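(* \textsc{ConsCheck: Matching}, parameterized by $k$, does not admit a fixed-parameter algorithm unless $\mathsf{FPT}=\mathsf{W}[2]$.
   Context: \textsc{ConsCheck: Matching}: Input: a finite vertex set $V$, labeled samples $(E_i,\lambda_i)_{i\in[t]}$ where each $G_i=(V,E_i)$ is a graph and $\lambda_i\in\{0,1\}$, and an integer $k$ (the parameter). Task: compute a set $F\subseteq\binom{V}{2}$ of size $k$ such that for each $i\in[t]$, $F$ forms a matching in $G_i$ (i.e., $F\subseteq E_i$ and the pairs in $F$ are pairwise vertex-disjoint) if and only if $\lambda_i=1$, or report that none exists. A fixed-parameter algorithm runs in time $f(k)\cdot|\mathcal{I}|^{\mathcal{O}(1)}$ for a computable $f$. *)

theory Defs
  imports Main
begin

section \<open>Deterministic multi-tape Turing machines\<close>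

text \<open>
  The tape alphabet is \<^typ>\<open>bool option\<close>, where \<^const>\<open>None\<close> is the blank.  A tape is
  infinite in both directions and is indexed relative to its head, which is always at cell 0; moving
  the head shifts the contents.
\<close>

datatype move = MoveL | MoveS | MoveR

type_synonym symb = "bool option"
type_synonym tape = "int \<Rightarrow> symb"

text \<open>
  The non-halting control states are \<open>0, \<dots>, tm_states M - 1\<close>, the start state is \<open>0\<close>, and every
  number \<open>\<ge> tm_states M\<close> is a halting state.  Only the finitely many values of \<open>tm_trans M\<close>
  at non-halting states and symbol lists of length \<open>tm_tapes M\<close> matter.
\<close>

record tm =
  tm_tapes :: nat
  tm_states :: nat
  tm_trans :: "nat \<Rightarrow> symb list \<Rightarrow> nat \<times> (symb \<times> move) list"

type_synonym config = "nat \<times> tape list"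

definition tm_wf :: "tm \<Rightarrow> bool" where
  "tm_wf M \<longleftrightarrow> 0 < tm_tapes M \<and>
     (\<forall>q < tm_states M. \<forall>ss. length ss = tm_tapes M \<longrightarrow>
        length (snd (tm_trans M q ss)) = tm_tapes M)"

fun move_offset :: "move \<Rightarrow> int" where
  "move_offset MoveL = -1"
| "move_offset MoveS = 0"
| "move_offset MoveR = 1"

definition tape_act :: "tape \<Rightarrow> symb \<times> move \<Rightarrow> tape" where
  "tape_act t a = (\<lambda>i. (t(0 := fst a)) (i + move_offset (snd a)))"

definition tm_step :: "tm \<Rightarrow> config \<Rightarrow> config" where
  "tm_step M c =
     (if tm_states M \<le> fst c then c
      else let r = tm_trans M (fst c) (map (\<lambda>t. t 0) (snd c))
           in (fst r, map2 tape_act (snd c) (snd r)))"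

definition input_tape :: "bool list \<Rightarrow> tape" where
  "input_tape w = (\<lambda>i. if 0 \<le> i \<and> i < int (length w) then Some (w ! nat i) else None)"

definition tm_init :: "tm \<Rightarrow> bool list \<Rightarrow> config" where
  "tm_init M w = (0, input_tape w # replicate (tm_tapes M - 1) (\<lambda>_. None))"

definition tape_holds :: "tape \<Rightarrow> bool list \<Rightarrow> bool" where
  "tape_holds t v \<longleftrightarrow>
     (\<forall>i < length v. t (int i) = Some (v ! i)) \<and> t (int (length v)) = None"

text \<open>
  On input \<open>w\<close>, \<open>M\<close> halts after at most \<open>T\<close> steps with output \<open>v\<close>; the output is read on the
  first tape from the head rightwards up to the first blank.  Halting configurations
  are fixed by \<^const>\<open>tm_step\<close>, so looking at step \<open>T\<close> amounts to ``at most \<open>T\<close> steps''.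
\<close>

definition tm_computes :: "tm \<Rightarrow> bool list \<Rightarrow> nat \<Rightarrow> bool list \<Rightarrow> bool" where
  "tm_computes M w T v \<longleftrightarrow>
     (let c = (tm_step M ^^ T) (tm_init M w)
      in tm_states M \<le> fst c \<and> tape_holds (hd (snd c)) v)"

definition computable_fun :: "(nat \<Rightarrow> nat) \<Rightarrow> bool" where
  "computable_fun f \<longleftrightarrow>
     (\<exists>M. tm_wf M \<and>
        (\<forall>k. \<exists>T. tm_computes M (replicate k True) T (replicate (f k) True)))"


section \<open>Parameterized problems, FPT and parameterized reductions\<close>

type_synonym param_problem = "(bool list \<times> nat) set"

text \<open>
  The instance \<open>(x, k)\<close> is given to a machine as one word, with the parameter in unary; the length
  of this word is the instance size.
\<close>

definition enc_instance :: "bool list \<Rightarrow> nat \<Rightarrow> bool list" where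
  "enc_instance x k = replicate k True @ False # x"

definition FPT :: "param_problem set" where
  "FPT = {L. \<exists>M f c. tm_wf M \<and> computable_fun f \<and>
     (\<forall>x k. tm_computes M (enc_instance x k)
              (f k * length (enc_instance x k) ^ c) [(x, k) \<in> L])}"

definition fpt_reducible :: "param_problem \<Rightarrow> param_problem \<Rightarrow> bool" where
  "fpt_reducible A B \<longleftrightarrow>
     (\<exists>M f g c. tm_wf M \<and> computable_fun f \<and> computable_fun g \<and>
        (\<forall>x k. \<exists>x' k'.
           tm_computes M (enc_instance x k)
             (f k * length (enc_instance x k) ^ c) (enc_instance x' k') \<and>
           k' \<le> g k \<and> ((x, k) \<in> A \<longleftrightarrow> (x', k') \<in> B)))"


section \<open>Encoding of finite objects as words\<close>

definition enc_nat :: "nat \<Rightarrow> bool list" where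
  "enc_nat n = replicate n True @ [False]"

definition enc_list :: "('a \<Rightarrow> bool list) \<Rightarrow> 'a list \<Rightarrow> bool list" where
  "enc_list enc xs = enc_nat (length xs) @ concat (map enc xs)"


section \<open>Boolean circuits and the W-hierarchy\<close>

text \<open>
  A circuit is a list of nodes in topological order: node \<open>j\<close> may only read nodes \<open>i < j\<close>, and the
  last node is the output.  Each \<open>InpG\<close> node is a variable of its own.  \<open>AndG []\<close> and \<open>OrG []\<close> are
  the constants true and false.
\<close>

datatype gate = InpG | NotG nat | AndG "nat list" | OrG "nat list"

type_synonym circuit = "gate list"

fun gate_args :: "gate \<Rightarrow> nat list" where
  "gate_args InpG = []"
| "gate_args (NotG i) = [i]"
| "gate_args (AndG is) = is"
| "gate_args (OrG is) = is"

definition circuit_wf :: "circuit \<Rightarrow> bool" where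
  "circuit_wf C \<longleftrightarrow> C \<noteq> [] \<and> (\<forall>j < length C. \<forall>i \<in> set (gate_args (C ! j)). i < j)"

definition circuit_inputs :: "circuit \<Rightarrow> nat set" where
  "circuit_inputs C = {j. j < length C \<and> C ! j = InpG}"

text \<open>
  Node-by-node evaluation: the value of node \<open>j\<close> is computed by \<open>h\<close> from \<open>j\<close>, the list of the values
  of nodes \<open>0, \<dots>, j - 1\<close>, and the gate at \<open>j\<close>.
\<close>

definition node_values :: "(nat \<Rightarrow> 'a list \<Rightarrow> gate \<Rightarrow> 'a) \<Rightarrow> circuit \<Rightarrow> 'a list" where
  "node_values h C = foldl (\<lambda>vs g. vs @ [h (length vs) vs g]) [] C"

fun gate_val :: "nat set \<Rightarrow> nat \<Rightarrow> bool list \<Rightarrow> gate \<Rightarrow> bool" where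
  "gate_val S j vs InpG = (j \<in> S)"
| "gate_val S j vs (NotG i) = (\<not> vs ! i)"
| "gate_val S j vs (AndG is) = (\<forall>i \<in> set is. vs ! i)"
| "gate_val S j vs (OrG is) = (\<exists>i \<in> set is. vs ! i)"

text \<open>\<open>S\<close> is the set of input nodes that are assigned true.\<close>

definition circuit_sat :: "circuit \<Rightarrow> nat set \<Rightarrow> bool" where
  "circuit_sat C S \<longleftrightarrow> last (node_values (gate_val S) C)"

definition gate_depth :: "nat \<Rightarrow> nat list \<Rightarrow> gate \<Rightarrow> nat" where
  "gate_depth j ds g =
     (if gate_args g = [] then 0 else Suc (Max ((!) ds ` set (gate_args g))))"

text \<open>Depth: the maximum length of a path ending in the output node.\<close>

definition circuit_depth :: "circuit \<Rightarrow> nat" where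
  "circuit_depth C = last (node_values gate_depth C)"

definition large_gate :: "gate \<Rightarrow> bool" where
  "large_gate g \<longleftrightarrow> 2 < length (gate_args g)"

definition gate_weft :: "nat \<Rightarrow> nat list \<Rightarrow> gate \<Rightarrow> nat" where
  "gate_weft j ws g =
     (if large_gate g then 1 else 0) + Max (insert 0 ((!) ws ` set (gate_args g)))"

text \<open>Weft: the maximum number of large gates on a path ending in the output node.\<close>

definition circuit_weft :: "circuit \<Rightarrow> nat" where
  "circuit_weft C = last (node_values gate_weft C)"

fun enc_gate :: "gate \<Rightarrow> bool list" where
  "enc_gate InpG = enc_nat 0"
| "enc_gate (NotG i) = enc_nat 1 @ enc_nat i"
| "enc_gate (AndG is) = enc_nat 2 @ enc_list enc_nat is"
| "enc_gate (OrG is) = enc_nat 3 @ enc_list enc_nat is"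

text \<open>
  Weighted circuit satisfiability for circuits of weft at most \<open>t\<close> and depth at most \<open>d\<close>: is there
  a satisfying assignment with exactly \<open>k\<close> inputs set to true?
\<close>

definition weighted_circuit_sat :: "nat \<Rightarrow> nat \<Rightarrow> param_problem" where
  "weighted_circuit_sat t d =
     {(enc_list enc_gate C, k) | C k.
        circuit_wf C \<and> circuit_weft C \<le> t \<and> circuit_depth C \<le> d \<and>
        (\<exists>S \<subseteq> circuit_inputs C. card S = k \<and> circuit_sat C S)}"

definition W_class :: "nat \<Rightarrow> param_problem set" where
  "W_class t = {L. \<exists>d \<ge> 1. fpt_reducible L (weighted_circuit_sat t d)}"


section \<open>Consistency checking for matchings\<close>

definition vertex_pairs :: "'v set \<Rightarrow> 'v set set" where
  "vertex_pairs V = {e. e \<subseteq> V \<and> card e = 2}"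

definition forms_matching :: "'v set set \<Rightarrow> 'v set set \<Rightarrow> bool" where
  "forms_matching E F \<longleftrightarrow> F \<subseteq> E \<and> pairwise disjnt F"

definition conscheck_matching_solution ::
  "'v set \<Rightarrow> ('v set set \<times> bool) list \<Rightarrow> nat \<Rightarrow> 'v set set \<Rightarrow> bool" where
  "conscheck_matching_solution V smp k F \<longleftrightarrow>
     F \<subseteq> vertex_pairs V \<and> card F = k \<and>
     (\<forall>(E, l) \<in> set smp. forms_matching E F \<longleftrightarrow> l)"

text \<open>
  For a machine, the vertices are numbered \<open>0, \<dots>, n - 1\<close>, and an edge set is given by a list of
  pairs of vertices (in any order, each pair in either orientation).
\<close>

type_synonym edge_list = "(nat \<times> nat) list"
type_synonym sample_list = "(edge_list \<times> bool) list"

definition edge_set :: "edge_list \<Rightarrow> nat set set" where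
  "edge_set es = {{u, v} | u v. (u, v) \<in> set es}"

definition valid_samples :: "nat \<Rightarrow> sample_list \<Rightarrow> bool" where
  "valid_samples n smp \<longleftrightarrow> (\<forall>(es, l) \<in> set smp. edge_set es \<subseteq> vertex_pairs {..<n})"

definition enc_edges :: "edge_list \<Rightarrow> bool list" where
  "enc_edges = enc_list (\<lambda>(u, v). enc_nat u @ enc_nat v)"

definition enc_samples :: "nat \<Rightarrow> sample_list \<Rightarrow> bool list" where
  "enc_samples n smp = enc_nat n @ enc_list (\<lambda>(es, l). enc_edges es @ [l]) smp"

text \<open>\<^const>\<open>None\<close> is the report that no solution exists.\<close>

fun enc_answer :: "edge_list option \<Rightarrow> bool list" where
  "enc_answer None = [False]"
| "enc_answer (Some es) = True # enc_edges es"

fun correct_answer :: "nat \<Rightarrow> sample_list \<Rightarrow> nat \<Rightarrow> edge_list option \<Rightarrow> bool" where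
  "correct_answer n smp k None \<longleftrightarrow>
     \<not> (\<exists>F. conscheck_matching_solution {..<n} (map (\<lambda>(es, l). (edge_set es, l)) smp) k F)"
| "correct_answer n smp k (Some fs) \<longleftrightarrow>
     conscheck_matching_solution {..<n} (map (\<lambda>(es, l). (edge_set es, l)) smp) k (edge_set fs)"

definition conscheck_matching_admits_fpt_algorithm :: bool where
  "conscheck_matching_admits_fpt_algorithm \<longleftrightarrow>
     (\<exists>M f c. tm_wf M \<and> computable_fun f \<and>
        (\<forall>n smp k. valid_samples n smp \<longrightarrow>
           (\<exists>ans. tm_computes M (enc_instance (enc_samples n smp) k)
                    (f k * length (enc_instance (enc_samples n smp) k) ^ c)
                    (enc_answer ans) \<and>
                  correct_answer n smp k ans)))"

end

theory Submission imports Defs begin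

text \<open>
  The consistency problem contains multicoloured hitting set: if the positive sample is a disjoint
  union of \<open>K\<close> stars, a matching of size \<open>K\<close> selects one edge from each star, and a negative sample
  demands that an edge outside of it is selected.

  Weighted satisfiability of circuits of weft 2 and depth \<open>d\<close> reduces to this in polynomial time.
  By distributivity at the small gates, a circuit is equivalent to a formula
  \<open>\<Or>\<^sub>\<gamma> \<And>\<^sub>\<upsilon> \<Or>\<^sub>\<epsilon> t\<close> of polynomial size whose terms \<open>t\<close> have at most \<open>q = 2\<^bsup>d+1\<^esup>\<close> literals.
  An assignment of weight \<open>k\<close> is the increasing list of its true variables; a literal of
  either sign is decided by two consecutive entries of this list, hence a term by \<open>2 q\<close> entries.
  There is one star for every \<open>2 q\<close>-tuple of positions, whose edges are the possible entries at
  these positions, and one star that selects \<open>\<gamma>\<close>.  The hitting sets force the tuples to be consistent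
  and every \<open>\<Or>\<^sub>\<epsilon> t\<close> of the selected disjunct to be true.

  An algorithm for the consistency problem then decides every problem in \<open>W[2]\<close>: the reduction
  to weighted satisfiability yields a parameter \<open>k' \<le> g k\<close>, and padding the list of true variables makes the
  number of stars a function of \<open>g k\<close>, so that the running time is controlled by \<open>k\<close>.
\<close>

section \<open>Programs on infinitely many tapes\<close>

text \<open>The classes are defined by concrete machines, so the reduction and its running time have
  to be programmed. Data are coded by self-delimiting words, \<open>poly\<close> is closed under
  composition, pairing and size-controlled folds, and for fixed \<open>d\<close> every recursion on
  \<open>d\<close> unrolls into a fixed composition; the reduction is then polynomial by its syntax.
  Distributing only at gates with at most two arguments multiplies at most two formulas per level,
  so constantly many levels stay polynomial. Two obstacles lie in the definition of a parameterized
  reduction. The weight \<open>k'\<close> that it produces is bounded by \<open>g k\<close> but is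
  not a function of \<open>k\<close>, while the running time of the assumed algorithm has an
  arbitrary computable factor in its parameter; hence the number of stars is computed from
  \<open>g k\<close>. To do so the decision procedure must run a machine for \<open>g\<close>, and
  \<open>computable_fun\<close> asserts that this machine halts without a computable bound on its
  time. Membership in \<open>FPT\<close> needs such a bound, and it comes from letting the machine
  count its own steps.\<close>

type_synonym tapes = "nat \<Rightarrow> tape"

text \<open>
  A program \<open>(N, \<delta>)\<close> has the states \<open>0, \<dots>, N - 1\<close>, starts in \<open>0\<close> and exits in state \<open>N\<close>.  It acts on
  infinitely many tapes, so that programs can be combined without a common number of tapes.
\<close>

type_synonym prog = "nat \<times> (nat \<Rightarrow> (nat \<Rightarrow> symb) \<Rightarrow> nat \<times> (nat \<Rightarrow> symb \<times> move))"

definition pstep :: "prog \<Rightarrow> nat \<times> tapes \<Rightarrow> nat \<times> tapes" where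
  "pstep P c =
     (if fst P \<le> fst c then c
      else let r = snd P (fst c) (\<lambda>i. snd c i 0)
           in (fst r, \<lambda>i. tape_act (snd c i) (snd r i)))"

definition runs :: "prog \<Rightarrow> tapes \<Rightarrow> nat \<Rightarrow> tapes \<Rightarrow> bool" where
  "runs P s T s' \<longleftrightarrow> (\<exists>t\<le>T. (pstep P ^^ t) (0, s) = (fst P, s'))"

text \<open>Locality in both directions: tapes from \<open>n\<close> on keep their contents and
  influence neither the control nor the other tapes. This turns a program into a machine with
  \<open>n\<close> tapes (\<open>to_tm\<close>) and lets it run beside foreign data
  (\<open>runs_frame\<close>).\<close>

definition uses :: "nat \<Rightarrow> prog \<Rightarrow> bool" where
  "uses n P \<longleftrightarrow> (\<forall>q rd.
     (\<forall>i\<ge>n. snd (snd P q rd) i = (rd i, MoveS)) \<and>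
     (\<forall>rd'. (\<forall>i<n. rd i = rd' i) \<longrightarrow>
        fst (snd P q rd) = fst (snd P q rd') \<and>
        (\<forall>i<n. snd (snd P q rd) i = snd (snd P q rd') i)))"

lemma runs_mono: "runs P s T s' \<Longrightarrow> T \<le> T' \<Longrightarrow> runs P s T' s'"
  unfolding runs_def using le_trans by blast

lemma uses_mono:
  assumes "uses n P" "n \<le> m" shows "uses m P"
  unfolding uses_def
proof (intro allI conjI impI)
  fix q rd i assume "m \<le> i"
  then show "snd (snd P q rd) i = (rd i, MoveS)" using assms by (auto simp: uses_def)
next
  fix q and rd rd' :: "nat \<Rightarrow> symb" assume *: "\<forall>i<m. rd i = rd' i"
  then have **: "\<forall>i<n. rd i = rd' i" using assms by auto
  then show "fst (snd P q rd) = fst (snd P q rd')" using assms unfolding uses_def by blast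
  fix i assume "i < m"
  show "snd (snd P q rd) i = snd (snd P q rd') i"
  proof (cases "i < n")
    case True then show ?thesis using assms ** unfolding uses_def by blast
  next
    case False then show ?thesis using assms * \<open>i < m\<close> unfolding uses_def by simp
  qed
qed

lemma uses_cong:
  assumes "uses n P" "\<And>i. i < n \<Longrightarrow> rd i = rd' i"
  shows "fst (snd P q rd) = fst (snd P q rd')"
    and "i < n \<Longrightarrow> snd (snd P q rd) i = snd (snd P q rd') i"
  using assms unfolding uses_def by blast+

lemma uses_cong_outside: "uses n P \<Longrightarrow> n \<le> i \<Longrightarrow> snd (snd P q rd) i = (rd i, MoveS)"
  by (auto simp: uses_def)

lemma tape_act_nop [simp]: "tape_act t (t 0, MoveS) = t"
  by (auto simp: tape_act_def fun_eq_iff)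

lemma funpow_fixpoint: "f x = x \<Longrightarrow> (f ^^ n) x = x"
  by (induction n) auto

lemma pstep_halted [simp]: "fst P \<le> q \<Longrightarrow> pstep P (q, s) = (q, s)"
  by (simp add: pstep_def)

text \<open>The map \<open>e\<close> embeds the states of \<open>P\<close> into those of a larger
  program \<open>R\<close>. The number of steps may drop because a halted \<open>P\<close> idles,
  whereas \<open>R\<close> in state \<open>e (fst P)\<close> may already go on with other code; the
  idle steps are discarded.\<close>

lemma simulate:
  assumes sim: "\<And>q s. q < fst P \<Longrightarrow>
      pstep R (e q, s) = (e (fst (pstep P (q, s))), snd (pstep P (q, s)))"
  shows "(pstep P ^^ t) (q, s) = (fst P, s') \<Longrightarrow>
      \<exists>t'\<le>t. (pstep R ^^ t') (e q, s) = (e (fst P), s')"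
proof (induction t arbitrary: q s)
  case 0
  then show ?case by auto
next
  case (Suc t)
  show ?case
  proof (cases "q < fst P")
    case True
    obtain q1 s1 where 1: "pstep P (q, s) = (q1, s1)" by fastforce
    with Suc.prems have "(pstep P ^^ t) (q1, s1) = (fst P, s')"
      by (simp add: funpow_Suc_right del: funpow.simps)
    from Suc.IH[OF this] obtain t' where "t' \<le> t"
      "(pstep R ^^ t') (e q1, s1) = (e (fst P), s')" by blast
    then have "(pstep R ^^ Suc t') (e q, s) = (e (fst P), s')"
      using sim[OF True, of s] 1 by (simp add: funpow_Suc_right del: funpow.simps)
    with \<open>t' \<le> t\<close> show ?thesis by (intro exI[of _ "Suc t'"]) auto
  next
    case False
    then have "(pstep P ^^ Suc t) (q, s) = (q, s)"
      by (intro funpow_fixpoint) simp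
    with Suc.prems show ?thesis by (intro exI[of _ 0]) auto
  qed
qed

text \<open>Every state from \<open>fst P\<close> on halts \<open>P\<close>; \<open>min\<close>
  sends all of them to \<open>fst P\<close>, which is the first state of \<open>Q\<close>
  here.\<close>

definition seqp :: "prog \<Rightarrow> prog \<Rightarrow> prog" (infixr ";;" 55) where
  "P ;; Q = (fst P + fst Q, \<lambda>q rd.
     if q < fst P then (let r = snd P q rd in (min (fst r) (fst P), snd r))
     else (let r = snd Q (q - fst P) rd in (fst P + min (fst r) (fst Q), snd r)))"

lemma runs_seq:
  assumes "runs P s T s1" "runs Q s1 T' s2"
  shows "runs (P ;; Q) s (T + T') s2"
proof -
  from assms obtain t t' where t: "t \<le> T" "(pstep P ^^ t) (0, s) = (fst P, s1)"
    and t': "t' \<le> T'" "(pstep Q ^^ t') (0, s1) = (fst Q, s2)" by (auto simp: runs_def)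
  have "\<exists>u\<le>t. (pstep (P ;; Q) ^^ u) (min 0 (fst P), s) = (min (fst P) (fst P), s1)"
    by (rule simulate[where e = "\<lambda>q. min q (fst P)", OF _ t(2)])
      (auto simp: pstep_def seqp_def Let_def)
  then obtain u where u: "u \<le> t" "(pstep (P ;; Q) ^^ u) (0, s) = (fst P, s1)" by auto
  have "\<exists>u\<le>t'. (pstep (P ;; Q) ^^ u) (fst P + min 0 (fst Q), s1) = (fst P + min (fst Q) (fst Q), s2)"
    by (rule simulate[where e = "\<lambda>q. fst P + min q (fst Q)", OF _ t'(2)])
      (auto simp: pstep_def seqp_def Let_def)
  then obtain u' where u': "u' \<le> t'" "(pstep (P ;; Q) ^^ u') (fst P, s1) = (fst P + fst Q, s2)" by auto
  have "(pstep (P ;; Q) ^^ (u' + u)) (0, s) = (fst (P ;; Q), s2)"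
    using u u' by (simp add: funpow_add seqp_def)
  moreover have "u' + u \<le> T + T'" using u u' t t' by auto
  ultimately show ?thesis unfolding runs_def by blast
qed

lemma uses_seq [intro]:
  assumes "uses n P" "uses n Q"
  shows "uses n (P ;; Q)"
  unfolding uses_def
proof (intro allI conjI impI)
  fix q rd j assume "n \<le> j"
  then show "snd (snd (P ;; Q) q rd) j = (rd j, MoveS)"
    using assms by (auto simp: seqp_def uses_def Let_def)
next
  fix q and rd rd' :: "nat \<Rightarrow> symb" assume *: "\<forall>i<n. rd i = rd' i"
  have 1: "fst (snd R q rd) = fst (snd R q rd') \<and> (\<forall>i<n. snd (snd R q rd) i = snd (snd R q rd') i)"
    if "uses n R" for R q using that * unfolding uses_def by blast
  show "fst (snd (P ;; Q) q rd) = fst (snd (P ;; Q) q rd')"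
    using 1[OF assms(1)] 1[OF assms(2)] by (simp add: seqp_def Let_def)
  fix j assume "j < n"
  then show "snd (snd (P ;; Q) q rd) j = snd (snd (P ;; Q) q rd') j"
    using 1[OF assms(1)] 1[OF assms(2)] by (simp add: seqp_def Let_def)
qed

definition actp :: "nat \<Rightarrow> (symb \<Rightarrow> symb) \<Rightarrow> move \<Rightarrow> prog" where
  "actp i w m = (1, \<lambda>q rd. (1, \<lambda>j. if j = i then (w (rd j), m) else (rd j, MoveS)))"

lemma runs_act: "runs (actp i w m) s 1 (s(i := tape_act (s i) (w (s i 0), m)))"
  unfolding runs_def by (rule exI[of _ 1]) (auto simp: actp_def pstep_def fun_eq_iff)

lemma uses_act [intro]: "i < n \<Longrightarrow> uses n (actp i w m)"
  by (auto simp: uses_def actp_def)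

text \<open>State 0 is the test, \<open>P\<close> and \<open>Q\<close> follow, and the exit of
  \<open>P\<close> has to jump over \<open>Q\<close>. An empty \<open>P\<close> needs its own case
  since state 1 then already belongs to \<open>Q\<close>.\<close>

definition ifp :: "nat \<Rightarrow> (symb \<Rightarrow> bool) \<Rightarrow> prog \<Rightarrow> prog \<Rightarrow> prog" where
  "ifp i b P Q = (1 + fst P + fst Q, \<lambda>q rd.
     if q = 0 then ((if b (rd i) then (if fst P = 0 then 1 + fst P + fst Q else 1) else 1 + fst P),
        \<lambda>j. (rd j, MoveS))
     else if q < 1 + fst P then
       (let r = snd P (q - 1) rd
        in (if fst r < fst P then 1 + fst r else 1 + fst P + fst Q, snd r))
     else (let r = snd Q (q - 1 - fst P) rd in (1 + fst P + min (fst r) (fst Q), snd r)))"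

lemma runs_if_true:
  assumes "b (s i 0)" "runs P s T s'"
  shows "runs (ifp i b P Q) s (Suc T) s'"
proof -
  from assms obtain t where t: "t \<le> T" "(pstep P ^^ t) (0, s) = (fst P, s')" by (auto simp: runs_def)
  let ?e = "\<lambda>q. if q < fst P then 1 + q else 1 + fst P + fst Q"
  have "\<exists>u\<le>t. (pstep (ifp i b P Q) ^^ u) (?e 0, s) = (?e (fst P), s')"
    by (rule simulate[where e = ?e, OF _ t(2)]) (auto simp: pstep_def ifp_def Let_def)
  then obtain u where u: "u \<le> t" "(pstep (ifp i b P Q) ^^ u) (?e 0, s) = (1 + fst P + fst Q, s')"
    by auto
  moreover have "pstep (ifp i b P Q) (0, s) = (?e 0, s)"
    using assms(1) by (auto simp: pstep_def ifp_def Let_def)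
  ultimately have "(pstep (ifp i b P Q) ^^ Suc u) (0, s) = (fst (ifp i b P Q), s')"
    by (simp add: funpow_Suc_right ifp_def del: funpow.simps)
  then show ?thesis unfolding runs_def using u t by (intro exI[of _ "Suc u"]) auto
qed

lemma runs_if_false:
  assumes "\<not> b (s i 0)" "runs Q s T s'"
  shows "runs (ifp i b P Q) s (Suc T) s'"
proof -
  from assms obtain t where t: "t \<le> T" "(pstep Q ^^ t) (0, s) = (fst Q, s')" by (auto simp: runs_def)
  let ?e = "\<lambda>q. 1 + fst P + min q (fst Q)"
  have "\<exists>u\<le>t. (pstep (ifp i b P Q) ^^ u) (?e 0, s) = (?e (fst Q), s')"
    by (rule simulate[where e = ?e, OF _ t(2)]) (auto simp: pstep_def ifp_def Let_def)
  then obtain u where u: "u \<le> t" "(pstep (ifp i b P Q) ^^ u) (1 + fst P, s) = (1 + fst P + fst Q, s')"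
    by auto
  moreover have "pstep (ifp i b P Q) (0, s) = (1 + fst P, s)"
    using assms(1) by (auto simp: pstep_def ifp_def Let_def)
  ultimately have "(pstep (ifp i b P Q) ^^ Suc u) (0, s) = (fst (ifp i b P Q), s')"
    by (simp add: funpow_Suc_right ifp_def del: funpow.simps)
  then show ?thesis unfolding runs_def using u t by (intro exI[of _ "Suc u"]) auto
qed

lemma uses_if [intro]:
  assumes "i < n" "uses n P" "uses n Q"
  shows "uses n (ifp i b P Q)"
  unfolding uses_def
proof (intro allI conjI impI)
  fix q rd j assume "n \<le> j"
  then show "snd (snd (ifp i b P Q) q rd) j = (rd j, MoveS)"
    using assms by (auto simp: ifp_def uses_def Let_def)
next
  fix q and rd rd' :: "nat \<Rightarrow> symb" assume *: "\<forall>i<n. rd i = rd' i"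
  have 1: "fst (snd R q rd) = fst (snd R q rd') \<and> (\<forall>i<n. snd (snd R q rd) i = snd (snd R q rd') i)"
    if "uses n R" for R q using that * unfolding uses_def by blast
  have 2: "rd i = rd' i" using * assms by blast
  show "fst (snd (ifp i b P Q) q rd) = fst (snd (ifp i b P Q) q rd')"
    using 1[OF assms(2)] 1[OF assms(3)] 2 by (simp add: ifp_def Let_def)
  fix j assume "j < n"
  then show "snd (snd (ifp i b P Q) q rd) j = snd (snd (ifp i b P Q) q rd') j"
    using 1[OF assms(2)] 1[OF assms(3)] 2 * by (simp add: ifp_def Let_def)
qed

definition whilep :: "nat \<Rightarrow> (symb \<Rightarrow> bool) \<Rightarrow> prog \<Rightarrow> prog" where
  "whilep i b P = (1 + fst P, \<lambda>q rd.
     if q = 0 then ((if b (rd i) then (if fst P = 0 then 0 else 1) else 1 + fst P), \<lambda>j. (rd j, MoveS))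
     else (let r = snd P (q - 1) rd in (if fst r < fst P then 1 + fst r else 0, snd r)))"

lemma runs_while_done:
  assumes "\<not> b (s i 0)"
  shows "runs (whilep i b P) s 1 s"
  unfolding runs_def using assms by (intro exI[of _ 1]) (auto simp: whilep_def pstep_def)

lemma runs_while_step:
  assumes "b (s i 0)" "runs P s T s1" "runs (whilep i b P) s1 T' s2"
  shows "runs (whilep i b P) s (Suc T + T') s2"
proof -
  from assms obtain t t' where t: "t \<le> T" "(pstep P ^^ t) (0, s) = (fst P, s1)"
    and t': "t' \<le> T'" "(pstep (whilep i b P) ^^ t') (0, s1) = (fst (whilep i b P), s2)"
    by (auto simp: runs_def)
  let ?e = "\<lambda>q. if q < fst P then 1 + q else 0"
  have "\<exists>u\<le>t. (pstep (whilep i b P) ^^ u) (?e 0, s) = (?e (fst P), s1)"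
    by (rule simulate[where e = ?e, OF _ t(2)]) (auto simp: pstep_def whilep_def Let_def)
  then obtain u where u: "u \<le> t" "(pstep (whilep i b P) ^^ u) (?e 0, s) = (0, s1)"
    by auto
  moreover have "pstep (whilep i b P) (0, s) = (?e 0, s)"
    using assms(1) by (auto simp: pstep_def whilep_def Let_def)
  ultimately have "(pstep (whilep i b P) ^^ Suc u) (0, s) = (0, s1)"
    by (simp add: funpow_Suc_right del: funpow.simps)
  then have "(pstep (whilep i b P) ^^ (t' + Suc u)) (0, s) = (fst (whilep i b P), s2)"
    by (simp only: funpow_add o_apply t')
  then show ?thesis unfolding runs_def using u t t' by (intro exI[of _ "t' + Suc u"]) auto
qed

lemma uses_while [intro]:
  assumes "i < n" "uses n P"
  shows "uses n (whilep i b P)"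
  unfolding uses_def
proof (intro allI conjI impI)
  fix q rd j assume "n \<le> j"
  then show "snd (snd (whilep i b P) q rd) j = (rd j, MoveS)"
    using assms by (auto simp: whilep_def uses_def Let_def)
next
  fix q and rd rd' :: "nat \<Rightarrow> symb" assume *: "\<forall>i<n. rd i = rd' i"
  have 1: "fst (snd R q rd) = fst (snd R q rd') \<and> (\<forall>i<n. snd (snd R q rd) i = snd (snd R q rd') i)"
    if "uses n R" for R q using that * unfolding uses_def by blast
  have 2: "rd i = rd' i" using * assms by blast
  show "fst (snd (whilep i b P) q rd) = fst (snd (whilep i b P) q rd')"
    using 1[OF assms(2)] 2 by (simp add: whilep_def Let_def)
  fix j assume "j < n"
  then show "snd (snd (whilep i b P) q rd) j = snd (snd (whilep i b P) q rd') j"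
    using 1[OF assms(2)] 2 * by (simp add: whilep_def Let_def)
qed

section \<open>Relocating a program to a block of tapes, and the frame rule\<close>

definition shiftp :: "nat \<Rightarrow> prog \<Rightarrow> prog" where
  "shiftp d P = (fst P, \<lambda>q rd. let r = snd P q (\<lambda>i. rd (i + d))
     in (fst r, \<lambda>i. if i < d then (rd i, MoveS) else snd r (i - d)))"

lemma pstep_shift:
  "pstep (shiftp d P) (q, s) =
     (fst (pstep P (q, \<lambda>i. s (i + d))),
      \<lambda>i. if i < d then s i else snd (pstep P (q, \<lambda>i. s (i + d))) (i - d))"
  by (auto simp: pstep_def shiftp_def Let_def fun_eq_iff)

lemma runs_shift:
  assumes "runs P (\<lambda>i. s (i + d)) T s'"
  shows "runs (shiftp d P) s T (\<lambda>i. if i < d then s i else s' (i - d))"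
proof -
  have *: "(pstep (shiftp d P) ^^ t) (0, s) =
     (fst ((pstep P ^^ t) (0, \<lambda>i. s (i + d))),
      \<lambda>i. if i < d then s i else snd ((pstep P ^^ t) (0, \<lambda>i. s (i + d))) (i - d))" for t
    by (induction t) (auto simp: pstep_shift)
  from assms obtain t where "t \<le> T" "(pstep P ^^ t) (0, \<lambda>i. s (i + d)) = (fst P, s')"
    by (auto simp: runs_def)
  then show ?thesis using *[of t] unfolding runs_def
    by (intro exI[of _ t]) (auto simp: shiftp_def)
qed

lemma uses_shift [intro]:
  assumes "uses n P" "n + d \<le> m"
  shows "uses m (shiftp d P)"
  unfolding uses_def
proof (intro allI conjI impI)
  fix q rd j assume "m \<le> j"
  then show "snd (snd (shiftp d P) q rd) j = (rd j, MoveS)"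
    using assms by (auto simp: shiftp_def uses_def Let_def)
next
  fix q and rd rd' :: "nat \<Rightarrow> symb" assume *: "\<forall>i<m. rd i = rd' i"
  then have "\<And>i. i < n \<Longrightarrow> rd (i + d) = rd' (i + d)" using assms by auto
  note 1 = uses_cong[OF assms(1), of "\<lambda>i. rd (i + d)" "\<lambda>i. rd' (i + d)", OF this]
  show "fst (snd (shiftp d P) q rd) = fst (snd (shiftp d P) q rd')"
    using 1 by (simp add: shiftp_def Let_def)
  fix j assume "j < m"
  then show "snd (snd (shiftp d P) q rd) j = snd (snd (shiftp d P) q rd') j"
    using 1 * by (cases "j - d < n") (auto simp: shiftp_def Let_def uses_cong_outside[OF assms(1)])
qed

lemma runs_outside:
  assumes "uses n P" "runs P s T s'" "n \<le> i"
  shows "s' i = s i"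
proof -
  have 1: "snd (pstep P c) i = snd c i" for c
    using assms(1,3) by (auto simp: uses_def pstep_def Let_def)
  have "snd ((pstep P ^^ t) (0, s)) i = s i" for t
    by (induction t) (auto simp: 1)
  then show ?thesis using assms(2) unfolding runs_def by (metis snd_conv)
qed

text \<open>The first \<open>n\<close> tapes evolve as in the given run, whatever stands on the
  others, because neither the control nor these tapes depend on them.\<close>

lemma runs_frame:
  assumes "uses n P" "runs P s T s'" "\<And>i. i < n \<Longrightarrow> u i = s i"
  shows "runs P u T (\<lambda>i. if i < n then s' i else u i)"
proof -
  have 1: "pstep P (q, \<lambda>i. if i < n then s i else u i) =
      (fst (pstep P (q, s)), \<lambda>i. if i < n then snd (pstep P (q, s)) i else u i)" for q s
  proof (cases "fst P \<le> q")
    case False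
    let ?v = "\<lambda>i. if i < n then s i else u i"
    have 2: "fst (snd P q (\<lambda>i. ?v i 0)) = fst (snd P q (\<lambda>i. s i 0))"
      "\<And>i. i < n \<Longrightarrow> snd (snd P q (\<lambda>i. ?v i 0)) i = snd (snd P q (\<lambda>i. s i 0)) i"
      by (rule uses_cong[OF assms(1)]; simp)+
    have 3: "snd (snd P q (\<lambda>i. ?v i 0)) i = (u i 0, MoveS)" if "\<not> i < n" for i
      using assms(1) that unfolding uses_def by simp
    show ?thesis using False 2 3 by (auto simp: pstep_def Let_def fun_eq_iff)
  qed (auto simp: fun_eq_iff)
  have *: "(pstep P ^^ t) (0, u) = (fst ((pstep P ^^ t) (0, s)),
      \<lambda>i. if i < n then snd ((pstep P ^^ t) (0, s)) i else u i)" for t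
  proof (induction t)
    case 0
    show ?case using assms(3) by (auto simp: fun_eq_iff)
  next
    case (Suc t)
    show ?case using 1[of "fst ((pstep P ^^ t) (0, s))" "snd ((pstep P ^^ t) (0, s))"] Suc
      by (simp cong: if_cong)
  qed
  from assms(2) obtain t where "t \<le> T" "(pstep P ^^ t) (0, s) = (fst P, s')"
    by (auto simp: runs_def)
  then show ?thesis using *[of t] unfolding runs_def by (intro exI[of _ t]) auto
qed

section \<open>Programs and Turing machines\<close>

definition to_tm :: "nat \<Rightarrow> prog \<Rightarrow> tm" where
  "to_tm n P = \<lparr>tm_tapes = n, tm_states = fst P,
     tm_trans = \<lambda>q ss. let r = snd P q (\<lambda>i. if i < n then ss ! i else None)
       in (fst r, map (snd r) [0..<n])\<rparr>"

definition start :: "bool list \<Rightarrow> tapes" where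
  "start w = (\<lambda>i. if i = 0 then input_tape w else input_tape [])"

lemma input_tape_Nil: "input_tape [] = (\<lambda>_. None)"
  by (simp add: input_tape_def fun_eq_iff)

lemma tm_step_to_tm:
  assumes "uses n P"
  shows "tm_step (to_tm n P) (q, map s [0..<n]) =
     (fst (pstep P (q, s)), map (snd (pstep P (q, s))) [0..<n])"
proof (cases "fst P \<le> q")
  case False
  let ?rd = "\<lambda>i. if i < n then map (\<lambda>i. s i 0) [0..<n] ! i else None"
  have "fst (snd P q ?rd) = fst (snd P q (\<lambda>i. s i 0))"
    "\<And>i. i < n \<Longrightarrow> snd (snd P q ?rd) i = snd (snd P q (\<lambda>i. s i 0)) i"
    by (rule uses_cong[OF assms]; simp)+
  then show ?thesis using False
    by (auto simp: tm_step_def to_tm_def pstep_def Let_def comp_def intro!: nth_equalityI)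
qed (simp add: tm_step_def to_tm_def)

lemma tm_computes_to_tm:
  assumes "uses n P" "0 < n" "runs P (start w) T s'" "tape_holds (s' 0) v"
  shows "tm_computes (to_tm n P) w T v"
proof -
  have init: "tm_init (to_tm n P) w = (0, map (start w) [0..<n])"
    using assms(2)
    by (auto simp: tm_init_def to_tm_def start_def input_tape_Nil nth_Cons' intro!: nth_equalityI)
  have *: "(tm_step (to_tm n P) ^^ t) (0, map (start w) [0..<n]) =
      (fst ((pstep P ^^ t) (0, start w)), map (snd ((pstep P ^^ t) (0, start w))) [0..<n])" for t
  proof (induction t)
    case (Suc t)
    show ?case using tm_step_to_tm[OF assms(1), of "fst ((pstep P ^^ t) (0, start w))"
        "snd ((pstep P ^^ t) (0, start w))"] Suc by simp
  qed simp
  from assms(3) obtain t where t: "t \<le> T" "(pstep P ^^ t) (0, start w) = (fst P, s')"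
    by (auto simp: runs_def)
  have "(pstep P ^^ T) (0, start w) = (pstep P ^^ (T - t)) ((pstep P ^^ t) (0, start w))"
    using t(1) by (simp flip: funpow_add[unfolded comp_def, THEN fun_cong])
  also have "\<dots> = (fst P, s')" unfolding t(2) by (rule funpow_fixpoint) simp
  finally show ?thesis using assms(2,4) unfolding tm_computes_def init *
    by (auto simp: to_tm_def hd_map)
qed

lemma tm_wf_to_tm: "0 < n \<Longrightarrow> tm_wf (to_tm n P)"
  by (simp add: tm_wf_def to_tm_def Let_def)

text \<open>A machine may halt in any state from \<open>tm_states M\<close> on, a program exits in
  one particular state; \<open>min\<close> identifies them.\<close>

definition of_tm :: "tm \<Rightarrow> prog" where
  "of_tm M = (tm_states M, \<lambda>q rd. let r = tm_trans M q (map rd [0..<tm_tapes M])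
     in (min (fst r) (tm_states M), \<lambda>i. if i < tm_tapes M then snd r ! i else (rd i, MoveS)))"

lemma uses_of_tm: "uses (tm_tapes M) (of_tm M)"
  unfolding uses_def
proof (intro allI conjI impI)
  fix q and rd rd' :: "nat \<Rightarrow> symb" assume "\<forall>i<tm_tapes M. rd i = rd' i"
  then have "map rd [0..<tm_tapes M] = map rd' [0..<tm_tapes M]" by auto
  then show "fst (snd (of_tm M) q rd) = fst (snd (of_tm M) q rd')"
    "\<And>i. i < tm_tapes M \<Longrightarrow> snd (snd (of_tm M) q rd) i = snd (snd (of_tm M) q rd') i"
    by (simp_all add: of_tm_def Let_def del: map_eq_conv)
qed (simp add: of_tm_def Let_def)

lemma pstep_of_tm:
  assumes "tm_wf M" "snd c = map s [0..<tm_tapes M]"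
  shows "fst (pstep (of_tm M) (min (fst c) (tm_states M), s)) = min (fst (tm_step M c)) (tm_states M)"
    "snd (tm_step M c) =
      map (snd (pstep (of_tm M) (min (fst c) (tm_states M), s))) [0..<tm_tapes M]"
proof -
  have eq: "map (\<lambda>i. s i 0) [0..<tm_tapes M] = map (\<lambda>t. t 0) (snd c)" using assms(2) by simp
  show "fst (pstep (of_tm M) (min (fst c) (tm_states M), s)) = min (fst (tm_step M c)) (tm_states M)"
    by (auto simp: pstep_def of_tm_def tm_step_def Let_def eq)
  show "snd (tm_step M c) =
      map (snd (pstep (of_tm M) (min (fst c) (tm_states M), s))) [0..<tm_tapes M]"
    using assms eq
    by (auto simp: pstep_def of_tm_def tm_step_def Let_def tm_wf_def comp_def intro!: nth_equalityI)
qed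

lemma of_tm_steps:
  assumes "tm_wf M"
  shows "fst ((pstep (of_tm M) ^^ t) (0, start w)) = min (fst ((tm_step M ^^ t) (tm_init M w))) (tm_states M)"
    and "snd ((tm_step M ^^ t) (tm_init M w)) =
      map (snd ((pstep (of_tm M) ^^ t) (0, start w))) [0..<tm_tapes M]"
proof -
  have "fst ((pstep (of_tm M) ^^ t) (0, start w)) = min (fst ((tm_step M ^^ t) (tm_init M w))) (tm_states M)
    \<and> snd ((tm_step M ^^ t) (tm_init M w)) =
      map (snd ((pstep (of_tm M) ^^ t) (0, start w))) [0..<tm_tapes M]"
  proof (induction t)
    case 0
    have "0 < tm_tapes M" using assms by (simp add: tm_wf_def)
    then show ?case
      by (auto simp: tm_init_def start_def input_tape_Nil nth_Cons' intro!: nth_equalityI)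
  next
    case (Suc t)
    let ?c = "(tm_step M ^^ t) (tm_init M w)" and ?p = "(pstep (of_tm M) ^^ t) (0, start w)"
    have "?p = (min (fst ?c) (tm_states M), snd ?p)" using Suc by (simp add: prod_eq_iff)
    then show ?case using pstep_of_tm[OF assms conjunct2[OF Suc]] by simp
  qed
  then show "fst ((pstep (of_tm M) ^^ t) (0, start w)) = min (fst ((tm_step M ^^ t) (tm_init M w))) (tm_states M)"
    "snd ((tm_step M ^^ t) (tm_init M w)) =
      map (snd ((pstep (of_tm M) ^^ t) (0, start w))) [0..<tm_tapes M]" by auto
qed

lemma runs_of_tm:
  assumes "tm_wf M" "tm_computes M w T v"
  shows "\<exists>s'. runs (of_tm M) (start w) T s' \<and> tape_holds (s' 0) v"
proof -
  let ?p = "(pstep (of_tm M) ^^ T) (0, start w)"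
  have 0: "0 < tm_tapes M" using assms(1) by (simp add: tm_wf_def)
  have "fst ?p = tm_states M" "tape_holds (snd ?p 0) v"
    using assms(2) of_tm_steps[OF assms(1), of T w] 0
    by (auto simp: tm_computes_def Let_def hd_map)
  then show ?thesis unfolding runs_def
    by (intro exI[of _ "snd ?p"] conjI exI[of _ T]) (auto simp: of_tm_def prod_eq_iff)
qed

section \<open>Tapes as stacks\<close>

lemma runs_cong: "runs P s T s' \<Longrightarrow> s = u \<Longrightarrow> s' = u' \<Longrightarrow> T \<le> T' \<Longrightarrow> runs P u T' u'"
  by (auto intro: runs_mono)

definition stack_top :: "bool list \<Rightarrow> symb" where
  "stack_top xs = (case xs of [] \<Rightarrow> None | x # _ \<Rightarrow> Some x)"

lemma stack_top_simps [simp]: "stack_top [] = None" "stack_top (x # xs) = Some x"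
  by (auto simp: stack_top_def)

lemma stack_top_eq_None [simp]: "stack_top xs = None \<longleftrightarrow> xs = []"
  by (cases xs) auto

text \<open>\<open>tape_act\<close> writes before it moves, so a push first copies the scanned
  symbol while moving left and then writes in place. Stacks grow to the left, with the top under the
  head.\<close>

definition pusht :: "bool \<Rightarrow> tape \<Rightarrow> tape" where
  "pusht b t = tape_act (tape_act t (t 0, MoveL)) (Some b, MoveS)"

definition popt :: "tape \<Rightarrow> tape" where
  "popt t = tape_act t (None, MoveR)"

lemma input_tape_0 [simp]: "input_tape xs 0 = stack_top xs"
  by (cases xs) (auto simp: input_tape_def)

lemma pusht_input [simp]: "pusht b (input_tape xs) = input_tape (b # xs)"
  by (auto simp: pusht_def tape_act_def input_tape_def fun_eq_iff nth_Cons' nat_diff_distrib)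

lemma popt_input [simp]: "popt (input_tape xs) = input_tape (tl xs)"
  by (cases xs) (auto simp: popt_def tape_act_def input_tape_def fun_eq_iff nth_Cons' nat_add_distrib)

lemma tape_holds_input: "tape_holds (input_tape xs) xs"
  by (auto simp: tape_holds_def input_tape_def)

lemma tape_holds_top: "tape_holds t xs \<Longrightarrow> t 0 = stack_top xs"
  by (cases xs) (auto simp: tape_holds_def)

text \<open>\<open>tape_holds\<close> ignores what lies left of the head and beyond the first blank.
  Unlike \<open>input_tape\<close> it therefore fits the output of an arbitrary machine.\<close>

lemma tape_holds_push:
  assumes "tape_holds t xs" shows "tape_holds (pusht b t) (b # xs)"
proof -
  have "t (int i - 1) = Some (xs ! (i - 1))" if "0 < i" "i < Suc (length xs)" for i
    using assms that by (auto simp: tape_holds_def of_nat_diff dest!: spec[of _ "i - 1"])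
  then show ?thesis using assms by (auto simp: tape_holds_def pusht_def tape_act_def nth_Cons')
qed

lemma tape_holds_pop:
  assumes "tape_holds t (x # xs)" shows "tape_holds (popt t) xs"
proof -
  have "t (int i + 1) = Some (xs ! i)" if "i < length xs" for i
    using assms that by (auto simp: tape_holds_def dest!: spec[of _ "Suc i"] simp: add.commute)
  then show ?thesis using assms by (auto simp: tape_holds_def popt_def tape_act_def add.commute)
qed

definition pushp :: "nat \<Rightarrow> bool \<Rightarrow> prog" where
  "pushp i b = actp i (\<lambda>x. x) MoveL ;; actp i (\<lambda>_. Some b) MoveS"

definition popp :: "nat \<Rightarrow> prog" where
  "popp i = actp i (\<lambda>_. None) MoveR"

definition mvbit :: "nat \<Rightarrow> nat \<Rightarrow> prog" where
  "mvbit i j = ifp i (\<lambda>x. x = Some True) (popp i ;; pushp j True) (popp i ;; pushp j False)"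

definition mvp :: "nat \<Rightarrow> nat \<Rightarrow> prog" where
  "mvp i j = whilep i (\<lambda>x. x \<noteq> None) (mvbit i j)"

definition mv2p :: "nat \<Rightarrow> nat \<Rightarrow> nat \<Rightarrow> prog" where
  "mv2p i j k = whilep i (\<lambda>x. x \<noteq> None)
     (ifp i (\<lambda>x. x = Some True) (popp i ;; pushp j True ;; pushp k True)
        (popp i ;; pushp j False ;; pushp k False))"

definition clearp :: "nat \<Rightarrow> prog" where
  "clearp i = whilep i (\<lambda>x. x \<noteq> None) (popp i)"

definition skipp :: prog where
  "skipp = (0, \<lambda>q rd. (0, \<lambda>j. (rd j, MoveS)))"

lemma runs_skip: "runs skipp s 0 s"
  by (auto simp: runs_def skipp_def)

lemma uses_basic [intro]:
  "i < n \<Longrightarrow> uses n (pushp i b)"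
  "i < n \<Longrightarrow> uses n (popp i)"
  "i < n \<Longrightarrow> j < n \<Longrightarrow> uses n (mvbit i j)"
  "i < n \<Longrightarrow> j < n \<Longrightarrow> uses n (mvp i j)"
  "i < n \<Longrightarrow> j < n \<Longrightarrow> k < n \<Longrightarrow> uses n (mv2p i j k)"
  "i < n \<Longrightarrow> uses n (clearp i)"
  "uses n skipp"
  unfolding pushp_def popp_def mvbit_def mvp_def mv2p_def clearp_def
  by (intro uses_seq uses_act uses_if uses_while; assumption)+ (simp add: uses_def skipp_def)

lemma runs_push: "runs (pushp i b) s 2 (s(i := pusht b (s i)))"
  using runs_seq[OF runs_act[of i "\<lambda>x. x" MoveL s] runs_act[of i "\<lambda>_. Some b" MoveS]]
  by (simp add: pushp_def pusht_def numeral_2_eq_2)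

lemma runs_pop: "runs (popp i) s 1 (s(i := popt (s i)))"
  unfolding popp_def popt_def by (rule runs_act)

lemma runs_mvbit:
  assumes "s i 0 = Some b" "i \<noteq> j"
  shows "runs (mvbit i j) s 4 (s(i := popt (s i), j := pusht b (s j)))"
proof -
  have "runs (popp i ;; pushp j c) s 3 (s(i := popt (s i), j := pusht c (s j)))" for c
    using runs_seq[OF runs_pop[of i s] runs_push[of j c "s(i := popt (s i))"]] assms by (simp add: numeral_3_eq_3)
  then have "runs (mvbit i j) s (Suc 3) (s(i := popt (s i), j := pusht b (s j)))"
    unfolding mvbit_def using assms(1)
    by (cases b; simp only:) (rule runs_if_true runs_if_false; simp)+
  then show ?thesis by simp
qed

text \<open>Stated for \<open>tape_holds\<close>, since it also copies outputs that are surrounded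
  by garbage; the contents of tape \<open>j\<close> are arbitrary.\<close>

lemma runs_mv:
  assumes "tape_holds (s i) xs" "i \<noteq> j"
  shows "runs (mvp i j) s (5 * length xs + 1)
    (s(i := (popt ^^ length xs) (s i), j := fold pusht xs (s j)))"
  using assms
proof (induction xs arbitrary: s)
  case Nil
  then show ?case using runs_while_done[of "\<lambda>x. x \<noteq> None" s i "mvbit i j"]
    by (auto simp: mvp_def dest: tape_holds_top)
next
  case (Cons x xs)
  have h: "s i 0 = Some x" using tape_holds_top[OF Cons.prems(1)] by simp
  let ?s = "s(i := popt (s i), j := pusht x (s j))"
  have "tape_holds (?s i) xs" using tape_holds_pop[OF Cons.prems(1)] Cons.prems(2) by simp
  note IH = Cons.IH[of ?s, OF this Cons.prems(2)]
  have *: "runs (whilep i (\<lambda>x. x \<noteq> None) (mvbit i j)) ?s (5 * length xs + 1)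
     (s(i := (popt ^^ length (x # xs)) (s i), j := fold pusht (x # xs) (s j)))"
    unfolding mvp_def[symmetric] using Cons.prems(2)
    by (intro runs_cong[OF IH]) (auto simp: fun_eq_iff funpow_swap1)
  have "runs (mvp i j) s (Suc 4 + (5 * length xs + 1))
     (s(i := (popt ^^ length (x # xs)) (s i), j := fold pusht (x # xs) (s j)))"
    unfolding mvp_def
    by (rule runs_while_step[OF _ runs_mvbit[of s i x j, OF h Cons.prems(2)] *]) (simp add: h)
  then show ?case by (rule runs_cong) auto
qed

section \<open>Runs between tapes that hold one word each and nothing else\<close>

type_synonym regs = "nat \<Rightarrow> bool list"

definition st :: "regs \<Rightarrow> tapes" where
  "st r = (\<lambda>i. input_tape (r i))"

abbreviation rruns :: "prog \<Rightarrow> regs \<Rightarrow> nat \<Rightarrow> regs \<Rightarrow> bool" where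
  "rruns P r T r' \<equiv> runs P (st r) T (st r')"

definition reg :: "bool list \<Rightarrow> regs" where
  "reg w = (\<lambda>_. [])(0 := w)"

lemma st_reg: "st (reg w) = start w"
  by (auto simp: st_def reg_def start_def)

lemma rruns_cong:
  "runs P (st r) T (st r') \<Longrightarrow> r = u \<Longrightarrow> r' = u' \<Longrightarrow> T \<le> T' \<Longrightarrow> runs P (st u) T' (st u')"
  by (auto intro: runs_mono)

lemma st_top [simp]: "st r i 0 = stack_top (r i)"
  by (simp add: st_def)

lemma fold_pusht_input [simp]: "fold pusht xs (input_tape ys) = input_tape (rev xs @ ys)"
  by (induction xs arbitrary: ys) auto

lemma popt_pow_input [simp]: "(popt ^^ n) (input_tape xs) = input_tape (drop n xs)"
  by (induction n) (auto simp: drop_Suc tl_drop)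

lemma tape_holds_fold_pusht: "tape_holds t ys \<Longrightarrow> tape_holds (fold pusht xs t) (rev xs @ ys)"
  by (induction xs arbitrary: t ys) (auto dest: tape_holds_push)

lemma rruns_push: "r' = r(i := b # r i) \<Longrightarrow> rruns (pushp i b) r 2 r'"
  by (rule runs_cong[OF runs_push[of i b "st r"]]) (auto simp: st_def fun_eq_iff)

lemma rruns_pop: "r' = r(i := tl (r i)) \<Longrightarrow> rruns (popp i) r 1 r'"
  by (rule runs_cong[OF runs_pop[of i "st r"]]) (auto simp: st_def fun_eq_iff)

lemma rruns_mv:
  assumes "i \<noteq> j" "r' = r(i := [], j := rev (r i) @ r j)" "T = 5 * length (r i) + 1"
  shows "rruns (mvp i j) r T r'"
proof (rule runs_cong[OF runs_mv[of "st r" i "r i" j]])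
  show "tape_holds (st r i) (r i)" by (simp add: st_def tape_holds_input)
qed (use assms in \<open>auto simp: st_def\<close>)

lemma rruns_mv2:
  assumes "i \<noteq> j" "i \<noteq> k" "j \<noteq> k" "r' = r(i := [], j := rev (r i) @ r j, k := rev (r i) @ r k)"
    "T = 7 * length (r i) + 1"
  shows "rruns (mv2p i j k) r T r'"
proof -
  have "rruns (mv2p i j k) r (7 * length xs + 1)
     (r(i := [], j := rev xs @ r j, k := rev xs @ r k))" if "r i = xs" for xs
    using that
  proof (induction xs arbitrary: r)
    case Nil
    then have "\<not> st r i 0 \<noteq> None" by simp
    with Nil show ?case unfolding mv2p_def
      by (intro rruns_cong[OF runs_while_done[where s = "st r"]]) (auto simp: fun_eq_iff)
  next
    case (Cons x xs)
    let ?r = "r(i := xs, j := x # r j, k := x # r k)"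
    have 1: "rruns (popp i ;; pushp j b ;; pushp k b) r (1 + (2 + 2))
        (r(i := xs, j := b # r j, k := b # r k))" for b
      using assms(1-3) Cons.prems
      by (intro runs_seq[OF rruns_pop[OF refl] runs_seq[OF rruns_push[OF refl] rruns_push]])
        (auto simp: fun_eq_iff)
    have 2: "rruns (ifp i (\<lambda>x. x = Some True) (popp i ;; pushp j True ;; pushp k True)
        (popp i ;; pushp j False ;; pushp k False)) r (Suc 5) ?r"
      using 1 Cons.prems by (cases x; simp only:) (intro runs_if_true runs_if_false; auto)+
    have 3: "rruns (mv2p i j k) ?r (7 * length xs + 1)
       (r(i := [], j := rev (x # xs) @ r j, k := rev (x # xs) @ r k))"
      using assms(1-3) by (intro rruns_cong[OF Cons.IH[of ?r]]) (auto simp: fun_eq_iff)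
    have "rruns (mv2p i j k) r (Suc (Suc 5) + (7 * length xs + 1))
       (r(i := [], j := rev (x # xs) @ r j, k := rev (x # xs) @ r k))"
      unfolding mv2p_def
      by (rule runs_while_step[OF _ 2 3[unfolded mv2p_def]]) (simp add: Cons.prems)
    then show ?case by (rule rruns_cong) (auto simp: fun_eq_iff)
  qed
  then show ?thesis using assms by simp
qed

lemma rruns_clear:
  assumes "r' = r(i := [])" "T = 2 * length (r i) + 1"
  shows "rruns (clearp i) r T r'"
proof -
  have "rruns (clearp i) r (2 * length xs + 1) (r(i := []))" if "r i = xs" for xs
    using that
  proof (induction xs arbitrary: r)
    case Nil
    then have "\<not> st r i 0 \<noteq> None" by simp
    with Nil show ?case unfolding clearp_def
      by (intro rruns_cong[OF runs_while_done[where s = "st r"]]) (auto simp: fun_eq_iff)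
  next
    case (Cons x xs)
    have "rruns (clearp i) r (Suc 1 + (2 * length xs + 1)) (r(i := []))"
      unfolding clearp_def
    proof (rule runs_while_step)
      show "rruns (popp i) r 1 (r(i := xs))" by (rule rruns_pop) (simp add: Cons.prems)
      show "rruns (whilep i (\<lambda>x. x \<noteq> None) (popp i)) (r(i := xs)) (2 * length xs + 1) (r(i := []))"
        unfolding clearp_def[symmetric] by (rule rruns_cong[OF Cons.IH[of "r(i := xs)"]]) auto
    qed (simp add: Cons.prems)
    then show ?case by (rule rruns_cong) (auto simp: fun_eq_iff)
  qed
  then show ?thesis using assms by simp
qed

lemma rruns_if:
  assumes "b (stack_top (r i)) \<Longrightarrow> rruns P r T r'" "\<not> b (stack_top (r i)) \<Longrightarrow> rruns Q r T r'"
  shows "rruns (ifp i b P Q) r (Suc T) r'"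
  using assms runs_if_true[of b "st r" i P T "st r'" Q] runs_if_false[of b "st r" i Q T "st r'" P]
  by auto

text \<open>A subroutine call: tape \<open>d\<close> holds the argument, and the work tapes of the
  block above it are blank before and after the call.\<close>

lemma rruns_call:
  assumes "uses n P" "0 < n" "rruns P (reg w) T (reg v)" "r d = w"
    "\<And>i. d < i \<Longrightarrow> i < d + n \<Longrightarrow> r i = []" "r' = r(d := v)"
  shows "rruns (shiftp d P) r T r'"
proof -
  let ?u = "\<lambda>i. st r (i + d)"
  have "?u i = st (reg w) i" if "i < n" for i
    using assms(4) assms(5)[of "i + d"] that by (cases "i = 0") (auto simp: reg_def st_def)
  from runs_shift[OF runs_frame[OF assms(1,3) this]]
  have "runs (shiftp d P) (st r) T
     (\<lambda>i. if i < d then st r i else if i - d < n then st (reg v) (i - d) else st r (i - d + d))" .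
  moreover have "(\<lambda>i. if i < d then st r i else if i - d < n then st (reg v) (i - d) else st r (i - d + d))
     = st r'"
  proof
    fix i
    show "(if i < d then st r i else if i - d < n then st (reg v) (i - d) else st r (i - d + d)) = st r' i"
      using assms(2,6) assms(5)[of i] by (cases "i < d"; cases "i = d") (auto simp: reg_def st_def)
  qed
  ultimately show ?thesis by simp
qed

section \<open>Polynomial bounds\<close>

text \<open>The base \<open>n + 2\<close> is at least 2, so a single exponent absorbs constants,
  sums and products for every \<open>n\<close>, including 0.\<close>

definition polyb :: "(nat \<Rightarrow> nat) \<Rightarrow> bool" where
  "polyb p \<longleftrightarrow> (\<exists>c. \<forall>n. p n \<le> (n + 2) ^ c)"

named_theorems polyb_intros

lemma polyb_const [polyb_intros]: "polyb (\<lambda>_. k)"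
proof -
  have "k \<le> (n + 2) ^ k" for n
    using power_mono[of 2 "n + 2" k] less_exp[of k] by linarith
  then show ?thesis unfolding polyb_def by blast
qed

lemma polyb_id [polyb_intros]: "polyb (\<lambda>n. n)"
  unfolding polyb_def by (rule exI[of _ 1]) auto

lemma polyb_mult [polyb_intros]: "polyb p \<Longrightarrow> polyb q \<Longrightarrow> polyb (\<lambda>n. p n * q n)"
  unfolding polyb_def by (metis mult_le_mono power_add)

lemma polyb_add [polyb_intros]:
  assumes "polyb p" "polyb q" shows "polyb (\<lambda>n. p n + q n)"
proof -
  obtain a b where ab: "\<And>n. p n \<le> (n + 2) ^ a" "\<And>n. q n \<le> (n + 2) ^ b"
    using assms unfolding polyb_def by blast
  have "p n + q n \<le> (n + 2) ^ (a + b + 1)" for n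
  proof -
    have "(n + 2) ^ a \<le> (n + 2) ^ (a + b)" "(n + 2) ^ b \<le> (n + 2) ^ (a + b)"
      by (intro power_increasing; simp)+
    then have "p n + q n \<le> 2 * (n + 2) ^ (a + b)" using ab[of n] by linarith
    also have "\<dots> \<le> (n + 2) * (n + 2) ^ (a + b)" by (rule mult_le_mono1) simp
    finally show ?thesis by simp
  qed
  then show ?thesis unfolding polyb_def by blast
qed

lemma polyb_Suc [polyb_intros]: "polyb p \<Longrightarrow> polyb (\<lambda>n. Suc (p n))"
  using polyb_add[OF _ polyb_const[of 1]] by simp

lemma polyb_power [polyb_intros]: "polyb p \<Longrightarrow> polyb (\<lambda>n. p n ^ c)"
  by (induction c) (auto intro: polyb_mult polyb_const)

section \<open>Functions computed in polynomial time\<close>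

text \<open>
  A program computes \<open>f\<close> with respect to the word encodings \<open>e\<close> and \<open>e'\<close> if it replaces the word
  \<open>e x\<close> on tape 0 by \<open>e' (f x)\<close>, all other tapes being blank before and after.
\<close>

definition pt :: "('a \<Rightarrow> bool list) \<Rightarrow> ('b \<Rightarrow> bool list) \<Rightarrow> ('a \<Rightarrow> 'b) \<Rightarrow> bool" where
  "pt e e' f \<longleftrightarrow> (\<exists>P n p. uses n P \<and> 0 < n \<and> polyb p \<and>
     (\<forall>x. rruns P (reg (e x)) (p (length (e x))) (reg (e' (f x))) \<and>
          length (e' (f x)) \<le> p (length (e x))))"

lemma ptI:
  assumes "uses n P" "0 < n" "\<And>x. rruns P (reg (e x)) (T x) (reg (e' (f x)))"
    "\<And>x. T x \<le> p (length (e x))" "polyb p"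
    "\<And>x. length (e' (f x)) \<le> q (length (e x))" "polyb q"
  shows "pt e e' f"
  unfolding pt_def
proof (intro exI conjI allI)
  show "uses n P" "0 < n" "polyb (\<lambda>n. p n + q n)" using assms polyb_add by auto
  show "rruns P (reg (e x)) (p (length (e x)) + q (length (e x))) (reg (e' (f x)))" for x
    using runs_mono[OF assms(3)[of x], of "p (length (e x)) + q (length (e x))"] assms(4)[of x] by simp
  show "length (e' (f x)) \<le> p (length (e x)) + q (length (e x))" for x
    using assms(6)[of x] by simp
qed

lemma ptE:
  assumes "pt e e' f"
  obtains P n c where "uses n P" "0 < n"
    "\<And>x. rruns P (reg (e x)) ((length (e x) + 2) ^ c) (reg (e' (f x)))"
    "\<And>x. length (e' (f x)) \<le> (length (e x) + 2) ^ c"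
proof -
  from assms obtain P n p c where 1: "uses n P" "0 < n" "\<And>n. p n \<le> (n + 2) ^ c"
    "\<And>x. rruns P (reg (e x)) (p (length (e x))) (reg (e' (f x)))"
    "\<And>x. length (e' (f x)) \<le> p (length (e x))" unfolding pt_def polyb_def by metis
  show thesis
    using that[OF 1(1,2) runs_mono[OF 1(4) 1(3)] order_trans[OF 1(5) 1(3)]] .
qed

lemma pt_cong: "pt e e' f \<Longrightarrow> (\<And>x. e' (f x) = e'' (g x)) \<Longrightarrow> pt e e'' g"
  by (simp add: pt_def)

lemma pt_id: "pt e e (\<lambda>x. x)"
  by (rule ptI[of 1 skipp _ "\<lambda>_. 0" _ _ "\<lambda>_. 0" "\<lambda>n. n"]) (auto intro: polyb_intros runs_skip)

lemma pt_comp: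
  assumes "pt e e' f" "pt e' e'' g"
  shows "pt e e'' (\<lambda>x. g (f x))"
proof -
  from assms(1) obtain P n c where P: "uses n P" "0 < n"
    "\<And>x. rruns P (reg (e x)) ((length (e x) + 2) ^ c) (reg (e' (f x)))"
    "\<And>x. length (e' (f x)) \<le> (length (e x) + 2) ^ c" by (rule ptE) (rule that)
  from assms(2) obtain Q m d where Q: "uses m Q" "0 < m"
    "\<And>x. rruns Q (reg (e' x)) ((length (e' x) + 2) ^ d) (reg (e'' (g x)))"
    "\<And>x. length (e'' (g x)) \<le> (length (e' x) + 2) ^ d" by (rule ptE) (rule that)
  have b: "(length (e' (f x)) + 2) ^ d \<le> ((length (e x) + 2) ^ c + 2) ^ d" for x
    using P(4) by (intro power_mono) auto
  show ?thesis
  proof (rule ptI[where p = "\<lambda>N. (N + 2) ^ c + ((N + 2) ^ c + 2) ^ d"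
        and q = "\<lambda>N. ((N + 2) ^ c + 2) ^ d"])
    show "uses (n + m) (P ;; Q)" 
      by (intro uses_seq uses_mono[OF P(1)] uses_mono[OF Q(1)]) auto
    show "rruns (P ;; Q) (reg (e x)) ((length (e x) + 2) ^ c + (length (e' (f x)) + 2) ^ d) (reg (e'' (g (f x))))" for x
      by (rule runs_seq[OF P(3) Q(3)])
    show "(length (e x) + 2) ^ c + (length (e' (f x)) + 2) ^ d
      \<le> (length (e x) + 2) ^ c + ((length (e x) + 2) ^ c + 2) ^ d" for x
      by (rule add_left_mono[OF b])
    show "length (e'' (g (f x))) \<le> ((length (e x) + 2) ^ c + 2) ^ d" for x
      by (rule order_trans[OF Q(4) b])
  qed (use P(2) in simp, (intro polyb_intros)+)
qed

lemma pt_const_word: "pt e e' (\<lambda>_. k)"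
proof -
  have "\<exists>P. uses 1 P \<and> (\<forall>r. rruns P r (2 * length w) (r(0 := w @ r 0)))" for w
  proof (induction w)
    case Nil
    show ?case by (rule exI[of _ skipp]) (auto intro: runs_skip)
  next
    case (Cons b w)
    then obtain P where P: "uses 1 P" "\<And>r. rruns P r (2 * length w) (r(0 := w @ r 0))" by blast
    have "rruns (P ;; pushp 0 b) r (2 * length w + 2) (r(0 := (b # w) @ r 0))" for r
      by (rule runs_seq[OF P(2) rruns_push]) auto
    then have "\<forall>r. rruns (P ;; pushp 0 b) r (2 * length (b # w)) (r(0 := (b # w) @ r 0))"
      by (simp del: fun_upd_apply)
    moreover have "uses 1 (P ;; pushp 0 b)" using P(1) by auto
    ultimately show ?case by blast
  qed
  from this[of "e' k"] obtain P where P: "uses 1 P"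
    "\<And>r. rruns P r (2 * length (e' k)) (r(0 := e' k @ r 0))" by blast
  have 1: "rruns (clearp 0 ;; P) (reg (e x)) ((2 * length (e x) + 1) + 2 * length (e' k)) (reg (e' k))" for x
  proof (rule runs_seq)
    show "rruns (clearp 0) (reg (e x)) (2 * length (e x) + 1) (\<lambda>_. [])"
      by (rule rruns_clear) (auto simp: reg_def)
    show "rruns P (\<lambda>_. []) (2 * length (e' k)) (reg (e' k))"
      by (rule rruns_cong[OF P(2)]) (auto simp: reg_def)
  qed
  show ?thesis
  proof (rule ptI[where p = "\<lambda>N. (2 * N + 1) + 2 * length (e' k)" and q = "\<lambda>_. length (e' k)"])
    show "rruns (clearp 0 ;; P) (reg (e x)) ((2 * length (e x) + 1) + 2 * length (e' k)) (reg (e' k))" for x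
      by (rule 1)
    show "2 * length (e x) + 1 + 2 * length (e' k) \<le> 2 * length (e x) + 1 + 2 * length (e' k)" for x by simp
    show "length (e' k) \<le> length (e' k)" ..
    show "uses 1 (clearp 0 ;; P)" using P(1) by auto
  qed (simp | intro polyb_intros)+
qed

text \<open>The leading \<open>True\<close> makes the code of a pair a tree with the codes of the
  components as subtrees, see \<open>tree_code\<close>.\<close>

definition pcode :: "('a \<Rightarrow> bool list) \<Rightarrow> ('b \<Rightarrow> bool list) \<Rightarrow> 'a \<times> 'b \<Rightarrow> bool list" where
  "pcode e e' p = True # e (fst p) @ e' (snd p)"

text \<open>The input is duplicated into two disjoint blocks of tapes. Each \<open>mvp\<close>
  reverses a word, so the two results are concatenated by way of two spare tapes.\<close>

lemma pt_pair:
  assumes "pt e e1 f" "pt e e2 g"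
  shows "pt e (pcode e1 e2) (\<lambda>x. (f x, g x))"
proof -
  from assms(1) obtain P n c where P: "uses n P" "0 < n"
    "\<And>x. rruns P (reg (e x)) ((length (e x) + 2) ^ c) (reg (e1 (f x)))"
    "\<And>x. length (e1 (f x)) \<le> (length (e x) + 2) ^ c" by (rule ptE) (rule that)
  from assms(2) obtain Q m d where Q: "uses m Q" "0 < m"
    "\<And>x. rruns Q (reg (e x)) ((length (e x) + 2) ^ d) (reg (e2 (g x)))"
    "\<And>x. length (e2 (g x)) \<le> (length (e x) + 2) ^ d" by (rule ptE) (rule that)
  let ?z = "n + m" and ?E = "(\<lambda>_. []) :: regs"
  let ?R = "mvp 0 ?z ;; mv2p ?z 0 n ;; shiftp 0 P ;; shiftp n Q ;; mvp 0 ?z ;; mvp n (?z + 1) ;;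
    mvp (?z + 1) 0 ;; mvp ?z 0 ;; pushp 0 True"
  define T where "T x = (5 * length (e x) + 1) + ((7 * length (e x) + 1) + ((length (e x) + 2) ^ c
    + ((length (e x) + 2) ^ d + ((5 * length (e1 (f x)) + 1) + ((5 * length (e2 (g x)) + 1)
    + ((5 * length (e2 (g x)) + 1) + ((5 * length (e1 (f x)) + 1) + 2)))))))" for x
  have 1: "rruns ?R (reg (e x)) (T x) (reg (pcode e1 e2 (f x, g x)))" for x
    unfolding T_def
  proof (rule runs_seq)
    show "rruns (mvp 0 ?z) (reg (e x)) (5 * length (e x) + 1) (?E(?z := rev (e x)))"
      using P(2) by (intro rruns_mv) (auto simp: reg_def)
    show "rruns (mv2p ?z 0 n ;; shiftp 0 P ;; shiftp n Q ;; mvp 0 ?z ;; mvp n (?z + 1) ;;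
       mvp (?z + 1) 0 ;; mvp ?z 0 ;; pushp 0 True) (?E(?z := rev (e x)))
       ((7 * length (e x) + 1) + ((length (e x) + 2) ^ c
    + ((length (e x) + 2) ^ d + ((5 * length (e1 (f x)) + 1) + ((5 * length (e2 (g x)) + 1)
    + ((5 * length (e2 (g x)) + 1) + ((5 * length (e1 (f x)) + 1) + 2)))))))
       (reg (pcode e1 e2 (f x, g x)))"
    proof (rule runs_seq[OF _ runs_seq[OF _ runs_seq[OF _ runs_seq[OF _ runs_seq[OF _ runs_seq[OF _ runs_seq]]]]]])
      show "rruns (mv2p ?z 0 n) (?E(?z := rev (e x))) (7 * length (e x) + 1) (?E(0 := e x, n := e x))"
        using P(2) Q(2) by (intro rruns_mv2) (auto simp: fun_eq_iff)
      show "rruns (shiftp 0 P) (?E(0 := e x, n := e x)) ((length (e x) + 2) ^ c) (?E(0 := e1 (f x), n := e x))"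
        by (rule rruns_call[OF P(1,2,3)]) (use P(2) in \<open>auto simp: fun_eq_iff\<close>)
      show "rruns (shiftp n Q) (?E(0 := e1 (f x), n := e x)) ((length (e x) + 2) ^ d)
         (?E(0 := e1 (f x), n := e2 (g x)))"
        by (rule rruns_call[OF Q(1,2,3)]) (use P(2) in \<open>auto simp: fun_eq_iff\<close>)
      show "rruns (mvp 0 ?z) (?E(0 := e1 (f x), n := e2 (g x))) (5 * length (e1 (f x)) + 1)
         (?E(?z := rev (e1 (f x)), n := e2 (g x)))"
        using P(2) Q(2) by (intro rruns_mv) (auto simp: fun_eq_iff)
      show "rruns (mvp n (?z + 1)) (?E(?z := rev (e1 (f x)), n := e2 (g x))) (5 * length (e2 (g x)) + 1)
         (?E(?z := rev (e1 (f x)), ?z + 1 := rev (e2 (g x))))"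
        using P(2) Q(2) by (intro rruns_mv) (auto simp: fun_eq_iff)
      show "rruns (mvp (?z + 1) 0) (?E(?z := rev (e1 (f x)), ?z + 1 := rev (e2 (g x)))) (5 * length (e2 (g x)) + 1)
         (?E(?z := rev (e1 (f x)), 0 := e2 (g x)))"
        using P(2) Q(2) by (intro rruns_mv) (auto simp: fun_eq_iff)
      show "rruns (mvp ?z 0) (?E(?z := rev (e1 (f x)), 0 := e2 (g x))) (5 * length (e1 (f x)) + 1)
         (?E(0 := e1 (f x) @ e2 (g x)))"
        using P(2) Q(2) by (intro rruns_mv) (auto simp: fun_eq_iff)
      show "rruns (pushp 0 True) (?E(0 := e1 (f x) @ e2 (g x))) 2 (reg (pcode e1 e2 (f x, g x)))"
        by (rule rruns_push) (auto simp: reg_def pcode_def)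
    qed
  qed
  let ?q = "\<lambda>N. (5 * N + 1) + ((7 * N + 1) + ((N + 2) ^ c
    + ((N + 2) ^ d + ((5 * (N + 2) ^ c + 1) + ((5 * (N + 2) ^ d + 1)
    + ((5 * (N + 2) ^ d + 1) + ((5 * (N + 2) ^ c + 1) + 2)))))))"
  show ?thesis
  proof (rule ptI[where T = T and n = "n + m + 2" and p = ?q and q = "\<lambda>N. 1 + (N + 2) ^ c + (N + 2) ^ d"])
    show "rruns ?R (reg (e x)) (T x) (reg (pcode e1 e2 (f x, g x)))" for x by (rule 1)
    show "uses (n + m + 2) ?R"
      using P(2) by (intro uses_seq uses_basic uses_shift[OF P(1)] uses_shift[OF Q(1)]) auto
    show "T x \<le> ?q (length (e x))" for x
      unfolding T_def using P(4)[of x] Q(4)[of x] by (intro add_mono mult_le_mono) auto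
    show "length (pcode e1 e2 (f x, g x)) \<le> 1 + (length (e x) + 2) ^ c + (length (e x) + 2) ^ d" for x
      using P(4)[of x] Q(4)[of x] by (auto simp: pcode_def)
  qed (simp | intro polyb_intros)+
qed

section \<open>Tree codes\<close>

text \<open>Preorder words of binary trees, \<open>True\<close> for an inner node and
  \<open>False\<close> for a leaf. They are self-delimiting: a machine that counts pending subtrees
  finds the end of a code inside a longer word.\<close>

inductive tree_code :: "bool list \<Rightarrow> bool" where
  code_leaf: "tree_code [False]"
| code_node: "tree_code u \<Longrightarrow> tree_code v \<Longrightarrow> tree_code (True # u @ v)"

definition treeloop :: "nat \<Rightarrow> nat \<Rightarrow> nat \<Rightarrow> prog" where
  "treeloop i j k = whilep k (\<lambda>x. x \<noteq> None)
     (ifp i (\<lambda>x. x = Some True) (pushp k True ;; pushp j True ;; popp i)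
        (popp k ;; pushp j False ;; popp i))"

text \<open>Tape \<open>k\<close> counts the subtrees that are still to be moved.\<close>

definition mvtree :: "nat \<Rightarrow> nat \<Rightarrow> nat \<Rightarrow> prog" where
  "mvtree i j k = pushp k True ;; treeloop i j k"

lemma uses_mvtree [intro]: "i < n \<Longrightarrow> j < n \<Longrightarrow> k < n \<Longrightarrow> uses n (mvtree i j k)"
  unfolding mvtree_def treeloop_def by (intro uses_seq uses_while uses_if uses_basic)

text \<open>Continuation form: the run in the premise is one of the same loop from the point where
  \<open>u\<close> has been moved. This makes the two subtrees of a node, handled by one and the
  same loop, accessible to the induction. Each symbol costs 7 steps.\<close>

lemma rruns_treeloop:
  assumes "tree_code u" "i \<noteq> j" "i \<noteq> k" "j \<noteq> k"
  shows "r i = u @ ys \<Longrightarrow> r k = True # ks \<Longrightarrow>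
    rruns (treeloop i j k) (r(i := ys, j := rev u @ r j, k := ks)) T r' \<Longrightarrow>
    rruns (treeloop i j k) r (7 * length u + T) r'"
  using assms(1)
proof (induction u arbitrary: r ys ks T rule: tree_code.induct)
  case code_leaf
  let ?r = "r(i := ys, j := False # r j, k := ks)"
  have 1: "rruns (popp k ;; pushp j False ;; popp i) r (1 + (2 + 1)) ?r"
    using assms(2-4) code_leaf
    by (intro runs_seq[OF rruns_pop[OF refl] runs_seq[OF rruns_push[OF refl] rruns_pop]])
      (auto simp: fun_eq_iff)
  have 2: "rruns (ifp i (\<lambda>x. x = Some True) (pushp k True ;; pushp j True ;; popp i)
     (popp k ;; pushp j False ;; popp i)) r (Suc 5) ?r"
    using 1 code_leaf(1) by (intro rruns_if) (auto intro: runs_mono)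
  have 3: "rruns (treeloop i j k) ?r T r'" by (rule rruns_cong[OF code_leaf(3)]) auto
  have "rruns (treeloop i j k) r (Suc (Suc 5) + T) r'"
    unfolding treeloop_def by (rule runs_while_step[OF _ 2 3[unfolded treeloop_def]]) (simp add: code_leaf(2))
  then show ?case by simp
next
  case (code_node u v)
  let ?r = "r(i := u @ v @ ys, j := True # r j, k := True # True # ks)"
  have 1: "rruns (pushp k True ;; pushp j True ;; popp i) r (2 + (2 + 1)) ?r"
    using assms(2-4) code_node.prems(1,2)
    by (intro runs_seq[OF rruns_push[OF refl] runs_seq[OF rruns_push[OF refl] rruns_pop]])
      (auto simp: fun_eq_iff)
  have 2: "rruns (ifp i (\<lambda>x. x = Some True) (pushp k True ;; pushp j True ;; popp i)
     (popp k ;; pushp j False ;; popp i)) r (Suc 5) ?r"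
    using 1 code_node.prems(1) by (intro rruns_if) (auto intro: runs_mono)
  let ?r2 = "?r(i := v @ ys, j := rev u @ ?r j, k := True # ks)"
  have 3: "rruns (treeloop i j k) ?r2 (7 * length v + T) r'"
  proof (rule code_node.IH(2))
    show "?r2 i = v @ ys" "?r2 k = True # ks" using assms(2-4) by auto
    show "rruns (treeloop i j k) (?r2(i := ys, j := rev v @ ?r2 j, k := ks)) T r'"
      by (rule rruns_cong[OF code_node.prems(3)]) (use assms(2-4) in \<open>auto simp: fun_eq_iff\<close>)
  qed
  have 4: "rruns (treeloop i j k) ?r (7 * length u + (7 * length v + T)) r'"
  proof (rule code_node.IH(1))
    show "?r i = u @ v @ ys" "?r k = True # True # ks" using assms(2-4) by auto
  qed (rule 3)
  have "rruns (treeloop i j k) r (Suc (Suc 5) + (7 * length u + (7 * length v + T))) r'"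
    unfolding treeloop_def by (rule runs_while_step[OF _ 2 4[unfolded treeloop_def]]) (simp add: code_node.prems(2))
  then show ?case by (rule runs_mono) simp
qed

lemma rruns_mvtree:
  assumes "tree_code u" "i \<noteq> j" "i \<noteq> k" "j \<noteq> k" "r i = u @ ys" "r k = []"
    "r' = r(i := ys, j := rev u @ r j)" "T = 7 * length u + 3"
  shows "rruns (mvtree i j k) r T r'"
proof -
  let ?r = "r(k := [True])"
  have "rruns (treeloop i j k) ?r (7 * length u + 1) r'"
  proof (rule rruns_treeloop[OF assms(1-4), of _ ys "[]"])
    show "rruns (treeloop i j k) (?r(i := ys, j := rev u @ ?r j, k := [])) 1 r'"
      unfolding treeloop_def
      by (rule rruns_cong[OF runs_while_done[where s = "st r'"]]) (use assms in \<open>auto simp: fun_eq_iff\<close>)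
  qed (use assms in auto)
  moreover have "rruns (pushp k True) r 2 ?r" by (rule rruns_push) (simp add: assms(6))
  ultimately show ?thesis
    unfolding mvtree_def using assms(8) by (intro runs_mono[OF runs_seq]) auto
qed

text \<open>Covers \<open>snd\<close>, \<open>tl\<close> and the predecessor at once: each drops the
  first subtree of the code of its argument. The case \<open>[False]\<close> is the value at the
  empty list or at 0, where nothing is dropped.\<close>

lemma pt_second:
  assumes "pt e e2 g"
    and *: "\<And>x. (e2 (g x) = [False] \<and> e3 (f x) = [False]) \<or> (\<exists>u. tree_code u \<and> e2 (g x) = True # u @ e3 (f x))"
  shows "pt e e3 f"
proof -
  let ?P = "ifp 0 (\<lambda>x. x = Some True) (popp 0 ;; mvtree 0 1 2 ;; clearp 1) skipp"
  have run: "rruns ?P (reg (e2 (g x))) (9 * length (e2 (g x)) + 6) (reg (e3 (f x)))" for x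
    using *[of x]
  proof (elim disjE exE conjE)
    assume "e2 (g x) = [False]" "e3 (f x) = [False]"
    then show ?thesis
      by (intro runs_mono[OF rruns_if[OF _ rruns_cong[OF runs_skip]]]) (auto simp: reg_def)
  next
    fix u assume u: "tree_code u" "e2 (g x) = True # u @ e3 (f x)"
    let ?E = "(\<lambda>_. []) :: regs"
    have "rruns (popp 0 ;; mvtree 0 1 2 ;; clearp 1) (reg (e2 (g x)))
       (1 + ((7 * length u + 3) + (2 * length u + 1))) (reg (e3 (f x)))"
    proof (rule runs_seq[OF _ runs_seq])
      show "rruns (popp 0) (reg (e2 (g x))) 1 (?E(0 := u @ e3 (f x)))"
        by (rule rruns_pop) (simp add: u reg_def)
      show "rruns (mvtree 0 1 2) (?E(0 := u @ e3 (f x))) (7 * length u + 3) (?E(0 := e3 (f x), 1 := rev u))"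
        by (rule rruns_mvtree[OF u(1)]) auto
      show "rruns (clearp 1) (?E(0 := e3 (f x), 1 := rev u)) (2 * length u + 1) (reg (e3 (f x)))"
        by (rule rruns_clear) (auto simp: reg_def)
    qed
    then show ?thesis
      by (intro runs_mono[OF rruns_if]) (auto simp: u reg_def)
  qed
  have "pt (\<lambda>x. e2 (g x)) e3 f"
  proof (rule ptI[where p = "\<lambda>N. 9 * N + 6" and q = "\<lambda>N. N"])
    show "uses 3 ?P" by (intro uses_if uses_seq uses_basic uses_mvtree) auto
    show "rruns ?P (reg (e2 (g x))) (9 * length (e2 (g x)) + 6) (reg (e3 (f x)))" for x by (rule run)
    show "length (e3 (f x)) \<le> length (e2 (g x))" for x using *[of x] by auto
  qed (simp | intro polyb_intros)+
  from pt_comp[OF pt_cong[OF assms(1)] this, of "\<lambda>x. x"] show ?thesis by simp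
qed

text \<open>Covers \<open>fst\<close> and \<open>hd\<close>. For \<open>hd\<close>, the word
  \<open>w0\<close> is the code of the fixed but unspecified value \<open>hd []\<close>, which the
  constant program \<open>Q\<close> writes.\<close>

lemma pt_first:
  assumes "pt e e2 g"
    and *: "\<And>x. (e2 (g x) = [False] \<and> e3 (f x) = w0) \<or> (\<exists>v. tree_code (e3 (f x)) \<and> e2 (g x) = True # e3 (f x) @ v)"
  shows "pt e e3 f"
proof -
  have "pt (\<lambda>_ :: unit. [False]) (\<lambda>_ :: unit. w0) (\<lambda>_. ())" by (rule pt_const_word)
  then obtain Q n c where Q: "uses n Q" "0 < n"
    "\<And>x. rruns Q (reg [False]) ((length [False] + 2) ^ c) (reg w0)" by (rule ptE) (rule that)
  let ?P = "ifp 0 (\<lambda>x. x = Some True) (popp 0 ;; mvtree 0 1 2 ;; clearp 0 ;; mvp 1 0) Q"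
  let ?T = "\<lambda>N. Suc (14 * N + 9 + 3 ^ c)"
  have run: "rruns ?P (reg (e2 (g x))) (?T (length (e2 (g x)))) (reg (e3 (f x)))" for x
    using *[of x]
  proof (elim disjE exE conjE)
    assume a: "e2 (g x) = [False]" "e3 (f x) = w0"
    show ?thesis unfolding a
      by (rule rruns_if, simp add: reg_def, rule runs_mono[OF Q(3)]) (simp add: numeral_3_eq_3)
  next
    fix v assume u: "tree_code (e3 (f x))" "e2 (g x) = True # e3 (f x) @ v"
    let ?E = "(\<lambda>_. []) :: regs" and ?u = "e3 (f x)"
    have "rruns (popp 0 ;; mvtree 0 1 2 ;; clearp 0 ;; mvp 1 0) (reg (e2 (g x)))
       (1 + ((7 * length ?u + 3) + ((2 * length v + 1) + (5 * length ?u + 1)))) (reg (e3 (f x)))"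
    proof (rule runs_seq[OF _ runs_seq[OF _ runs_seq]])
      show "rruns (popp 0) (reg (e2 (g x))) 1 (?E(0 := ?u @ v))"
        by (rule rruns_pop) (simp add: u reg_def)
      show "rruns (mvtree 0 1 2) (?E(0 := ?u @ v)) (7 * length ?u + 3) (?E(0 := v, 1 := rev ?u))"
        by (rule rruns_mvtree[OF u(1)]) auto
      show "rruns (clearp 0) (?E(0 := v, 1 := rev ?u)) (2 * length v + 1) (?E(1 := rev ?u))"
        by (rule rruns_clear) auto
      show "rruns (mvp 1 0) (?E(1 := rev ?u)) (5 * length ?u + 1) (reg ?u)"
        by (rule rruns_mv) (auto simp: reg_def)
    qed
    then show ?thesis
      by (intro rruns_if) (auto simp: u reg_def elim!: runs_mono)
  qed
  have "pt (\<lambda>x. e2 (g x)) e3 f"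
  proof (rule ptI[where p = ?T and q = "\<lambda>N. N + length w0"])
    show "uses (n + 3) ?P"
      by (intro uses_if uses_seq uses_basic uses_mvtree uses_mono[OF Q(1)]) auto
    show "rruns ?P (reg (e2 (g x))) (?T (length (e2 (g x)))) (reg (e3 (f x)))" for x by (rule run)
    show "length (e3 (f x)) \<le> length (e2 (g x)) + length w0" for x using *[of x] by auto
  qed (simp | intro polyb_intros)+
  from pt_comp[OF pt_cong[OF assms(1)] this, of "\<lambda>x. x"] show ?thesis by simp
qed

lemma pt_if:
  assumes "pt e e1 t" "\<And>x. stack_top (e1 (t x)) = Some (b x)" "pt e e2 g" "pt e e2 h"
  shows "pt e e2 (\<lambda>x. if b x then g x else h x)"
proof -
  from assms(1) obtain P n c where P: "uses n P" "0 < n"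
    "\<And>x. rruns P (reg (e x)) ((length (e x) + 2) ^ c) (reg (e1 (t x)))"
    "\<And>x. length (e1 (t x)) \<le> (length (e x) + 2) ^ c" by (rule ptE) (rule that)
  from assms(3) obtain G m d where G: "uses m G" "0 < m"
    "\<And>x. rruns G (reg (e x)) ((length (e x) + 2) ^ d) (reg (e2 (g x)))"
    "\<And>x. length (e2 (g x)) \<le> (length (e x) + 2) ^ d" by (rule ptE) (rule that)
  from assms(4) obtain H l a where H: "uses l H" "0 < l"
    "\<And>x. rruns H (reg (e x)) ((length (e x) + 2) ^ a) (reg (e2 (h x)))"
    "\<And>x. length (e2 (h x)) \<le> (length (e x) + 2) ^ a" by (rule ptE) (rule that)
  let ?z = "n + 1" and ?E = "(\<lambda>_. []) :: regs"
  let ?R = "mvp 0 ?z ;; mv2p ?z 0 1 ;; shiftp 1 P ;;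
     ifp 1 (\<lambda>x. x = Some True) (clearp 1 ;; G) (clearp 1 ;; H)"
  let ?T = "\<lambda>N. (5 * N + 1) + ((7 * N + 1) + ((N + 2) ^ c + Suc ((2 * (N + 2) ^ c + 1) + ((N + 2) ^ d + (N + 2) ^ a))))"
  have run: "rruns ?R (reg (e x)) (?T (length (e x))) (reg (e2 (if b x then g x else h x)))" for x
  proof (rule runs_seq[OF _ runs_seq[OF _ runs_seq]])
    let ?S = "?E(0 := e x, 1 := e1 (t x))"
    show "rruns (mvp 0 ?z) (reg (e x)) (5 * length (e x) + 1) (?E(?z := rev (e x)))"
      by (rule rruns_mv) (auto simp: reg_def)
    show "rruns (mv2p ?z 0 1) (?E(?z := rev (e x))) (7 * length (e x) + 1) (?E(0 := e x, 1 := e x))"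
      using P(2) by (intro rruns_mv2) (auto simp: fun_eq_iff)
    show "rruns (shiftp 1 P) (?E(0 := e x, 1 := e x)) ((length (e x) + 2) ^ c) ?S"
      by (rule rruns_call[OF P(1,2,3)]) (auto simp: fun_eq_iff)
    have c: "rruns (clearp 1) ?S (2 * (length (e x) + 2) ^ c + 1) (reg (e x))"
      using P(4)[of x] by (intro runs_mono[OF rruns_clear]) (auto simp: reg_def)
    show "rruns (ifp 1 (\<lambda>x. x = Some True) (clearp 1 ;; G) (clearp 1 ;; H)) ?S
        (Suc ((2 * (length (e x) + 2) ^ c + 1) + ((length (e x) + 2) ^ d + (length (e x) + 2) ^ a)))
        (reg (e2 (if b x then g x else h x)))"
    proof (rule rruns_if)
      assume "stack_top (?S 1) = Some True"
      then have "b x" using assms(2)[of x] by simp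
      then show "rruns (clearp 1 ;; G) ?S ((2 * (length (e x) + 2) ^ c + 1) +
         ((length (e x) + 2) ^ d + (length (e x) + 2) ^ a)) (reg (e2 (if b x then g x else h x)))"
        using G(3)[of x] by (intro runs_seq[OF c]) (auto elim: runs_mono)
    next
      assume "stack_top (?S 1) \<noteq> Some True"
      then have "\<not> b x" using assms(2)[of x] by simp
      then show "rruns (clearp 1 ;; H) ?S ((2 * (length (e x) + 2) ^ c + 1) +
         ((length (e x) + 2) ^ d + (length (e x) + 2) ^ a)) (reg (e2 (if b x then g x else h x)))"
        using H(3)[of x] by (intro runs_seq[OF c]) (auto elim: runs_mono)
    qed
  qed
  show ?thesis
  proof (rule ptI[where p = ?T and q = "\<lambda>N. (N + 2) ^ d + (N + 2) ^ a"])
    show "uses (n + m + l + 2) ?R"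
      by (intro uses_if uses_seq uses_basic uses_shift[OF P(1)] uses_mono[OF G(1)] uses_mono[OF H(1)]) auto
    show "rruns ?R (reg (e x)) (?T (length (e x))) (reg (e2 (if b x then g x else h x)))" for x by (rule run)
    show "length (e2 (if b x then g x else h x)) \<le> (length (e x) + 2) ^ d + (length (e x) + 2) ^ a" for x
      using G(4)[of x] H(4)[of x] by auto
  qed (simp | intro polyb_intros)+
qed

text \<open>A nonempty list has the code of the pair of its head and tail, so that cons,
  \<open>hd\<close> and \<open>tl\<close> are programs for pairs.\<close>

fun lcode :: "('a \<Rightarrow> bool list) \<Rightarrow> 'a list \<Rightarrow> bool list" where
  "lcode e [] = [False]"
| "lcode e (x # xs) = True # e x @ lcode e xs"

lemma code_lcode: "(\<And>x. tree_code (e x)) \<Longrightarrow> tree_code (lcode e xs)"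
  by (induction xs) (auto intro: tree_code.intros)

lemma length_lcode_mem: "y \<in> set xs \<Longrightarrow> length (e y) \<le> length (lcode e xs)"
  by (induction xs) auto

lemma length_le_lcode: "length xs \<le> length (lcode e xs)"
  by (induction xs) auto

text \<open>Iterating a polynomial-time step can let the accumulator grow exponentially; the bound
  on the code of every intermediate value excludes this. The remaining list is kept on a tape of its
  own and loses one element per pass.\<close>

lemma pt_fold:
  assumes l: "pt e (lcode el) l" and s: "pt e ea s"
    and g: "pt (pcode el ea) ea (\<lambda>p. g (fst p) (snd p))"
    and tree_code: "\<And>y. tree_code (el y)"
    and bound: "\<And>x i. length (ea (fold g (take i (l x)) (s x))) \<le> (length (e x) + 2) ^ b"
  shows "pt e ea (\<lambda>x. fold g (l x) (s x))"
proof -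
  from pt_pair[OF l s] obtain P n c where P: "uses n P" "0 < n"
    "\<And>x. rruns P (reg (e x)) ((length (e x) + 2) ^ c) (reg (pcode (lcode el) ea (l x, s x)))"
    "\<And>x. length (pcode (lcode el) ea (l x, s x)) \<le> (length (e x) + 2) ^ c"
    by (rule ptE) (rule that)
  from g obtain G m d where G: "uses m G" "0 < m"
    "\<And>p. rruns G (reg (pcode el ea p)) ((length (pcode el ea p) + 2) ^ d) (reg (ea (g (fst p) (snd p))))"
    by (rule ptE) (rule that)
  \<comment> \<open>Tape \<open>m + 3\<close> lies beyond the tapes of \<open>G\<close> and beyond
    the tapes 0, 1, 2 of the initial split, so the remaining list survives each call of
    \<open>G\<close>.\<close>
  let ?q = "m + 3" and ?E = "(\<lambda>_. []) :: regs"
  let ?body = "popp ?q ;; mvtree ?q (?q + 1) (?q + 2) ;; mvp (?q + 1) 0 ;; pushp 0 True ;; G"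
  let ?W = "whilep ?q (\<lambda>x. x = Some True) ?body"
  let ?R = "P ;; popp 0 ;; mvtree 0 1 2 ;; mvp 1 ?q ;; ?W ;; popp ?q"
  \<comment> \<open>Cost of one pass if \<open>B\<close> bounds the codes of the element and the
    accumulator; the argument of \<open>G\<close> then has length at most
    \<open>2 * B + 1\<close>.\<close>
  let ?K = "\<lambda>B. Suc (1 + ((7 * B + 3) + ((5 * B + 1) + (2 + (2 * B + 3) ^ d))))"
  have loop: "rruns ?W (?E(0 := ea a, ?q := lcode el xs)) (length xs * ?K B + 1)
      (?E(0 := ea (fold g xs a), ?q := [False]))"
    if "\<And>i. length (ea (fold g (take i xs) a)) \<le> B" "\<And>y. y \<in> set xs \<Longrightarrow> length (el y) \<le> B" for xs a B
    using that
  proof (induction xs arbitrary: a)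
    case Nil
    show ?case
      by (rule rruns_cong[OF runs_while_done[where s = "st (?E(0 := ea a, ?q := [False]))"]])
        (auto simp: fun_eq_iff)
  next
    case (Cons y ys)
    have y: "length (el y) \<le> B" using Cons.prems(2) by simp
    have a: "length (ea a) \<le> B" using Cons.prems(1)[of 0] by simp
    have IH: "rruns ?W (?E(0 := ea (g y a), ?q := lcode el ys)) (length ys * ?K B + 1)
      (?E(0 := ea (fold g ys (g y a)), ?q := [False]))"
      by (rule Cons.IH) (use Cons.prems(1)[of "Suc _"] Cons.prems(2) in auto)
    have "rruns ?body (?E(0 := ea a, ?q := lcode el (y # ys)))
       (1 + ((7 * B + 3) + ((5 * B + 1) + (2 + (2 * B + 3) ^ d)))) (?E(0 := ea (g y a), ?q := lcode el ys))"
    proof (rule runs_seq[OF _ runs_seq[OF _ runs_seq[OF _ runs_seq]]])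
      show "rruns (popp ?q) (?E(0 := ea a, ?q := lcode el (y # ys))) 1 (?E(0 := ea a, ?q := el y @ lcode el ys))"
        by (rule rruns_pop) auto
      show "rruns (mvtree ?q (?q + 1) (?q + 2)) (?E(0 := ea a, ?q := el y @ lcode el ys)) (7 * B + 3)
          (?E(0 := ea a, ?q := lcode el ys, ?q + 1 := rev (el y)))"
        using y by (intro runs_mono[OF rruns_mvtree[OF tree_code[of y]]]) auto
      show "rruns (mvp (?q + 1) 0) (?E(0 := ea a, ?q := lcode el ys, ?q + 1 := rev (el y))) (5 * B + 1)
          (?E(0 := el y @ ea a, ?q := lcode el ys))"
        using y by (intro runs_mono[OF rruns_mv]) (auto simp: fun_eq_iff)
      show "rruns (pushp 0 True) (?E(0 := el y @ ea a, ?q := lcode el ys)) 2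
          (?E(0 := pcode el ea (y, a), ?q := lcode el ys))"
        by (rule rruns_push) (auto simp: fun_eq_iff pcode_def)
      have "length (pcode el ea (y, a)) + 2 \<le> 2 * B + 3" using y a by (simp add: pcode_def)
      then have le: "(length (pcode el ea (y, a)) + 2) ^ d \<le> (2 * B + 3) ^ d" by (intro power_mono) auto
      have "rruns (shiftp 0 G) (?E(0 := pcode el ea (y, a), ?q := lcode el ys)) ((2 * B + 3) ^ d)
          (?E(0 := ea (g y a), ?q := lcode el ys))"
        by (rule rruns_call[OF G(1,2) runs_mono[OF G(3) le]]) (auto simp: fun_eq_iff)
      then show "rruns G (?E(0 := pcode el ea (y, a), ?q := lcode el ys)) ((2 * B + 3) ^ d)
          (?E(0 := ea (g y a), ?q := lcode el ys))"
        by (simp add: shiftp_def)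
    qed
    from runs_while_step[OF _ this IH]
    have "rruns ?W (?E(0 := ea a, ?q := lcode el (y # ys))) (?K B + (length ys * ?K B + 1))
      (?E(0 := ea (fold g ys (g y a)), ?q := [False]))" by simp
    then show ?case by (rule rruns_cong) (auto simp: fun_eq_iff)
  qed
  let ?B = "\<lambda>N. (N + 2) ^ c + (N + 2) ^ b"
  let ?T = "\<lambda>N. (N + 2) ^ c + (1 + ((7 * (N + 2) ^ c + 3) + ((5 * (N + 2) ^ c + 1) +
     (((N + 2) ^ c * ?K (?B N) + 1) + 1))))"
  have run: "rruns ?R (reg (e x)) (?T (length (e x))) (reg (ea (fold g (l x) (s x))))" for x
  proof (rule runs_seq[OF P(3) runs_seq[OF _ runs_seq[OF _ runs_seq[OF _ runs_seq]]]])
    let ?L = "lcode el (l x)" and ?N = "length (e x)"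
    have L: "length ?L \<le> (?N + 2) ^ c" using P(4)[of x] by (simp add: pcode_def)
    show "rruns (popp 0) (reg (pcode (lcode el) ea (l x, s x))) 1 (?E(0 := ?L @ ea (s x)))"
      by (rule rruns_pop) (auto simp: reg_def pcode_def)
    show "rruns (mvtree 0 1 2) (?E(0 := ?L @ ea (s x))) (7 * (?N + 2) ^ c + 3) (?E(0 := ea (s x), 1 := rev ?L))"
      using L by (intro runs_mono[OF rruns_mvtree[OF code_lcode[OF tree_code]]]) auto
    show "rruns (mvp 1 ?q) (?E(0 := ea (s x), 1 := rev ?L)) (5 * (?N + 2) ^ c + 1) (?E(0 := ea (s x), ?q := ?L))"
      using L by (intro runs_mono[OF rruns_mv]) (auto simp: fun_eq_iff)
    have "length (l x) * ?K (?B ?N) + 1 \<le> (?N + 2) ^ c * ?K (?B ?N) + 1"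
      using L length_le_lcode[of "l x" el] by (intro add_mono mult_le_mono) auto
    then show "rruns ?W (?E(0 := ea (s x), ?q := ?L)) ((?N + 2) ^ c * ?K (?B ?N) + 1)
      (?E(0 := ea (fold g (l x) (s x)), ?q := [False]))"
    proof (rule runs_mono[OF loop, rotated 2])
      show "length (ea (fold g (take i (l x)) (s x))) \<le> ?B ?N" for i
        using bound[of i x] by simp
      show "length (el y) \<le> ?B ?N" if "y \<in> set (l x)" for y
        using length_lcode_mem[OF that, of el] L by simp
    qed
    show "rruns (popp ?q) (?E(0 := ea (fold g (l x) (s x)), ?q := [False])) 1 (reg (ea (fold g (l x) (s x))))"
      by (rule rruns_pop) (auto simp: reg_def fun_eq_iff)
  qed
  show ?thesis
  proof (rule ptI[where p = ?T and q = "\<lambda>N. (N + 2) ^ b"])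
    show "uses (n + m + 6) ?R"
      by (intro uses_while uses_seq uses_basic uses_mvtree uses_mono[OF P(1)] uses_mono[OF G(1)]) auto
    show "rruns ?R (reg (e x)) (?T (length (e x))) (reg (ea (fold g (l x) (s x))))" for x by (rule run)
    show "length (ea (fold g (l x) (s x))) \<le> (length (e x) + 2) ^ b" for x
      using bound[where x = x and i = "length (l x)"] by simp
  qed (simp | intro polyb_intros)+
qed

text \<open>A tree code whose first symbol is the value itself, which is what \<open>pt_if\<close>
  tests.\<close>

definition bcode :: "bool \<Rightarrow> bool list" where
  "bcode b = (if b then [True, False, False] else [False])"

text \<open>Two codes are compared symbol by symbol, and mismatches are marked on tape 3. They agree
  iff no mark was made and nothing is left of the second one.\<close>

lemma pt_eq:
  assumes f: "pt e e1 f" and g: "pt e e1 g"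
    and tree_code: "\<And>x. tree_code (e1 x)" and inj: "inj e1"
  shows "pt e bcode (\<lambda>x. f x = g x)"
proof -
  let ?E = "(\<lambda>_. []) :: regs"
  let ?diff = "pushp 3 True ;; popp 1 ;; popp 2"
  let ?same = "popp 1 ;; popp 2"
  let ?body = "ifp 1 (\<lambda>x. x = Some True) (ifp 2 (\<lambda>x. x = Some True) ?same ?diff)
     (ifp 2 (\<lambda>x. x = Some False) ?same ?diff)"
  let ?W = "whilep 1 (\<lambda>x. x \<noteq> None) ?body"
  \<comment> \<open>An exhausted second word shows a blank, which counts as a mismatch; popping an
    empty stack changes nothing.\<close>
  have loop: "\<exists>zs'. rruns ?W (?E(1 := xs, 2 := ys, 3 := zs)) (7 * length xs + 1)
      (?E(2 := drop (length xs) ys, 3 := zs')) \<and> length zs' \<le> length zs + length xs \<and>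
      (zs' = [] \<longleftrightarrow> zs = [] \<and> take (length xs) ys = xs)" for xs ys zs
  proof (induction xs arbitrary: ys zs)
    case Nil
    have "rruns ?W (?E(1 := [], 2 := ys, 3 := zs)) 1 (?E(2 := ys, 3 := zs))"
      by (rule rruns_cong[OF runs_while_done[where s = "st (?E(2 := ys, 3 := zs))"]]) (auto simp: fun_eq_iff)
    note * = this
    show ?case
      by (rule exI[of _ zs], intro conjI, rule rruns_cong[OF *]) (auto simp: fun_eq_iff)
  next
    case (Cons x xs)
    define zs1 where "zs1 = (if stack_top ys = Some x then zs else True # zs)"
    from Cons.IH[of "tl ys" zs1] obtain zs' where
      IH: "rruns ?W (?E(1 := xs, 2 := tl ys, 3 := zs1)) (7 * length xs + 1)
        (?E(2 := drop (length xs) (tl ys), 3 := zs'))" and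
      zs': "length zs' \<le> length zs1 + length xs"
        "zs' = [] \<longleftrightarrow> zs1 = [] \<and> take (length xs) (tl ys) = xs" by blast
    have same: "rruns ?same (?E(1 := x # xs, 2 := ys, 3 := zs)) (1 + 1) (?E(1 := xs, 2 := tl ys, 3 := zs))"
      by (rule runs_seq[OF rruns_pop[OF refl] rruns_pop]) (auto simp: fun_eq_iff)
    have diff: "rruns ?diff (?E(1 := x # xs, 2 := ys, 3 := zs)) (2 + (1 + 1)) (?E(1 := xs, 2 := tl ys, 3 := True # zs))"
      by (rule runs_seq[OF rruns_push[OF refl] runs_seq[OF rruns_pop[OF refl] rruns_pop]]) (auto simp: fun_eq_iff)
    have "rruns ?body (?E(1 := x # xs, 2 := ys, 3 := zs)) (Suc (Suc 4)) (?E(1 := xs, 2 := tl ys, 3 := zs1))"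
      using same diff by (intro rruns_if) (auto simp: zs1_def elim: runs_mono)
    from runs_while_step[OF _ this IH]
    have "rruns ?W (?E(1 := x # xs, 2 := ys, 3 := zs)) (7 * length (x # xs) + 1)
      (?E(2 := drop (length (x # xs)) ys, 3 := zs'))" by (simp add: drop_Suc)
    moreover have "zs' = [] \<longleftrightarrow> zs = [] \<and> take (length (x # xs)) ys = x # xs"
      using zs'(2) by (cases ys) (auto simp: zs1_def)
    moreover have "length zs' \<le> length zs + length (x # xs)"
      using zs'(1) by (auto simp: zs1_def split: if_splits)
    ultimately show ?case by blast
  qed
  let ?true = "pushp 0 False ;; pushp 0 False ;; pushp 0 True"
  let ?R = "popp 0 ;; mvtree 0 1 2 ;; mvp 0 2 ;; ?W ;;
     ifp 3 (\<lambda>x. x = None) (ifp 2 (\<lambda>x. x = None) ?true (pushp 0 False)) (pushp 0 False) ;; clearp 2 ;; clearp 3"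
  let ?T = "\<lambda>N. 1 + ((7 * N + 3) + ((5 * N + 1) + ((7 * N + 1) + (Suc (Suc 6) + ((2 * N + 1) + (2 * N + 1))))))"
  let ?e = "\<lambda>x. pcode e1 e1 (f x, g x)"
  have run: "rruns ?R (reg (?e x)) (?T (length (?e x))) (reg (bcode (f x = g x)))" for x
  proof -
    let ?u = "e1 (f x)" and ?v = "e1 (g x)" and ?N = "length (?e x)"
    have N: "length ?u \<le> ?N" "length ?v \<le> ?N" by (auto simp: pcode_def)
    from loop[of "rev ?u" "rev ?v" "[]"] obtain zs where
      zs: "rruns ?W (?E(1 := rev ?u, 2 := rev ?v)) (7 * length ?u + 1) (?E(2 := drop (length ?u) (rev ?v), 3 := zs))"
        "length zs \<le> length ?u" "zs = [] \<longleftrightarrow> take (length ?u) (rev ?v) = rev ?u"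
      by (auto simp: fun_upd_idem)
    let ?S = "?E(2 := drop (length ?u) (rev ?v), 3 := zs)"
    have eq: "f x = g x \<longleftrightarrow> zs = [] \<and> drop (length ?u) (rev ?v) = []"
      using zs(3) injD[OF inj, of "f x" "g x"]
      by (metis append.right_neutral append_take_drop_id length_rev order_refl rev_rev_ident drop_eq_Nil)
    show ?thesis
    proof (rule runs_seq[OF _ runs_seq[OF _ runs_seq[OF _ runs_seq[OF _ runs_seq[OF _ runs_seq]]]]])
      show "rruns (popp 0) (reg (?e x)) 1 (?E(0 := ?u @ ?v))"
        by (rule rruns_pop) (auto simp: reg_def pcode_def)
      show "rruns (mvtree 0 1 2) (?E(0 := ?u @ ?v)) (7 * ?N + 3) (?E(0 := ?v, 1 := rev ?u))"
        using N by (intro runs_mono[OF rruns_mvtree[OF tree_code]]) auto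
      show "rruns (mvp 0 2) (?E(0 := ?v, 1 := rev ?u)) (5 * ?N + 1) (?E(1 := rev ?u, 2 := rev ?v))"
        using N by (intro runs_mono[OF rruns_mv]) (auto simp: fun_eq_iff)
      show "rruns ?W (?E(1 := rev ?u, 2 := rev ?v)) (7 * ?N + 1) ?S"
        using N by (intro runs_mono[OF zs(1)]) auto
      have t: "rruns ?true r (2 + (2 + 2)) (r(0 := bcode True))" if "r 0 = []" for r
        using that by (intro runs_seq[OF rruns_push[OF refl] runs_seq[OF rruns_push[OF refl] rruns_push]])
          (auto simp: bcode_def fun_eq_iff)
      have f: "rruns (pushp 0 False) r 6 (r(0 := bcode False))" if "r 0 = []" for r
        using that by (intro runs_mono[OF rruns_push]) (auto simp: bcode_def)
      show "rruns (ifp 3 (\<lambda>x. x = None) (ifp 2 (\<lambda>x. x = None) ?true (pushp 0 False)) (pushp 0 False))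
          ?S (Suc (Suc 6)) (?S(0 := bcode (f x = g x)))"
        unfolding eq using t[of ?S] f[of ?S] by (intro rruns_if) (auto elim: runs_mono)
      show "rruns (clearp 2) (?S(0 := bcode (f x = g x))) (2 * ?N + 1) (?E(0 := bcode (f x = g x), 3 := zs))"
        using N by (intro runs_mono[OF rruns_clear]) (auto simp: fun_eq_iff)
      show "rruns (clearp 3) (?E(0 := bcode (f x = g x), 3 := zs)) (2 * ?N + 1) (reg (bcode (f x = g x)))"
        using N zs(2) by (intro runs_mono[OF rruns_clear]) (auto simp: reg_def fun_eq_iff)
    qed
  qed
  have "pt ?e bcode (\<lambda>x. f x = g x)"
  proof (rule ptI[where p = ?T and q = "\<lambda>_. 3"])
    show "uses 4 ?R" by (intro uses_if uses_while uses_seq uses_basic uses_mvtree) auto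
    show "rruns ?R (reg (?e x)) (?T (length (?e x))) (reg (bcode (f x = g x)))" for x by (rule run)
    show "length (bcode (f x = g x)) \<le> 3" for x by (simp add: bcode_def)
  qed (simp | intro polyb_intros)+
  from pt_comp[OF pt_cong[OF pt_pair[OF f g]] this, of "\<lambda>x. x"] show ?thesis by simp
qed

text \<open>Machines see raw words, the calculus sees tree codes of lists of bits. This lemma and
  \<open>pt_code_word\<close> convert between the two.\<close>

lemma pt_word_code: "pt (\<lambda>w. w) (lcode bcode) (\<lambda>w. w)"
proof -
  let ?E = "(\<lambda>_. []) :: regs"
  let ?body = "ifp 1 (\<lambda>x. x = Some True)
    (popp 1 ;; pushp 0 False ;; pushp 0 False ;; pushp 0 True ;; pushp 0 True)
    (popp 1 ;; pushp 0 False ;; pushp 0 True)"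
  let ?W = "whilep 1 (\<lambda>x. x \<noteq> None) ?body"
  have loop: "rruns ?W (?E(0 := lcode bcode ys, 1 := xs)) (11 * length xs + 1)
      (?E(0 := lcode bcode (rev xs @ ys)))" for xs ys
  proof (induction xs arbitrary: ys)
    case Nil
    show ?case
      by (rule rruns_cong[OF runs_while_done[where s = "st (?E(0 := lcode bcode ys))"]]) (auto simp: fun_eq_iff)
  next
    case (Cons x xs)
    have t: "rruns (popp 1 ;; pushp 0 False ;; pushp 0 False ;; pushp 0 True ;; pushp 0 True)
       (?E(0 := lcode bcode ys, 1 := True # xs)) (1 + (2 + (2 + (2 + 2)))) (?E(0 := lcode bcode (True # ys), 1 := xs))"
      by (intro runs_seq[OF rruns_pop[OF refl] runs_seq[OF rruns_push[OF refl] runs_seq[OF rruns_push[OF refl] runs_seq[OF rruns_push[OF refl] rruns_push]]]])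
        (auto simp: fun_eq_iff bcode_def)
    have f: "rruns (popp 1 ;; pushp 0 False ;; pushp 0 True)
       (?E(0 := lcode bcode ys, 1 := False # xs)) (1 + (2 + 2)) (?E(0 := lcode bcode (False # ys), 1 := xs))"
      by (intro runs_seq[OF rruns_pop[OF refl] runs_seq[OF rruns_push[OF refl] rruns_push]])
        (auto simp: fun_eq_iff bcode_def)
    have "rruns ?body (?E(0 := lcode bcode ys, 1 := x # xs)) (Suc 9) (?E(0 := lcode bcode (x # ys), 1 := xs))"
    proof (rule rruns_if)
      assume "stack_top ((?E(0 := lcode bcode ys, 1 := x # xs)) 1) = Some True"
      then have x: "x = True" by simp
      show "rruns (popp 1 ;; pushp 0 False ;; pushp 0 False ;; pushp 0 True ;; pushp 0 True)
        (?E(0 := lcode bcode ys, 1 := x # xs)) 9 (?E(0 := lcode bcode (x # ys), 1 := xs))"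
        unfolding x by (rule runs_mono[OF t]) simp
    next
      assume "stack_top ((?E(0 := lcode bcode ys, 1 := x # xs)) 1) \<noteq> Some True"
      then have x: "x = False" by simp
      show "rruns (popp 1 ;; pushp 0 False ;; pushp 0 True)
        (?E(0 := lcode bcode ys, 1 := x # xs)) 9 (?E(0 := lcode bcode (x # ys), 1 := xs))"
        unfolding x by (rule runs_mono[OF f]) simp
    qed
    from runs_while_step[OF _ this Cons.IH[of "x # ys"]]
    show ?case by (rule rruns_cong) auto
  qed
  let ?R = "mvp 0 1 ;; pushp 0 False ;; ?W"
  have run: "rruns ?R (reg w) ((5 * length w + 1) + (2 + (11 * length w + 1))) (reg (lcode bcode w))" for w
  proof (rule runs_seq[OF _ runs_seq])
    show "rruns (mvp 0 1) (reg w) (5 * length w + 1) (?E(1 := rev w))"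
      by (rule rruns_mv) (auto simp: reg_def)
    show "rruns (pushp 0 False) (?E(1 := rev w)) 2 (?E(0 := lcode bcode [], 1 := rev w))"
      by (rule rruns_push) (auto simp: fun_eq_iff)
    show "rruns ?W (?E(0 := lcode bcode [], 1 := rev w)) (11 * length w + 1) (reg (lcode bcode w))"
      by (rule rruns_cong[OF loop[of "[]" "rev w"]]) (auto simp: reg_def)
  qed
  show ?thesis
  proof (rule ptI[where p = "\<lambda>N. (5 * N + 1) + (2 + (11 * N + 1))" and q = "\<lambda>N. 4 * N + 1"])
    show "uses 2 ?R" by (intro uses_if uses_while uses_seq uses_basic) auto
    show "rruns ?R (reg w) ((5 * length w + 1) + (2 + (11 * length w + 1))) (reg (lcode bcode w))" for w
      by (rule run)
    show "length (lcode bcode w) \<le> 4 * length w + 1" for w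
      by (induction w) (auto simp: bcode_def)
  qed (simp | intro polyb_intros)+
qed

lemma pt_code_word: "pt (lcode bcode) (\<lambda>w. w) (\<lambda>w. w)"
proof -
  let ?E = "(\<lambda>_. []) :: regs"
  let ?body = "popp 0 ;; ifp 0 (\<lambda>x. x = Some True)
    (popp 0 ;; popp 0 ;; popp 0 ;; pushp 1 True) (popp 0 ;; pushp 1 False)"
  let ?W = "whilep 0 (\<lambda>x. x = Some True) ?body"
  have loop: "rruns ?W (?E(0 := lcode bcode xs, 1 := ys)) (8 * length xs + 1)
      (?E(0 := [False], 1 := rev xs @ ys))" for xs ys
  proof (induction xs arbitrary: ys)
    case Nil
    show ?case
      by (rule rruns_cong[OF runs_while_done[where s = "st (?E(0 := [False], 1 := ys))"]]) (auto simp: fun_eq_iff)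
  next
    case (Cons x xs)
    have t: "rruns (popp 0 ;; popp 0 ;; popp 0 ;; pushp 1 True)
       (?E(0 := bcode True @ lcode bcode xs, 1 := ys)) (1 + (1 + (1 + 2))) (?E(0 := lcode bcode xs, 1 := True # ys))"
      by (intro runs_seq[OF rruns_pop[OF refl] runs_seq[OF rruns_pop[OF refl] runs_seq[OF rruns_pop[OF refl] rruns_push]]])
        (auto simp: fun_eq_iff bcode_def)
    have f: "rruns (popp 0 ;; pushp 1 False)
       (?E(0 := bcode False @ lcode bcode xs, 1 := ys)) (1 + 2) (?E(0 := lcode bcode xs, 1 := False # ys))"
      by (intro runs_seq[OF rruns_pop[OF refl] rruns_push]) (auto simp: fun_eq_iff bcode_def)
    have b: "rruns (ifp 0 (\<lambda>x. x = Some True) (popp 0 ;; popp 0 ;; popp 0 ;; pushp 1 True) (popp 0 ;; pushp 1 False))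
       (?E(0 := bcode x @ lcode bcode xs, 1 := ys)) (Suc 5) (?E(0 := lcode bcode xs, 1 := x # ys))"
    proof (rule rruns_if)
      assume "stack_top ((?E(0 := bcode x @ lcode bcode xs, 1 := ys)) 0) = Some True"
      then have x: "x = True" by (auto simp: bcode_def split: if_splits)
      show "rruns (popp 0 ;; popp 0 ;; popp 0 ;; pushp 1 True)
        (?E(0 := bcode x @ lcode bcode xs, 1 := ys)) 5 (?E(0 := lcode bcode xs, 1 := x # ys))"
        unfolding x by (rule runs_mono[OF t]) simp
    next
      assume "stack_top ((?E(0 := bcode x @ lcode bcode xs, 1 := ys)) 0) \<noteq> Some True"
      then have x: "x = False" by (auto simp: bcode_def split: if_splits)
      show "rruns (popp 0 ;; pushp 1 False)
        (?E(0 := bcode x @ lcode bcode xs, 1 := ys)) 5 (?E(0 := lcode bcode xs, 1 := x # ys))"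
        unfolding x by (rule runs_mono[OF f]) simp
    qed
    have "rruns ?body (?E(0 := lcode bcode (x # xs), 1 := ys)) (1 + Suc 5) (?E(0 := lcode bcode xs, 1 := x # ys))"
      by (rule runs_seq[OF rruns_pop b]) (auto simp: fun_eq_iff)
    from runs_while_step[OF _ this Cons.IH[of "x # ys"]]
    show ?case by (rule rruns_cong) auto
  qed
  let ?R = "?W ;; popp 0 ;; mvp 1 0"
  have run: "rruns ?R (reg (lcode bcode w)) ((8 * length w + 1) + (1 + (5 * length w + 1))) (reg w)" for w
  proof (rule runs_seq[OF _ runs_seq])
    show "rruns ?W (reg (lcode bcode w)) (8 * length w + 1) (?E(0 := [False], 1 := rev w))"
      by (rule rruns_cong[OF loop[of w "[]"]]) (auto simp: reg_def)
    show "rruns (popp 0) (?E(0 := [False], 1 := rev w)) 1 (?E(1 := rev w))"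
      by (rule rruns_pop) (auto simp: fun_eq_iff)
    show "rruns (mvp 1 0) (?E(1 := rev w)) (5 * length w + 1) (reg w)"
      by (rule rruns_mv) (auto simp: reg_def)
  qed
  show ?thesis
  proof (rule ptI[where p = "\<lambda>N. (8 * N + 1) + (1 + (5 * N + 1))" and q = "\<lambda>N. N"])
    show "uses 2 ?R" by (intro uses_if uses_while uses_seq uses_basic) auto
    show "rruns ?R (reg (lcode bcode w)) ((8 * length w + 1) + (1 + (5 * length w + 1))) (reg w)" for w
      by (rule run)
    show "length w \<le> length (lcode bcode w)" for w by (rule length_le_lcode)
    show "(8 * length w + 1) + (1 + (5 * length w + 1)) \<le>
       (8 * length (lcode bcode w) + 1) + (1 + (5 * length (lcode bcode w) + 1))" for w
      using length_le_lcode[of w bcode] by simp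
  qed (simp | intro polyb_intros)+
qed

section \<open>Polynomial-time functions on structured data\<close>

text \<open>The reason why concatenated codes can be split, and hence why \<open>tc\<close> is
  injective on pairs and lists.\<close>

lemma code_prefix_free:
  assumes "tree_code u"
  shows "tree_code u' \<Longrightarrow> u @ v = u' @ v' \<Longrightarrow> u = u' \<and> v = v'"
  using assms
proof (induction u arbitrary: u' v v' rule: tree_code.induct)
  case code_leaf
  then show ?case by (auto elim: tree_code.cases)
next
  case (code_node a b)
  from code_node.prems obtain c d where u': "u' = True # c @ d" "tree_code c" "tree_code d"
    by (auto elim: tree_code.cases)
  with code_node.prems have "a @ b @ v = c @ d @ v'" by simp
  with code_node.IH(1)[OF u'(2)] have "a = c" "b @ v = d @ v'" by blast+
  with code_node.IH(2)[OF u'(3)] u' show ?case by blast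
qed

class tree_codable =
  fixes tc :: "'a \<Rightarrow> bool list"
  assumes code_tc: "tree_code (tc x)"
    and tc_inj: "tc x = tc y \<Longrightarrow> x = y"

lemma inj_tc: "inj (tc :: 'a::tree_codable \<Rightarrow> _)"
  by (auto intro: injI tc_inj)

instantiation bool :: tree_codable
begin
definition "tc = bcode"
instance
proof
  show "tree_code (tc b)" for b :: bool
    using code_node[OF code_leaf code_leaf] code_leaf by (simp add: tc_bool_def bcode_def)
qed (auto simp: tc_bool_def bcode_def split: if_splits)
end

instantiation list :: (tree_codable) tree_codable
begin
definition "tc = lcode (tc :: 'a \<Rightarrow> _)"
instance
proof
  fix xs ys :: "'a list"
  show "tree_code (tc xs)" unfolding tc_list_def by (rule code_lcode[OF code_tc])
  show "tc xs = tc ys \<Longrightarrow> xs = ys" unfolding tc_list_def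
  proof (induction xs arbitrary: ys)
    case Nil
    then show ?case by (cases ys) auto
  next
    case (Cons x xs)
    then obtain y zs where "ys = y # zs" by (cases ys) auto
    with Cons code_prefix_free[OF code_tc[of x] code_tc[of y]] show ?case
      by (auto dest: tc_inj)
  qed
qed
end

instantiation prod :: (tree_codable, tree_codable) tree_codable
begin
definition "tc = pcode (tc :: 'a \<Rightarrow> _) (tc :: 'b \<Rightarrow> _)"
instance
proof
  fix p q :: "'a \<times> 'b"
  show "tree_code (tc p)" by (auto simp: tc_prod_def pcode_def intro: tree_code.intros code_tc)
  assume "tc p = tc q"
  then have "tc (fst p) @ tc (snd p) = tc (fst q) @ tc (snd q)" by (simp add: tc_prod_def pcode_def)
  from code_prefix_free[OF code_tc code_tc this] show "p = q" by (auto simp: prod_eq_iff dest: tc_inj)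
qed
end

text \<open>Numbers are coded in unary, so polynomial time is measured in their values. This agrees
  with \<open>enc_nat\<close> and the unary parameter of \<open>enc_instance\<close>, and it makes
  lists such as \<open>[0..<n]\<close> polynomial objects.\<close>

instantiation nat :: tree_codable
begin
definition "tc n = tc (replicate n False)"
instance
proof
  fix m n :: nat
  show "tree_code (tc n)" by (simp add: tc_nat_def code_tc)
  assume "tc m = tc n"
  then have "replicate m False = replicate n False" unfolding tc_nat_def by (rule tc_inj)
  then show "m = n" by (metis length_replicate)
qed
end

fun gate_tag :: "gate \<Rightarrow> nat" where
  "gate_tag InpG = 0" | "gate_tag (NotG i) = 1" | "gate_tag (AndG is) = 2" | "gate_tag (OrG is) = 3"

text \<open>With the pair of tag and arguments as the code, both are available through the
  projections of a pair.\<close>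

instantiation gate :: tree_codable
begin
definition "tc g = tc (gate_tag g, gate_args g)"
instance
proof
  fix g h :: gate
  show "tree_code (tc g)" by (simp add: tc_gate_def code_tc)
  show "tc g = tc h \<Longrightarrow> g = h" unfolding tc_gate_def
    by (drule tc_inj, cases g; cases h) auto
qed
end

abbreviation sz :: "'a::tree_codable \<Rightarrow> nat" where
  "sz x \<equiv> length (tc x)"

lemma sz_Nil [simp]: "sz [] = 1"
  by (simp add: tc_list_def)

lemma sz_Cons [simp]: "sz (x # xs) = Suc (sz x + sz xs)"
  by (simp add: tc_list_def)

lemma sz_Pair [simp]: "sz (a, b) = Suc (sz a + sz b)"
  by (simp add: tc_prod_def pcode_def)

lemma sz_False [simp]: "sz False = 1"
  by (simp add: tc_bool_def bcode_def)

lemma sz_nat [simp]: "sz (n :: nat) = 2 * n + 1"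
  unfolding tc_nat_def by (induction n) auto

lemma sz_append: "Suc (sz (xs @ ys)) = sz xs + sz ys"
  by (induction xs) auto

lemma sz_mem: "y \<in> set xs \<Longrightarrow> sz y \<le> sz xs"
  by (induction xs) auto

lemma length_le_sz: "length xs \<le> sz xs"
  by (induction xs) auto

section \<open>Closure properties of polynomial-time functions\<close>

definition poly :: "('a::tree_codable \<Rightarrow> 'b::tree_codable) \<Rightarrow> bool" where
  "poly f \<longleftrightarrow> pt tc tc f"

named_theorems poly_intros

lemma poly_size:
  assumes "poly f"
  obtains c where "\<And>x. sz (f x) \<le> (sz x + 2) ^ c"
  using assms unfolding poly_def by (rule ptE) (rule that)

lemma poly_id [poly_intros]: "poly (\<lambda>x. x)"
  unfolding poly_def by (rule pt_id)

lemma poly_const [poly_intros]: "poly (\<lambda>_. k)"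
  unfolding poly_def by (rule pt_const_word)

lemma poly_comp: "poly f \<Longrightarrow> poly g \<Longrightarrow> poly (\<lambda>x. g (f x))"
  unfolding poly_def by (rule pt_comp)

lemma poly_Pair [poly_intros]: "poly f \<Longrightarrow> poly g \<Longrightarrow> poly (\<lambda>x. (f x, g x))"
  unfolding poly_def tc_prod_def by (rule pt_pair)

text \<open>Closure rules speak of functions of a common argument \<open>x\<close>; a curried
  \<open>F\<close> enters them as a function on pairs, and this rule substitutes its
  arguments.\<close>

lemma poly_comp2:
  assumes "poly (\<lambda>p. F (fst p) (snd p))" "poly a" "poly b"
  shows "poly (\<lambda>x. F (a x) (b x))"
  using poly_comp[OF poly_Pair[OF assms(2,3)] assms(1)] by simp

lemma poly_comp3:
  assumes "poly (\<lambda>p. F (fst p) (fst (snd p)) (snd (snd p)))" "poly a" "poly b" "poly c"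
  shows "poly (\<lambda>x. F (a x) (b x) (c x))"
  using poly_comp[OF poly_Pair[OF assms(2) poly_Pair[OF assms(3,4)]] assms(1)] by simp

lemma poly_snd [poly_intros]: "poly f \<Longrightarrow> poly (\<lambda>x. snd (f x))"
  unfolding poly_def by (erule pt_second) (auto simp: tc_prod_def pcode_def intro: code_tc)

lemma poly_fst [poly_intros]: "poly f \<Longrightarrow> poly (\<lambda>x. fst (f x))"
  unfolding poly_def
  by (erule pt_first[where ?w0.0 = "[]"]) (auto simp: tc_prod_def pcode_def intro: code_tc)

lemma poly_Cons [poly_intros]:
  assumes "poly f" "poly l" shows "poly (\<lambda>x. f x # l x)"
  unfolding poly_def
  by (rule pt_cong[OF pt_pair[OF assms[unfolded poly_def]]]) (simp add: pcode_def tc_list_def)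

lemma poly_tl [poly_intros]:
  assumes "poly l" shows "poly (\<lambda>x. tl (l x))"
  unfolding poly_def
proof (rule pt_second[OF assms[unfolded poly_def]])
  show "(tc (l x) = [False] \<and> tc (tl (l x)) = [False]) \<or> (\<exists>u. tree_code u \<and> tc (l x) = True # u @ tc (tl (l x)))" for x
    by (cases "l x") (auto simp: tc_list_def intro: code_tc)
qed

lemma poly_hd [poly_intros]:
  fixes l :: "'a::tree_codable \<Rightarrow> 'b::tree_codable list"
  assumes "poly l" shows "poly (\<lambda>x. hd (l x))"
  unfolding poly_def
proof (rule pt_first[OF assms[unfolded poly_def]])
  show "(tc (l x) = [False] \<and> tc (hd (l x)) = tc (hd [] :: 'b)) \<or>
     (\<exists>v. tree_code (tc (hd (l x))) \<and> tc (l x) = True # tc (hd (l x)) @ v)" for x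
    by (cases "l x") (auto simp: tc_list_def intro: code_tc)
qed

lemma poly_if [poly_intros]:
  assumes "poly b" "poly g" "poly h"
  shows "poly (\<lambda>x. if b x then g x else h x)"
  unfolding poly_def
  by (rule pt_if[where t = b and b = b, OF assms(1)[unfolded poly_def] _ assms(2,3)[unfolded poly_def]])
    (simp add: tc_bool_def bcode_def)

lemma poly_not [poly_intros]: assumes "poly b" shows "poly (\<lambda>x. \<not> b x)"
proof -
  have "(\<lambda>x. \<not> b x) = (\<lambda>x. if b x then False else True)" by auto
  then show ?thesis using poly_if[OF assms poly_const[of False] poly_const[of True]] by (simp only:)
qed

lemma poly_conj [poly_intros]: assumes "poly a" "poly b" shows "poly (\<lambda>x. a x \<and> b x)"
proof -
  have "(\<lambda>x. a x \<and> b x) = (\<lambda>x. if a x then b x else False)" by auto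
  then show ?thesis using poly_if[OF assms poly_const[of False]] by (simp only:)
qed

lemma poly_disj [poly_intros]: assumes "poly a" "poly b" shows "poly (\<lambda>x. a x \<or> b x)"
proof -
  have "(\<lambda>x. a x \<or> b x) = (\<lambda>x. if a x then True else b x)" by auto
  then show ?thesis using poly_if[OF assms(1) poly_const[of True] assms(2)] by (simp only:)
qed

lemma poly_imp [poly_intros]: assumes "poly a" "poly b" shows "poly (\<lambda>x. a x \<longrightarrow> b x)"
proof -
  have "(\<lambda>x. a x \<longrightarrow> b x) = (\<lambda>x. if a x then b x else True)" by auto
  then show ?thesis using poly_if[OF assms poly_const[of True]] by (simp only:)
qed

lemma poly_eq [poly_intros]: "poly f \<Longrightarrow> poly g \<Longrightarrow> poly (\<lambda>x. f x = g x)"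
  unfolding poly_def tc_bool_def by (rule pt_eq[OF _ _ code_tc inj_tc])

lemma poly_fold:
  assumes l: "poly l" and s: "poly s"
    and f: "poly (\<lambda>p. f (fst p) (fst (snd p)) (snd (snd p)))"
    and bound: "\<And>x i. sz (fold (f x) (take i (l x)) (s x)) \<le> p (sz x)" and p: "polyb p"
  shows "poly (\<lambda>x. fold (f x) (l x) (s x))"
proof -
  \<comment> \<open>The step may depend on the input \<open>x\<close>, which \<open>pt_fold\<close>
    does not provide; the accumulator carries a copy of \<open>x\<close>.\<close>
  let ?g = "\<lambda>y st. (fst st, f (fst st) y (snd st))"
  have fold: "fold ?g ys (x, a) = (x, fold (f x) ys a)" for ys x a
    by (induction ys arbitrary: a) auto
  have "polyb (\<lambda>N. Suc (N + p N))" by (intro polyb_intros p)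
  then obtain b where b: "\<And>N. Suc (N + p N) \<le> (N + 2) ^ b" unfolding polyb_def by blast
  have "pt tc tc (\<lambda>x. fold ?g (l x) (x, s x))"
  proof (rule pt_fold[where el = tc and b = b])
    show "pt tc (lcode tc) l" using l by (simp add: poly_def tc_list_def)
    show "pt tc tc (\<lambda>x. (x, s x))" using poly_Pair[OF poly_id s] by (simp add: poly_def)
    have "poly (\<lambda>p. ?g (fst p) (snd p))"
      by (intro poly_Pair poly_comp3[OF f] poly_intros)
    then show "pt (pcode tc tc) tc (\<lambda>p. ?g (fst p) (snd p))" by (simp add: poly_def tc_prod_def)
    show "sz (fold ?g (take i (l x)) (x, s x)) \<le> (sz x + 2) ^ b" for x i
      unfolding fold using bound[where x = x and i = i] b[of "sz x"] by simp
  qed (rule code_tc)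
  then have "poly (\<lambda>x. (x, fold (f x) (l x) (s x)))" by (simp add: fold poly_def)
  from poly_snd[OF this] show ?thesis by simp
qed

text \<open>Each step adds an amount that does not depend on the accumulator, so the total growth is
  at most the length of the list times a polynomial. A step such as doubling is ruled out.\<close>

lemma poly_fold_additive:
  assumes l: "poly l" and s: "poly s"
    and f: "poly (\<lambda>p. f (fst p) (fst (snd p)) (snd (snd p)))"
    and add: "\<And>x y a. y \<in> set (l x) \<Longrightarrow> sz (f x y a) \<le> sz a + 1 + (sz (x, y) + 2) ^ c"
  shows "poly (\<lambda>x. fold (f x) (l x) (s x))"
proof -
  from poly_size[OF l] obtain cl where cl: "\<And>x. sz (l x) \<le> (sz x + 2) ^ cl" by blast
  from poly_size[OF s] obtain cs where cs: "\<And>x. sz (s x) \<le> (sz x + 2) ^ cs" by blast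
  let ?K = "\<lambda>N. 1 + (1 + N + (N + 2) ^ cl + 2) ^ c"
  show ?thesis
  proof (rule poly_fold[OF l s f])
    fix x i
    have "sz (fold (f x) ys a) \<le> sz a + length ys * ?K (sz x)" if "set ys \<subseteq> set (l x)" for ys a
      using that
    proof (induction ys arbitrary: a)
      case (Cons y ys)
      have "sz y \<le> (sz x + 2) ^ cl" using Cons.prems sz_mem[of y "l x"] cl[of x] by simp
      then have "(sz (x, y) + 2) ^ c \<le> (1 + sz x + (sz x + 2) ^ cl + 2) ^ c"
        by (intro power_mono) auto
      moreover have "sz (f x y a) \<le> sz a + 1 + (sz (x, y) + 2) ^ c" using Cons.prems by (intro add) simp
      ultimately have "sz (f x y a) \<le> sz a + ?K (sz x)" by linarith
      moreover have "sz (fold (f x) ys (f x y a)) \<le> sz (f x y a) + length ys * ?K (sz x)"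
        using Cons.prems by (intro Cons.IH) simp
      ultimately show ?case by simp
    qed simp
    from this[OF set_take_subset, of i "s x"]
    have "sz (fold (f x) (take i (l x)) (s x)) \<le> sz (s x) + length (take i (l x)) * ?K (sz x)" .
    also have "\<dots> \<le> (sz x + 2) ^ cs + (sz x + 2) ^ cl * ?K (sz x)"
      using cs[of x] cl[of x] length_le_sz[of "l x"] by (intro add_mono mult_le_mono) auto
    finally show "sz (fold (f x) (take i (l x)) (s x)) \<le> (\<lambda>N. (N + 2) ^ cs + (N + 2) ^ cl * ?K N) (sz x)" .
  qed (intro polyb_intros)
qed

section \<open>Operations on lists\<close>

lemma poly_rev [poly_intros]:
  assumes "poly l" shows "poly (\<lambda>x. rev (l x))"
proof -
  have "poly (\<lambda>x. fold (\<lambda>y a. y # a) (l x) [])"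
    by (rule poly_fold_additive[where c = 1], (intro poly_intros assms)+) auto
  then show ?thesis by (simp add: fold_Cons_rev)
qed

lemma poly_append [poly_intros]:
  assumes "poly l" "poly m" shows "poly (\<lambda>x. l x @ m x)"
proof -
  have "poly (\<lambda>x. fold (\<lambda>y a. y # a) (rev (l x)) (m x))"
    by (rule poly_fold_additive[where c = 1], (intro poly_intros assms)+) auto
  then show ?thesis by (simp add: fold_Cons_rev)
qed

lemma poly_map [poly_intros]:
  assumes f: "poly (\<lambda>p. f (fst p) (snd p))" and l: "poly l"
  shows "poly (\<lambda>x. map (f x) (l x))"
proof -
  from poly_size[OF f] obtain c where c: "\<And>p. sz (f (fst p) (snd p)) \<le> (sz p + 2) ^ c" by blast
  have "poly (\<lambda>x. fold (\<lambda>y a. f x y # a) (l x) [])"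
  proof (rule poly_fold_additive[where c = c])
    show "sz (f x y # a) \<le> sz a + 1 + (sz (x, y) + 2) ^ c" for x y a
      using c[of "(x, y)"] by simp
  qed (intro poly_intros l poly_comp2[OF f])+
  moreover have "fold (\<lambda>y a. f x y # a) ys a = rev (map (f x) ys) @ a" for x ys a
    by (induction ys arbitrary: a) auto
  ultimately have "poly (\<lambda>x. rev (map (f x) (l x)))" by simp
  from poly_rev[OF this] show ?thesis by simp
qed

lemma poly_filter [poly_intros]:
  assumes f: "poly (\<lambda>p. P (fst p) (snd p))" and l: "poly l"
  shows "poly (\<lambda>x. filter (P x) (l x))"
proof -
  have "poly (\<lambda>x. fold (\<lambda>y a. if P x y then y # a else a) (l x) [])"
    by (rule poly_fold_additive[where c = 1], (intro poly_intros l poly_comp2[OF f])+) auto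
  moreover have "fold (\<lambda>y a. if P x y then y # a else a) ys a = rev (filter (P x) ys) @ a" for x ys a
    by (induction ys arbitrary: a) auto
  ultimately have "poly (\<lambda>x. rev (filter (P x) (l x)))" by simp
  from poly_rev[OF this] show ?thesis by simp
qed

lemma poly_concat [poly_intros]:
  assumes "poly l" shows "poly (\<lambda>x. concat (l x))"
proof -
  have "poly (\<lambda>x. fold (\<lambda>y a. a @ y) (l x) [])"
  proof (rule poly_fold_additive[where c = 1])
    show "sz (a @ y) \<le> sz a + 1 + (sz (x, y) + 2) ^ 1" for x :: 'a and y a :: "'b list"
      using sz_append[of a y] by simp
  qed (intro poly_intros assms)+
  moreover have "fold (\<lambda>y a. a @ y) ys a = a @ concat ys" for ys and a :: "'b list"
    by (induction ys arbitrary: a) auto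
  ultimately show ?thesis by simp
qed

lemma poly_Ball [poly_intros]:
  assumes "poly l" "poly (\<lambda>p. P (fst p) (snd p))"
  shows "poly (\<lambda>x. \<forall>y\<in>set (l x). P x y)"
proof -
  have "poly (\<lambda>x. filter (\<lambda>y. \<not> P x y) (l x) = [])" by (intro poly_intros assms)
  then show ?thesis by (simp add: filter_empty_conv)
qed

lemma poly_Bex [poly_intros]:
  assumes "poly l" "poly (\<lambda>p. P (fst p) (snd p))"
  shows "poly (\<lambda>x. \<exists>y\<in>set (l x). P x y)"
proof -
  have "poly (\<lambda>x. \<not> (\<forall>y\<in>set (l x). \<not> P x y))" by (intro poly_intros assms)
  then show ?thesis by simp
qed

section \<open>Arithmetic in unary, and iteration\<close>

lemma poly_Suc [poly_intros]:
  assumes "poly n" shows "poly (\<lambda>x. Suc (n x))"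
  \<comment> \<open>The unary code of \<open>n + 1\<close> is the code of the pair
    \<open>(False, n)\<close>.\<close>
  using poly_Pair[OF poly_const[of False] assms] unfolding poly_def
  by (rule pt_cong) (simp add: tc_prod_def pcode_def tc_nat_def tc_list_def)

lemma poly_pred:
  assumes "poly n" shows "poly (\<lambda>x. n x - 1 :: nat)"
  unfolding poly_def
proof (rule pt_second[OF assms[unfolded poly_def]])
  show "(tc (n x) = [False] \<and> tc (n x - 1) = [False]) \<or> (\<exists>u. tree_code u \<and> tc (n x) = True # u @ tc (n x - 1))" for x
    by (cases "n x") (auto simp: tc_nat_def tc_list_def intro: code_tc)
qed

lemma poly_replicate_False: "poly n \<Longrightarrow> poly (\<lambda>x. replicate (n x) False)"
  unfolding poly_def by (erule pt_cong) (simp add: tc_nat_def)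

lemma poly_length [poly_intros]:
  assumes "poly l" shows "poly (\<lambda>x. length (l x))"
proof -
  have "poly (\<lambda>x. fold (\<lambda>y a. Suc a) (l x) 0)"
    by (rule poly_fold_additive[where c = 1], (intro poly_intros assms)+) auto
  moreover have "fold (\<lambda>y a. Suc a) ys a = length ys + a" for a and ys :: "'b list"
    by (induction ys arbitrary: a) auto
  ultimately show ?thesis by simp
qed

lemma fold_replicate_funpow: "fold (\<lambda>_. f) (replicate n z) a = (f ^^ n) a"
  by (induction n arbitrary: a) (auto simp: funpow_swap1)

text \<open>Iteration is a fold over \<open>n x\<close> dummy bits; this list is at hand because it
  has the same code as the number.\<close>

lemma poly_funpow:
  fixes f :: "'a::tree_codable \<Rightarrow> 'b::tree_codable \<Rightarrow> 'b"
  assumes n: "poly n" and s: "poly s" and f: "poly (\<lambda>p. f (fst p) (snd p))"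
    and add: "\<And>x a. sz (f x a) \<le> sz a + 1 + (sz x + 2) ^ c"
  shows "poly (\<lambda>x. (f x ^^ n x) (s x))"
proof -
  have "poly (\<lambda>x. fold (\<lambda>_. f x) (replicate (n x) False) (s x))"
  proof (rule poly_fold_additive[where c = c])
    show "poly (\<lambda>x. replicate (n x) False)" by (rule poly_replicate_False[OF n])
    show "poly (\<lambda>p. f (fst p) (snd (snd p)))" by (intro poly_comp2[OF f] poly_intros)
    show "sz (f x a) \<le> sz a + 1 + (sz (x, y) + 2) ^ c" for x a and y :: bool
      using add[of x a] power_mono[of "sz x + 2" "sz (x, y) + 2" c] by simp
  qed (rule s)
  then show ?thesis by (simp add: fold_replicate_funpow)
qed

lemma poly_add [poly_intros]:
  assumes "poly m" "poly n" shows "poly (\<lambda>x. m x + n x :: nat)"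
proof -
  have "poly (\<lambda>x. (Suc ^^ m x) (n x))"
    by (rule poly_funpow[where c = 1], (intro poly_intros assms)+) auto
  moreover have "(Suc ^^ a) b = a + b" for a b by (induction a) auto
  ultimately show ?thesis by simp
qed

lemma poly_diff [poly_intros]:
  assumes "poly m" "poly n" shows "poly (\<lambda>x. m x - n x :: nat)"
proof -
  have "poly (\<lambda>x. ((\<lambda>a. a - 1) ^^ n x) (m x))"
    by (rule poly_funpow[where c = 1], (intro poly_pred poly_intros assms)+) auto
  moreover have "((\<lambda>a. a - 1) ^^ b) a = a - b" for a b :: nat by (induction b) auto
  ultimately show ?thesis by simp
qed

lemma poly_mult [poly_intros]:
  assumes "poly m" "poly n" shows "poly (\<lambda>x. m x * n x :: nat)"
proof -
  from poly_size[OF assms(2)] obtain c where c: "\<And>x. sz (n x) \<le> (sz x + 2) ^ c" by blast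
  have "poly (\<lambda>x. ((\<lambda>a. a + n x) ^^ m x) 0)"
  proof (rule poly_funpow[where c = c])
    show "sz (a + n x) \<le> sz a + 1 + (sz x + 2) ^ c" for x a using c[of x] by simp
  qed (intro poly_intros assms poly_comp[OF poly_fst[OF poly_id] assms(2)])+
  moreover have "((\<lambda>a. a + b) ^^ a) 0 = a * b" for a b :: nat by (induction a) auto
  ultimately show ?thesis by simp
qed

lemma poly_power [poly_intros]:
  assumes "poly m" shows "poly (\<lambda>x. m x ^ c :: nat)"
  by (induction c) (auto intro: poly_intros assms)

lemma poly_le [poly_intros]: "poly m \<Longrightarrow> poly n \<Longrightarrow> poly (\<lambda>x. (m x :: nat) \<le> n x)"
  using poly_eq[OF poly_diff poly_const[of 0]] by simp

lemma poly_less [poly_intros]: "poly m \<Longrightarrow> poly n \<Longrightarrow> poly (\<lambda>x. (m x :: nat) < n x)"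
  using poly_le[OF poly_Suc] by (simp add: Suc_le_eq)

lemma poly_upt [poly_intros]:
  assumes "poly n" shows "poly (\<lambda>x. [0..<n x])"
proof -
  from poly_size[OF assms] obtain c where c: "\<And>x. sz (n x) \<le> (sz x + 2) ^ c" by blast
  \<comment> \<open>The next number is the length of the list built so far. The growth per step thus
    depends on the accumulator, so a direct quadratic estimate replaces the additive
    criterion.\<close>
  have eq: "fold (\<lambda>_ a. a @ [length a]) (replicate k False) [] = [0..<k]" for k
    unfolding fold_replicate_funpow by (induction k) auto
  note eq' = eq[unfolded fold_replicate_funpow]
  have sz: "sz [0..<k] \<le> k * (2 * k + 2) + 1" for k
  proof (induction k)
    case (Suc k)
    then show ?case using sz_append[of "[0..<k]" "[k]"] by simp
  qed simp
  have "poly (\<lambda>x. fold (\<lambda>_ a. a @ [length a]) (replicate (n x) False) [])"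
  proof (rule poly_fold)
    show "poly (\<lambda>x. replicate (n x) False)" by (rule poly_replicate_False[OF assms])
    show "sz (fold (\<lambda>_ a. a @ [length a]) (take i (replicate (n x) False)) []) \<le>
        (\<lambda>N. (N + 2) ^ c * (2 * (N + 2) ^ c + 2) + 1) (sz x)" for x i
    proof -
      let ?k = "min i (n x)"
      have "fold (\<lambda>_ a. a @ [length a]) (take i (replicate (n x) False)) [] = [0..<?k]"
        by (simp add: eq eq' fold_replicate_funpow)
      moreover have "?k \<le> (sz x + 2) ^ c" using c[of x] by simp
      then have "?k * (2 * ?k + 2) + 1 \<le> (sz x + 2) ^ c * (2 * (sz x + 2) ^ c + 2) + 1"
        by (intro add_mono mult_le_mono) auto
      ultimately show ?thesis using sz[of ?k] by simp
    qed
  qed (intro polyb_intros poly_intros)+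
  then show ?thesis by (simp add: eq eq' fold_replicate_funpow)
qed

lemma poly_drop [poly_intros]:
  assumes "poly n" "poly l" shows "poly (\<lambda>x. drop (n x) (l x))"
proof -
  have "sz (tl a) \<le> sz a" for a :: "'b list" by (cases a) auto
  then have "poly (\<lambda>x. (tl ^^ n x) (l x))"
    by (intro poly_funpow[where c = 1] poly_intros assms) (simp add: le_SucI trans_le_add1)
  moreover have "(tl ^^ k) a = drop k a" for k and a :: "'b list"
    by (induction k) (auto simp: drop_Suc tl_drop)
  ultimately show ?thesis by simp
qed

lemma poly_take [poly_intros]:
  assumes "poly n" "poly l" shows "poly (\<lambda>x. take (n x) (l x))"
proof -
  have "poly (\<lambda>x. rev (drop (length (l x) - n x) (rev (l x))))" by (intro poly_intros assms)
  moreover have "rev (drop (length a - k) (rev a)) = take k a" for k and a :: "'b list"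
    by (cases "k \<le> length a") (auto simp: drop_rev)
  ultimately show ?thesis by simp
qed

lemma poly_replicate [poly_intros]:
  assumes "poly n" "poly f" shows "poly (\<lambda>x. replicate (n x) (f x))"
proof -
  have "poly (\<lambda>x. map (\<lambda>_. f x) [0..<n x])"
    by (intro poly_intros assms poly_comp[OF poly_fst[OF poly_id] assms(2)])
  then show ?thesis by (simp add: map_replicate_const)
qed

lemma poly_dropWhile [poly_intros]:
  assumes P: "poly (\<lambda>p. P (fst p) (snd p))" and l: "poly l"
  shows "poly (\<lambda>x. dropWhile (P x) (l x))"
proof -
  \<comment> \<open>Iterated as often as the list is long, this conditional tail becomes stationary
    at the first element that violates \<open>P\<close>.\<close>
  let ?f = "\<lambda>x a. if a \<noteq> [] \<and> P x (hd a) then tl a else a"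
  have "sz (?f x a) \<le> sz a" for x a by (cases a) auto
  then have "poly (\<lambda>x. (?f x ^^ length (l x)) (l x))"
    by (intro poly_funpow[where c = 1] poly_intros l poly_comp2[OF P]) (simp add: le_SucI trans_le_add1)
  moreover have "(?f x ^^ n) a = dropWhile (P x) a" if "length a \<le> n" for x n a
    using that
  proof (induction n arbitrary: a)
    case (Suc n)
    show ?case
    proof (cases "a \<noteq> [] \<and> P x (hd a)")
      case True
      then have "(?f x ^^ Suc n) a = (?f x ^^ n) (tl a)" by (simp add: funpow_Suc_right del: funpow.simps)
      with True Suc show ?thesis by (cases a) auto
    next
      case False
      then have "(?f x ^^ Suc n) a = a" by (intro funpow_fixpoint) auto
      with False show ?thesis by (cases a) auto
    qed
  qed auto
  ultimately show ?thesis by simp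
qed

lemma poly_takeWhile [poly_intros]:
  assumes "poly (\<lambda>p. P (fst p) (snd p))" and "poly l"
  shows "poly (\<lambda>x. takeWhile (P x) (l x))"
proof -
  have "poly (\<lambda>x. take (length (l x) - length (dropWhile (P x) (l x))) (l x))"
    by (intro poly_intros assms)
  moreover have "take (length a - length (dropWhile p a)) a = takeWhile p a" for p and a :: "'b list"
    by (metis add_diff_cancel_right' append_eq_conv_conj length_append takeWhile_dropWhile_id)
  ultimately show ?thesis by simp
qed

lemma poly_gate_tag [poly_intros]:
  assumes "poly g" shows "poly (\<lambda>x. gate_tag (g x))"
proof -
  have "poly (\<lambda>x. (gate_tag (g x), gate_args (g x)))"
    using assms unfolding poly_def by (rule pt_cong) (simp add: tc_gate_def)
  from poly_fst[OF this] show ?thesis by simp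
qed

lemma poly_gate_args [poly_intros]:
  assumes "poly g" shows "poly (\<lambda>x. gate_args (g x))"
proof -
  have "poly (\<lambda>x. (gate_tag (g x), gate_args (g x)))"
    using assms unfolding poly_def by (rule pt_cong) (simp add: tc_gate_def)
  from poly_snd[OF this] show ?thesis by simp
qed

text \<open>Defined for every tag because the parser runs on arbitrary words; words that encode no
  circuit are recognised later by \<open>good_circuit\<close>.\<close>

definition mk_gate :: "nat \<Rightarrow> nat list \<Rightarrow> gate" where
  "mk_gate t is = (if t = 0 then InpG else if t = 1 then NotG (hd is) else if t = 2 then AndG is else OrG is)"

lemma poly_mk_gate [poly_intros]:
  assumes "poly t" "poly is" shows "poly (\<lambda>x. mk_gate (t x) (is x))"
proof -
  have "poly (\<lambda>x. if t x = 0 then (0, []) else if t x = 1 then (1, [hd (is x)])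
     else if t x = 2 then (2 :: nat, is x) else (3, is x))"
    by (intro poly_intros assms)
  then show ?thesis unfolding poly_def
    by (rule pt_cong) (auto simp: mk_gate_def tc_gate_def)
qed

lemma poly_word_program:
  assumes "poly h" shows "pt (\<lambda>w. w) (\<lambda>w. w) h"
proof -
  have "pt (lcode bcode) (lcode bcode) h"
    using assms by (simp add: poly_def tc_list_def tc_bool_def)
  from pt_comp[OF pt_comp[OF pt_word_code this] pt_code_word] show ?thesis by simp
qed

section \<open>Circuits of weft at most two\<close>

lemma node_values_snoc:
  "node_values h (C @ [g]) = node_values h C @ [h (length (node_values h C)) (node_values h C) g]"
  by (simp add: node_values_def)

lemma length_node_values [simp]: "length (node_values h C) = length C"
  by (induction C rule: rev_induct) (simp_all add: node_values_snoc, simp add: node_values_def)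

lemma node_values_nth:
  "j < length C \<Longrightarrow> node_values h C ! j = h j (take j (node_values h C)) (C ! j)"
proof (induction C rule: rev_induct)
  case (snoc g C)
  then show ?case by (cases "j = length C") (auto simp: node_values_snoc nth_append)
qed simp

abbreviation cval :: "nat set \<Rightarrow> circuit \<Rightarrow> nat \<Rightarrow> bool" where
  "cval S C j \<equiv> node_values (gate_val S) C ! j"

abbreviation cdep :: "circuit \<Rightarrow> nat \<Rightarrow> nat" where
  "cdep C j \<equiv> node_values gate_depth C ! j"

abbreviation cweft :: "circuit \<Rightarrow> nat \<Rightarrow> nat" where
  "cweft C j \<equiv> node_values gate_weft C ! j"

text \<open>Written with \<open>hd\<close> and \<open>drop\<close>, which are available as
  polynomial-time operations for all arguments.\<close>

definition gate_at :: "circuit \<Rightarrow> nat \<Rightarrow> gate" where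
  "gate_at C j = hd (drop j C)"

lemma gate_at_nth: "j < length C \<Longrightarrow> gate_at C j = C ! j"
  by (simp add: gate_at_def hd_drop_conv_nth)

lemma circuit_wf_args:
  "circuit_wf C \<Longrightarrow> j < length C \<Longrightarrow> i \<in> set (gate_args (C ! j)) \<Longrightarrow> i < j"
  by (auto simp: circuit_wf_def)

lemma cval_simps:
  assumes "circuit_wf C" "j < length C"
  shows "C ! j = InpG \<Longrightarrow> cval S C j \<longleftrightarrow> j \<in> S"
    and "C ! j = NotG i \<Longrightarrow> cval S C j \<longleftrightarrow> \<not> cval S C i"
    and "C ! j = AndG is \<Longrightarrow> cval S C j \<longleftrightarrow> (\<forall>i\<in>set is. cval S C i)"
    and "C ! j = OrG is \<Longrightarrow> cval S C j \<longleftrightarrow> (\<exists>i\<in>set is. cval S C i)"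
  using node_values_nth[OF assms(2), of "gate_val S"] circuit_wf_args[OF assms] by auto

lemma cdep_arg:
  assumes "circuit_wf C" "j < length C" "i \<in> set (gate_args (C ! j))"
  shows "cdep C i < cdep C j"
proof -
  have "cdep C j = gate_depth j (take j (node_values gate_depth C)) (C ! j)"
    by (rule node_values_nth[OF assms(2)])
  moreover have "(!) (take j (node_values gate_depth C)) ` set (gate_args (C ! j)) =
      cdep C ` set (gate_args (C ! j))"
    using circuit_wf_args[OF assms(1,2)] by (intro image_cong) auto
  ultimately have "cdep C j = Suc (Max (cdep C ` set (gate_args (C ! j))))"
    using assms(3) by (auto simp: gate_depth_def)
  moreover have "cdep C i \<le> Max (cdep C ` set (gate_args (C ! j)))"
    using assms(3) by (intro Max_ge) auto
  ultimately show ?thesis by simp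
qed

text \<open>Replaces the maximum by a condition on the arguments, which gives the recursion of
  \<open>depth_le\<close>.\<close>

lemma cdep_le_iff:
  assumes "circuit_wf C" "j < length C"
  shows "cdep C j \<le> d \<longleftrightarrow> (\<forall>i\<in>set (gate_args (C ! j)). cdep C i < d)"
proof -
  have 1: "cdep C j = gate_depth j (take j (node_values gate_depth C)) (C ! j)"
    by (rule node_values_nth[OF assms(2)])
  have 2: "(!) (take j (node_values gate_depth C)) ` set (gate_args (C ! j)) =
      cdep C ` set (gate_args (C ! j))"
    using circuit_wf_args[OF assms(1,2)] by (intro image_cong) auto
  show ?thesis unfolding 1 gate_depth_def 2
    by (cases d) (auto simp: less_Suc_eq_le)
qed

lemma cweft_le_iff:
  assumes "circuit_wf C" "j < length C"
  shows "cweft C j \<le> t \<longleftrightarrow>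
    (if large_gate (C ! j) then 0 < t \<and> (\<forall>i\<in>set (gate_args (C ! j)). cweft C i \<le> t - 1)
     else (\<forall>i\<in>set (gate_args (C ! j)). cweft C i \<le> t))"
proof -
  have 1: "cweft C j = gate_weft j (take j (node_values gate_weft C)) (C ! j)"
    by (rule node_values_nth[OF assms(2)])
  have 2: "(!) (take j (node_values gate_weft C)) ` set (gate_args (C ! j)) =
      cweft C ` set (gate_args (C ! j))"
    using circuit_wf_args[OF assms(1,2)] by (intro image_cong) auto
  have 3: "Max (insert 0 (cweft C ` set (gate_args (C ! j)))) \<le> u \<longleftrightarrow>
      (\<forall>i\<in>set (gate_args (C ! j)). cweft C i \<le> u)" for u by auto
  note 4 = gate_weft_def[of j "take j (node_values gate_weft C)" "C ! j"]
  show ?thesis unfolding 1 4 2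
    using 3[of t] 3[of "t - 1"] by (cases t) auto
qed

text \<open>Depth is tested against a constant \<open>d\<close>, so the recursion unrolls into a
  fixed polynomial-time test, without a table of node values.\<close>

primrec depth_le :: "nat \<Rightarrow> circuit \<Rightarrow> nat \<Rightarrow> bool" where
  "depth_le 0 C j \<longleftrightarrow> gate_args (gate_at C j) = []"
| "depth_le (Suc d) C j \<longleftrightarrow> (\<forall>i\<in>set (gate_args (gate_at C j)). depth_le d C i)"

lemma depth_le_iff:
  "circuit_wf C \<Longrightarrow> j < length C \<Longrightarrow> depth_le d C j \<longleftrightarrow> cdep C j \<le> d"
proof (induction d arbitrary: j)
  case 0
  then show ?case using cdep_le_iff[of C j 0] by (auto simp: gate_at_nth)
next
  case (Suc d)
  then have "depth_le d C i \<longleftrightarrow> cdep C i < Suc d" if "i \<in> set (gate_args (C ! j))" for i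
    using circuit_wf_args[OF Suc.prems that] by (auto simp: less_Suc_eq_le)
  then show ?case using cdep_le_iff[OF Suc.prems, of "Suc d"] Suc.prems by (simp add: gate_at_nth)
qed

text \<open>Fuel 0 answers \<open>True\<close>: it stands for a node of depth 0, which has no
  arguments and hence weft 0. The test is meaningful for nodes of depth at most
  \<open>d\<close>.\<close>

primrec weft_le :: "nat \<Rightarrow> nat \<Rightarrow> circuit \<Rightarrow> nat \<Rightarrow> bool" where
  "weft_le 0 t C j \<longleftrightarrow> True"
| "weft_le (Suc d) t C j \<longleftrightarrow>
     (if 2 < length (gate_args (gate_at C j)) then
        0 < t \<and> (\<forall>i\<in>set (gate_args (gate_at C j)). weft_le d (t - 1) C i)
      else (\<forall>i\<in>set (gate_args (gate_at C j)). weft_le d t C i))"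

lemma weft_le_iff:
  "circuit_wf C \<Longrightarrow> j < length C \<Longrightarrow> cdep C j \<le> d \<Longrightarrow> weft_le d t C j \<longleftrightarrow> cweft C j \<le> t"
proof (induction d arbitrary: j t)
  case 0
  then have "gate_args (C ! j) = []" using cdep_le_iff[of C j 0] by auto
  then show ?case using cweft_le_iff[OF 0(1,2), of t] by (auto simp: large_gate_def)
next
  case (Suc d)
  have "weft_le d u C i \<longleftrightarrow> cweft C i \<le> u" if "i \<in> set (gate_args (C ! j))" for i u
    using circuit_wf_args[OF Suc.prems(1,2) that] cdep_arg[OF Suc.prems(1,2) that] Suc.prems
    by (intro Suc.IH) auto
  then show ?case unfolding cweft_le_iff[OF Suc.prems(1,2)] using Suc.prems
    by (simp add: gate_at_nth large_gate_def)
qed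

text \<open>The distributive law for the at most two arguments of a small gate; \<open>[[]]\<close>
  is the empty product. One application multiplies two sizes, so a constant number of levels remains
  polynomial.\<close>

definition pairprod :: "'a list list list \<Rightarrow> 'a list list" where
  "pairprod Ds = (if Ds = [] then [[]] else if tl Ds = [] then hd Ds
     else concat (map (\<lambda>s. map (\<lambda>t. s @ t) (hd (tl Ds))) (hd Ds)))"

lemma pairprod_disj_conj:
  assumes "length Ds \<le> 2"
  shows "(\<exists>t\<in>set (pairprod Ds). \<forall>l\<in>set t. P l) \<longleftrightarrow> (\<forall>D\<in>set Ds. \<exists>t\<in>set D. \<forall>l\<in>set t. P l)"
proof (cases Ds)
  case (Cons D Es)
  show ?thesis
  proof (cases Es)
    case Nil
    then show ?thesis using Cons by (simp add: pairprod_def)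
  next
    case (Cons E Fs)
    with \<open>Ds = D # Es\<close> assms have "Ds = [D, E]" by simp
    then show ?thesis by (auto simp: pairprod_def ball_Un)
  qed
qed (simp add: pairprod_def)

lemma pairprod_conj_disj:
  assumes "length Ds \<le> 2"
  shows "(\<forall>t\<in>set (pairprod Ds). \<exists>l\<in>set t. P l) \<longleftrightarrow> (\<exists>D\<in>set Ds. \<forall>t\<in>set D. \<exists>l\<in>set t. P l)"
  \<comment> \<open>The dual law, read off after negating \<open>P\<close>.\<close>
  using pairprod_disj_conj[OF assms, of "\<lambda>l. \<not> P l"] by blast

lemma mem_pairprod:
  "t \<in> set (pairprod Ds) \<Longrightarrow> t = [] \<or> (\<exists>D\<in>set Ds. t \<in> set D) \<or>
     (\<exists>D\<in>set Ds. \<exists>E\<in>set Ds. \<exists>u\<in>set D. \<exists>v\<in>set E. t = u @ v)"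
  by (cases Ds; cases "tl Ds") (auto simp: pairprod_def split: if_splits)

section \<open>Normal forms for nodes of weft 0, 1 and 2\<close>

type_synonym lit = "nat \<times> bool"

text \<open>
  For a node of weft at most 0, 1 or 2 the statement ``node \<open>j\<close> has value \<open>b\<close>'' is a disjunction of
  short terms, a conjunction of such disjunctions, or a disjunction of such conjunctions.  A small
  gate of the type that does not match the outermost connective is handled by distributivity; a
  large gate of that type uses the formulas of the level below for its arguments.
\<close>

primrec dnf0 :: "nat \<Rightarrow> circuit \<Rightarrow> nat \<Rightarrow> bool \<Rightarrow> lit list list" where
  "dnf0 0 C j b = []"
| "dnf0 (Suc d) C j b =
    (if gate_tag (gate_at C j) = 0 then [[(j, b)]]
     else if gate_tag (gate_at C j) = 1 then dnf0 d C (hd (gate_args (gate_at C j))) (\<not> b)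
     else if (gate_tag (gate_at C j) = 2) = b
       then pairprod (map (\<lambda>i. dnf0 d C i b) (gate_args (gate_at C j)))
     else concat (map (\<lambda>i. dnf0 d C i b) (gate_args (gate_at C j))))"

primrec cnf1 :: "nat \<Rightarrow> circuit \<Rightarrow> nat \<Rightarrow> bool \<Rightarrow> lit list list list" where
  "cnf1 0 C j b = []"
| "cnf1 (Suc d) C j b =
    (if gate_tag (gate_at C j) = 0 then [[[(j, b)]]]
     else if gate_tag (gate_at C j) = 1 then cnf1 d C (hd (gate_args (gate_at C j))) (\<not> b)
     else if (gate_tag (gate_at C j) = 2) = b
       then concat (map (\<lambda>i. cnf1 d C i b) (gate_args (gate_at C j)))
     else if 2 < length (gate_args (gate_at C j))
       then [concat (map (\<lambda>i. dnf0 d C i b) (gate_args (gate_at C j)))]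
     else pairprod (map (\<lambda>i. cnf1 d C i b) (gate_args (gate_at C j))))"

primrec dnf2 :: "nat \<Rightarrow> circuit \<Rightarrow> nat \<Rightarrow> bool \<Rightarrow> lit list list list list" where
  "dnf2 0 C j b = []"
| "dnf2 (Suc d) C j b =
    (if gate_tag (gate_at C j) = 0 then [[[[(j, b)]]]]
     else if gate_tag (gate_at C j) = 1 then dnf2 d C (hd (gate_args (gate_at C j))) (\<not> b)
     else if (gate_tag (gate_at C j) = 2) = b
       then (if 2 < length (gate_args (gate_at C j))
             then [concat (map (\<lambda>i. cnf1 d C i b) (gate_args (gate_at C j)))]
             else pairprod (map (\<lambda>i. dnf2 d C i b) (gate_args (gate_at C j))))
     else concat (map (\<lambda>i. dnf2 d C i b) (gate_args (gate_at C j))))"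

definition lit_true :: "nat set \<Rightarrow> lit \<Rightarrow> bool" where
  "lit_true S l \<longleftrightarrow> (fst l \<in> S) = snd l"

definition sem0 :: "nat set \<Rightarrow> lit list list \<Rightarrow> bool" where
  "sem0 S D \<longleftrightarrow> (\<exists>t\<in>set D. \<forall>l\<in>set t. lit_true S l)"

definition sem1 :: "nat set \<Rightarrow> lit list list list \<Rightarrow> bool" where
  "sem1 S Ds \<longleftrightarrow> (\<forall>D\<in>set Ds. sem0 S D)"

definition sem2 :: "nat set \<Rightarrow> lit list list list list \<Rightarrow> bool" where
  "sem2 S Cs \<longleftrightarrow> (\<exists>Ds\<in>set Cs. sem1 S Ds)"

lemma sem0_pairprod: "length Ds \<le> 2 \<Longrightarrow> sem0 S (pairprod Ds) \<longleftrightarrow> (\<forall>D\<in>set Ds. sem0 S D)"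
  unfolding sem0_def by (rule pairprod_disj_conj)

lemma sem0_concat: "sem0 S (concat Ds) \<longleftrightarrow> (\<exists>D\<in>set Ds. sem0 S D)"
  unfolding sem0_def by auto

lemma sem1_pairprod: "length Ds \<le> 2 \<Longrightarrow> sem1 S (pairprod Ds) \<longleftrightarrow> (\<exists>D\<in>set Ds. sem1 S D)"
  unfolding sem1_def sem0_def by (rule pairprod_conj_disj)

lemma sem1_concat: "sem1 S (concat Ds) \<longleftrightarrow> (\<forall>D\<in>set Ds. sem1 S D)"
  unfolding sem1_def by auto

lemma sem2_pairprod: "length Ds \<le> 2 \<Longrightarrow> sem2 S (pairprod Ds) \<longleftrightarrow> (\<forall>D\<in>set Ds. sem2 S D)"
  unfolding sem2_def sem1_def by (rule pairprod_disj_conj)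

lemma sem2_concat: "sem2 S (concat Ds) \<longleftrightarrow> (\<exists>D\<in>set Ds. sem2 S D)"
  unfolding sem2_def by auto

lemma sem1_single: "sem1 S [D] \<longleftrightarrow> sem0 S D"
  by (simp add: sem1_def)

lemma sem2_single: "sem2 S [D] \<longleftrightarrow> sem1 S D"
  by (simp add: sem2_def)

lemma gate_cases:
  obtains (inp) "g = InpG" "gate_tag g = 0"
  | (neg) i where "g = NotG i" "gate_tag g = 1" "gate_args g = [i]"
  | (conj) "gate_tag g = 2" "g = AndG (gate_args g)"
  | (disj) "gate_tag g = 3" "g = OrG (gate_args g)"
  by (cases g) auto

text \<open>De Morgan: an and gate with value true and an or gate with value false are both
  conjunctions over the arguments with the same \<open>b\<close>. The test
  \<open>(gate_tag g = 2) = b\<close> in the normal forms thus tells conjunctions from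
  disjunctions.\<close>

lemma cval_conj:
  assumes "circuit_wf C" "j < length C" "2 \<le> gate_tag (C ! j)"
  shows "(gate_tag (C ! j) = 2) = b \<Longrightarrow> cval S C j = b \<longleftrightarrow> (\<forall>i\<in>set (gate_args (C ! j)). cval S C i = b)"
    and "(gate_tag (C ! j) = 2) \<noteq> b \<Longrightarrow> cval S C j = b \<longleftrightarrow> (\<exists>i\<in>set (gate_args (C ! j)). cval S C i = b)"
  using cval_simps[OF assms(1,2), where S = S] assms(3) by (cases "C ! j"; cases b; auto)+

text \<open>\<open>d\<close> is fuel and must exceed the depth strictly, since one unit is spent at
  the input nodes themselves.\<close>

lemma dnf0_correct:
  assumes "circuit_wf C"
  shows "j < length C \<Longrightarrow> cdep C j < d \<Longrightarrow> cweft C j \<le> 0 \<Longrightarrow> sem0 S (dnf0 d C j b) \<longleftrightarrow> cval S C j = b"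
proof (induction d arbitrary: j b)
  case (Suc d)
  note wf = assms Suc.prems(1)
  have small: "\<not> large_gate (C ! j)" and w: "\<And>i. i \<in> set (gate_args (C ! j)) \<Longrightarrow> cweft C i \<le> 0"
    using cweft_le_iff[OF wf, of 0] Suc.prems(3) by (auto split: if_splits)
  have IH: "sem0 S (dnf0 d C i c) \<longleftrightarrow> cval S C i = c" if "i \<in> set (gate_args (C ! j))" for i c
    using that circuit_wf_args[OF wf that] cdep_arg[OF wf that] Suc.prems(1,2) w
    by (intro Suc.IH) auto
  have len: "length (gate_args (C ! j)) \<le> 2" using small by (simp add: large_gate_def)
  show ?case
  proof (cases "C ! j" rule: gate_cases)
    case inp
    then show ?thesis using cval_simps(1)[OF wf] wf by (auto simp: gate_at_nth sem0_def lit_true_def)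
  next
    case (neg i)
    then show ?thesis using cval_simps(2)[OF wf neg(1)] IH[of i "\<not> b"] wf by (auto simp: gate_at_nth)
  next
    case conj
    then show ?thesis using cval_conj[OF wf, where b = b and S = S] IH[where c = b] len wf
      by (cases b) (simp_all add: gate_at_nth sem0_pairprod sem0_concat)
  next
    case disj
    then show ?thesis using cval_conj[OF wf, where b = b and S = S] IH[where c = b] len wf
      by (cases b) (simp_all add: gate_at_nth sem0_pairprod sem0_concat)
  qed
qed simp

lemma cnf1_correct:
  assumes "circuit_wf C"
  shows "j < length C \<Longrightarrow> cdep C j < d \<Longrightarrow> cweft C j \<le> 1 \<Longrightarrow> sem1 S (cnf1 d C j b) \<longleftrightarrow> cval S C j = b"
proof (induction d arbitrary: j b)
  case (Suc d)
  note wf = assms Suc.prems(1)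
  have w: "cweft C i \<le> 1" "large_gate (C ! j) \<Longrightarrow> cweft C i \<le> 0" if "i \<in> set (gate_args (C ! j))" for i
    using that cweft_le_iff[OF wf, of 1] Suc.prems(3) by (auto split: if_splits)
  have IH: "sem1 S (cnf1 d C i c) \<longleftrightarrow> cval S C i = c" if "i \<in> set (gate_args (C ! j))" for i c
    using that circuit_wf_args[OF wf that] cdep_arg[OF wf that] Suc.prems(1,2) w
    by (intro Suc.IH) auto
  have IH0: "sem0 S (dnf0 d C i c) \<longleftrightarrow> cval S C i = c"
    if "i \<in> set (gate_args (C ! j))" "2 < length (gate_args (C ! j))" for i c
    using that circuit_wf_args[OF wf that(1)] cdep_arg[OF wf that(1)] Suc.prems(1,2) w
    by (intro dnf0_correct[OF assms]) (auto simp: large_gate_def)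
  show ?case
  proof (cases "C ! j" rule: gate_cases)
    case inp
    then show ?thesis using cval_simps(1)[OF wf] wf
      by (auto simp: gate_at_nth sem1_def sem0_def lit_true_def)
  next
    case (neg i)
    then show ?thesis using cval_simps(2)[OF wf neg(1)] IH[of i "\<not> b"] wf by (auto simp: gate_at_nth)
  next
    case conj
    then show ?thesis using cval_conj[OF wf, where b = b and S = S] IH[where c = b] IH0[where c = b] wf
      by (cases b; cases "2 < length (gate_args (C ! j))")
        (simp_all add: gate_at_nth sem1_pairprod sem1_concat sem1_single sem0_concat)
  next
    case disj
    then show ?thesis using cval_conj[OF wf, where b = b and S = S] IH[where c = b] IH0[where c = b] wf
      by (cases b; cases "2 < length (gate_args (C ! j))")
        (simp_all add: gate_at_nth sem1_pairprod sem1_concat sem1_single sem0_concat)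
  qed
qed simp

lemma dnf2_correct:
  assumes "circuit_wf C"
  shows "j < length C \<Longrightarrow> cdep C j < d \<Longrightarrow> cweft C j \<le> 2 \<Longrightarrow> sem2 S (dnf2 d C j b) \<longleftrightarrow> cval S C j = b"
proof (induction d arbitrary: j b)
  case (Suc d)
  note wf = assms Suc.prems(1)
  have w: "cweft C i \<le> 2" "large_gate (C ! j) \<Longrightarrow> cweft C i \<le> 1" if "i \<in> set (gate_args (C ! j))" for i
    using that cweft_le_iff[OF wf, of 2] Suc.prems(3) by (auto split: if_splits)
  have IH: "sem2 S (dnf2 d C i c) \<longleftrightarrow> cval S C i = c" if "i \<in> set (gate_args (C ! j))" for i c
    using that circuit_wf_args[OF wf that] cdep_arg[OF wf that] Suc.prems(1,2) w
    by (intro Suc.IH) auto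
  have IH1: "sem1 S (cnf1 d C i c) \<longleftrightarrow> cval S C i = c"
    if "i \<in> set (gate_args (C ! j))" "2 < length (gate_args (C ! j))" for i c
    using that circuit_wf_args[OF wf that(1)] cdep_arg[OF wf that(1)] Suc.prems(1,2) w
    by (intro cnf1_correct[OF assms]) (auto simp: large_gate_def)
  show ?case
  proof (cases "C ! j" rule: gate_cases)
    case inp
    then show ?thesis using cval_simps(1)[OF wf] wf
      by (auto simp: gate_at_nth sem2_def sem1_def sem0_def lit_true_def)
  next
    case (neg i)
    then show ?thesis using cval_simps(2)[OF wf neg(1)] IH[of i "\<not> b"] wf by (auto simp: gate_at_nth)
  next
    case conj
    then show ?thesis using cval_conj[OF wf, where b = b and S = S] IH[where c = b] IH1[where c = b] wf
      by (cases b; cases "2 < length (gate_args (C ! j))")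
        (simp_all add: gate_at_nth sem2_pairprod sem2_concat sem2_single sem1_concat)
  next
    case disj
    then show ?thesis using cval_conj[OF wf, where b = b and S = S] IH[where c = b] IH1[where c = b] wf
      by (cases b; cases "2 < length (gate_args (C ! j))")
        (simp_all add: gate_at_nth sem2_pairprod sem2_concat sem2_single sem1_concat)
  qed
qed simp

section \<open>The width of the terms\<close>

definition short_term :: "nat \<Rightarrow> nat \<Rightarrow> lit list \<Rightarrow> bool" where
  "short_term q N t \<longleftrightarrow> length t \<le> q \<and> (\<forall>l\<in>set t. fst l < N)"

lemma short_term_mono: "short_term (2 ^ d) N t \<Longrightarrow> short_term (2 ^ Suc d) N t"
  by (simp add: short_term_def)

text \<open>Only products lengthen terms, and each joins two terms of the level below, so a level at
  most doubles the length.\<close>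

lemma short_term_dnf0:
  assumes "circuit_wf C"
  shows "j < length C \<Longrightarrow> t \<in> set (dnf0 d C j b) \<Longrightarrow> short_term (2 ^ d) (length C) t"
proof (induction d arbitrary: j b t)
  case (Suc d)
  have IH: "short_term (2 ^ d) (length C) t" if "i \<in> set (gate_args (C ! j))" "t \<in> set (dnf0 d C i c)" for i c t
    using Suc.IH[of i t c] circuit_wf_args[OF assms Suc.prems(1) that(1)] Suc.prems(1) that(2) by auto
  have pair: "short_term (2 ^ Suc d) (length C) t"
    if "t \<in> set (pairprod (map (\<lambda>i. dnf0 d C i b) (gate_args (C ! j))))"
    using mem_pairprod[OF that]
  proof (elim disjE bexE)
    fix D E u v
    assume "D \<in> set (map (\<lambda>i. dnf0 d C i b) (gate_args (C ! j)))" "u \<in> set D"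
      "E \<in> set (map (\<lambda>i. dnf0 d C i b) (gate_args (C ! j)))" "v \<in> set E" and t: "t = u @ v"
    then have "short_term (2 ^ d) (length C) u" "short_term (2 ^ d) (length C) v" using IH by auto
    then show ?thesis unfolding t by (auto simp: short_term_def)
  next
    fix D assume "D \<in> set (map (\<lambda>i. dnf0 d C i b) (gate_args (C ! j)))" "t \<in> set D"
    then show ?thesis using IH by (intro short_term_mono) auto
  qed (simp add: short_term_def)
  have conc: "short_term (2 ^ Suc d) (length C) t"
    if "t \<in> set (concat (map (\<lambda>i. dnf0 d C i b) (gate_args (C ! j))))"
    using that IH by (intro short_term_mono) auto
  show ?case
  proof (cases "C ! j" rule: gate_cases)
    case inp
    then show ?thesis using Suc.prems by (auto simp: gate_at_nth short_term_def)
  next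
    case (neg i)
    then show ?thesis using Suc.prems IH[of i t] by (auto simp: gate_at_nth intro!: short_term_mono simp del: power_Suc)
  next
    case conj
    with Suc.prems pair conc show ?thesis
      by (simp add: gate_at_nth del: power_Suc set_concat split: if_splits)
  next
    case disj
    with Suc.prems pair conc show ?thesis
      by (simp add: gate_at_nth del: power_Suc set_concat split: if_splits)
  qed
qed simp

lemma short_term_cnf1:
  assumes "circuit_wf C"
  shows "j < length C \<Longrightarrow> D \<in> set (cnf1 d C j b) \<Longrightarrow> t \<in> set D \<Longrightarrow> short_term (2 ^ d) (length C) t"
proof (induction d arbitrary: j b D t)
  case (Suc d)
  have IH: "short_term (2 ^ Suc d) (length C) t"
    if "i \<in> set (gate_args (C ! j))" "D \<in> set (cnf1 d C i c)" "t \<in> set D" for i c D t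
    using Suc.IH[of i D c t] circuit_wf_args[OF assms Suc.prems(1) that(1)] Suc.prems(1) that(2,3)
    by (auto intro!: short_term_mono simp del: power_Suc)
  have IH0: "short_term (2 ^ Suc d) (length C) t"
    if "i \<in> set (gate_args (C ! j))" "t \<in> set (dnf0 d C i c)" for i c t
    using short_term_dnf0[OF assms, of i t d c] circuit_wf_args[OF assms Suc.prems(1) that(1)] Suc.prems(1) that(2)
    by (auto intro!: short_term_mono simp del: power_Suc)
  show ?case
  proof (cases "C ! j" rule: gate_cases)
    case inp
    then show ?thesis using Suc.prems by (auto simp: gate_at_nth short_term_def)
  next
    case (neg i)
    then show ?thesis using Suc.prems IH[of i D] by (auto simp: gate_at_nth simp del: power_Suc)
  next
    case conj
    then show ?thesis using Suc.prems IH IH0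
      by (auto simp: gate_at_nth simp del: power_Suc dest!: mem_pairprod split: if_splits)
  next
    case disj
    then show ?thesis using Suc.prems IH IH0
      by (auto simp: gate_at_nth simp del: power_Suc dest!: mem_pairprod split: if_splits)
  qed
qed simp

lemma short_term_dnf2:
  assumes "circuit_wf C"
  shows "j < length C \<Longrightarrow> Ds \<in> set (dnf2 d C j b) \<Longrightarrow> D \<in> set Ds \<Longrightarrow> t \<in> set D \<Longrightarrow>
    short_term (2 ^ d) (length C) t"
proof (induction d arbitrary: j b Ds D t)
  case (Suc d)
  have IH: "short_term (2 ^ Suc d) (length C) t"
    if "i \<in> set (gate_args (C ! j))" "Ds \<in> set (dnf2 d C i c)" "D \<in> set Ds" "t \<in> set D" for i c Ds D t
    using Suc.IH[of i Ds c D t] circuit_wf_args[OF assms Suc.prems(1) that(1)] Suc.prems(1) that(2-4)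
    by (auto intro!: short_term_mono simp del: power_Suc)
  have IH1: "short_term (2 ^ Suc d) (length C) t"
    if "i \<in> set (gate_args (C ! j))" "D \<in> set (cnf1 d C i c)" "t \<in> set D" for i c D t
    using short_term_cnf1[OF assms, of i D d c t] circuit_wf_args[OF assms Suc.prems(1) that(1)] Suc.prems(1) that(2,3)
    by (auto intro!: short_term_mono simp del: power_Suc)
  show ?case
  proof (cases "C ! j" rule: gate_cases)
    case inp
    then show ?thesis using Suc.prems by (auto simp: gate_at_nth short_term_def)
  next
    case (neg i)
    then show ?thesis using Suc.prems IH[of i Ds] by (auto simp: gate_at_nth simp del: power_Suc)
  next
    case conj
    then show ?thesis using Suc.prems IH IH1
      by (auto simp: gate_at_nth simp del: power_Suc dest!: mem_pairprod split: if_splits)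
  next
    case disj
    then show ?thesis using Suc.prems IH IH1
      by (auto simp: gate_at_nth simp del: power_Suc dest!: mem_pairprod split: if_splits)
  qed
qed simp

section \<open>Selecting one edge from every star\<close>

definition key_index :: "'k list \<Rightarrow> 'k \<Rightarrow> nat" where
  "key_index ks \<kappa> = length (takeWhile (\<lambda>y. y \<noteq> \<kappa>) ks)"

definition numbered :: "'i list \<Rightarrow> (nat \<times> 'i) list" where
  "numbered its = map (\<lambda>e. (e, hd (drop e its))) [0..<length its]"

definition star_edge :: "'k list \<Rightarrow> nat \<times> 'k \<times> 'p \<Rightarrow> nat \<times> nat" where
  "star_edge ks x = (key_index ks (fst (snd x)), length ks + fst x)"

text \<open>
  The vertices are the keys (the centres of the stars) and the items (the leaves); a negative sample
  consists of the edges that do not satisfy a predicate \<open>h\<close>, so that a selection that is a matching in the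
  full graph is consistent with the sample iff it contains an edge satisfying \<open>h\<close>.
\<close>

definition star_sample :: "'k list \<Rightarrow> ('k \<times> 'p) list \<Rightarrow> ('k \<times> 'p \<Rightarrow> bool) \<Rightarrow> edge_list" where
  "star_sample ks its h = map (star_edge ks) (filter (\<lambda>x. \<not> h (snd x)) (numbered its))"

text \<open>The predicate that is always false removes no edge, so the positive sample is the union
  of all stars.\<close>

definition star_samples :: "'k list \<Rightarrow> ('k \<times> 'p) list \<Rightarrow> ('k \<times> 'p \<Rightarrow> bool) list \<Rightarrow> sample_list" where
  "star_samples ks its hs =
     (star_sample ks its (\<lambda>_. False), True) # map (\<lambda>h. (star_sample ks its h, False)) hs"

lemma key_index:
  assumes "\<kappa> \<in> set ks"
  shows "key_index ks \<kappa> < length ks" "ks ! key_index ks \<kappa> = \<kappa>"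
proof -
  show 1: "key_index ks \<kappa> < length ks"
    unfolding key_index_def using assms by (induction ks) auto
  then show "ks ! key_index ks \<kappa> = \<kappa>"
    unfolding key_index_def using nth_length_takeWhile[of "\<lambda>y. y \<noteq> \<kappa>" ks] by simp
qed

locale stars =
  fixes ks :: "'k list" and its :: "('k \<times> 'p) list"
  assumes dist: "distinct ks" and keys: "\<And>it. it \<in> set its \<Longrightarrow> fst it \<in> set ks"
begin

definition ctr :: "nat \<Rightarrow> nat" where
  "ctr e = key_index ks (fst (its ! e))"

definition edge :: "nat \<Rightarrow> nat set" where
  "edge e = {ctr e, length ks + e}"

lemma ctr_less: "e < length its \<Longrightarrow> ctr e < length ks"
  unfolding ctr_def by (intro key_index(1) keys) simp

lemma ctr_key: "e < length its \<Longrightarrow> ks ! ctr e = fst (its ! e)"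
  unfolding ctr_def by (intro key_index(2) keys) simp

lemma edge_inj: "e < length its \<Longrightarrow> e' < length its \<Longrightarrow> edge e = edge e' \<Longrightarrow> e = e'"
  using ctr_less[of e] ctr_less[of e'] by (auto simp: edge_def doubleton_eq_iff)

lemma disjnt_edge:
  "e < length its \<Longrightarrow> e' < length its \<Longrightarrow> disjnt (edge e) (edge e') \<longleftrightarrow> ctr e \<noteq> ctr e' \<and> e \<noteq> e'"
  using ctr_less[of e] ctr_less[of e'] by (auto simp: edge_def disjnt_def)

lemma edge_set_sample: "edge_set (star_sample ks its h) = edge ` {e. e < length its \<and> \<not> h (its ! e)}"
proof -
  have "set (star_sample ks its h) =
      (\<lambda>e. (ctr e, length ks + e)) ` {e. e < length its \<and> \<not> h (its ! e)}"
    by (auto simp: star_sample_def numbered_def star_edge_def ctr_def hd_drop_conv_nth image_iff)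
  then show ?thesis by (auto simp: edge_set_def edge_def image_iff)
qed

lemma edge_pairs: "e < length its \<Longrightarrow> edge e \<in> vertex_pairs {..<length ks + length its}"
  using ctr_less[of e] by (auto simp: edge_def vertex_pairs_def card_insert_if)

lemma valid_star_samples: "valid_samples (length ks + length its) (star_samples ks its hs)"
  unfolding valid_samples_def star_samples_def using edge_pairs by (auto simp: edge_set_sample)

text \<open>The positive sample already makes \<open>F\<close> pairwise disjoint, so
  \<open>F\<close> can fail to be a matching in a negative sample only by using one of its missing
  edges, which are those that satisfy \<open>h\<close>.\<close>

lemma solution_iff:
  "conscheck_matching_solution {..<length ks + length its}
     (map (\<lambda>(es, l). (edge_set es, l)) (star_samples ks its hs)) (length ks) F \<longleftrightarrow>
   F \<subseteq> edge ` {..<length its} \<and> card F = length ks \<and> pairwise disjnt F \<and>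
   (\<forall>h\<in>set hs. \<exists>e<length its. edge e \<in> F \<and> h (its ! e))"
proof -
  have *: "\<not> F \<subseteq> edge ` {e. e < length its \<and> \<not> h (its ! e)} \<longleftrightarrow>
      (\<exists>e<length its. edge e \<in> F \<and> h (its ! e))" if F: "F \<subseteq> edge ` {..<length its}" for h
  proof
    assume "\<not> F \<subseteq> edge ` {e. e < length its \<and> \<not> h (its ! e)}"
    then obtain f where "f \<in> F" "f \<notin> edge ` {e. e < length its \<and> \<not> h (its ! e)}" by blast
    with F show "\<exists>e<length its. edge e \<in> F \<and> h (its ! e)" by auto
  next
    assume "\<exists>e<length its. edge e \<in> F \<and> h (its ! e)"
    then obtain e where e: "e < length its" "edge e \<in> F" "h (its ! e)" by blast
    then have "edge e \<notin> edge ` {e. e < length its \<and> \<not> h (its ! e)}" using edge_inj by auto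
    with e show "\<not> F \<subseteq> edge ` {e. e < length its \<and> \<not> h (its ! e)}" by blast
  qed
  have lt: "{e. e < length its \<and> \<not> False} = {..<length its}" by auto
  have vp: "F \<subseteq> vertex_pairs {..<length ks + length its}" if "F \<subseteq> edge ` {..<length its}"
    using that edge_pairs by auto
  have "(\<forall>(E, l)\<in>set (map (\<lambda>(es, l). (edge_set es, l)) (star_samples ks its hs)). forms_matching E F \<longleftrightarrow> l) \<longleftrightarrow>
      (F \<subseteq> edge ` {..<length its} \<and> pairwise disjnt F) \<and>
      (\<forall>h\<in>set hs. \<not> (F \<subseteq> edge ` {e. e < length its \<and> \<not> h (its ! e)} \<and> pairwise disjnt F))"
    by (simp add: star_samples_def edge_set_sample forms_matching_def lt[simplified])
  also have "\<dots> \<longleftrightarrow> F \<subseteq> edge ` {..<length its} \<and> pairwise disjnt F \<and>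
      (\<forall>h\<in>set hs. \<exists>e<length its. edge e \<in> F \<and> h (its ! e))"
    using * by (cases "F \<subseteq> edge ` {..<length its}"; cases "pairwise disjnt F") simp_all
  finally show ?thesis unfolding conscheck_matching_solution_def using vp by blast
qed

text \<open>Distinct edges meet only in a common centre, so a matching with as many edges as stars
  uses each centre once and is a choice function \<open>\<sigma>\<close> on the keys.\<close>

theorem star_solution:
  "(\<exists>F. conscheck_matching_solution {..<length ks + length its}
      (map (\<lambda>(es, l). (edge_set es, l)) (star_samples ks its hs)) (length ks) F) \<longleftrightarrow>
   (\<exists>\<sigma>. (\<forall>\<kappa>\<in>set ks. (\<kappa>, \<sigma> \<kappa>) \<in> set its) \<and> (\<forall>h\<in>set hs. \<exists>\<kappa>\<in>set ks. h (\<kappa>, \<sigma> \<kappa>)))"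
  unfolding solution_iff
proof
  assume "\<exists>F\<subseteq>edge ` {..<length its}. card F = length ks \<and> pairwise disjnt F \<and>
   (\<forall>h\<in>set hs. \<exists>e<length its. edge e \<in> F \<and> h (its ! e))"
  then obtain F where F: "F \<subseteq> edge ` {..<length its}" "card F = length ks" "pairwise disjnt F"
    "\<And>h. h \<in> set hs \<Longrightarrow> \<exists>e<length its. edge e \<in> F \<and> h (its ! e)" by blast
  define X where "X = {e. e < length its \<and> edge e \<in> F}"
  have X: "finite X" "X \<subseteq> {..<length its}" by (auto simp: X_def)
  have "F = edge ` X" using F(1) by (auto simp: X_def)
  moreover have "inj_on edge X" using edge_inj X(2) by (intro inj_onI) auto
  ultimately have cX: "card X = length ks" using F(2) card_image by metis
  have inj: "inj_on ctr X"
  proof (rule inj_onI, rule ccontr)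
    fix e e' assume e: "e \<in> X" "e' \<in> X" "ctr e = ctr e'" "e \<noteq> e'"
    then have "edge e \<noteq> edge e'" using edge_inj by (auto simp: X_def)
    then have "disjnt (edge e) (edge e')" using F(3) e by (auto simp: X_def pairwise_def)
    then show False using disjnt_edge e by (auto simp: X_def)
  qed
  \<comment> \<open>An injective map from \<open>length ks\<close> edges to \<open>length ks\<close>
    centres hits every centre.\<close>
  have "ctr ` X = {..<length ks}"
    using ctr_less X card_image[OF inj] cX by (intro card_subset_eq) (auto simp: X_def)
  then have ex: "\<exists>e\<in>X. fst (its ! e) = \<kappa>" if "\<kappa> \<in> set ks" for \<kappa>
  proof -
    from that obtain i where i: "i < length ks" "\<kappa> = ks ! i" by (auto simp: in_set_conv_nth)
    then obtain e where "e \<in> X" "ctr e = i" using \<open>ctr ` X = {..<length ks}\<close> by (metis image_iff lessThan_iff)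
    then show ?thesis using ctr_key[of e] i by (auto simp: X_def)
  qed
  have uniq: "e = e'" if "e \<in> X" "e' \<in> X" "fst (its ! e) = fst (its ! e')" for e e'
    using inj_onD[OF inj, of e e'] that by (simp add: ctr_def)
  define \<sigma> where "\<sigma> \<kappa> = snd (its ! (SOME e. e \<in> X \<and> fst (its ! e) = \<kappa>))" for \<kappa>
  have \<sigma>: "its ! e = (fst (its ! e), \<sigma> (fst (its ! e)))" if "e \<in> X" for e
  proof -
    let ?e = "SOME e'. e' \<in> X \<and> fst (its ! e') = fst (its ! e)"
    have "?e \<in> X \<and> fst (its ! ?e) = fst (its ! e)" by (rule someI[of _ e]) (simp add: that)
    then have "?e = e" using uniq that by blast
    then show ?thesis by (simp add: \<sigma>_def)
  qed
  show "\<exists>\<sigma>. (\<forall>\<kappa>\<in>set ks. (\<kappa>, \<sigma> \<kappa>) \<in> set its) \<and> (\<forall>h\<in>set hs. \<exists>\<kappa>\<in>set ks. h (\<kappa>, \<sigma> \<kappa>))"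
  proof (intro exI conjI ballI)
    fix \<kappa> assume "\<kappa> \<in> set ks"
    from ex[OF this] obtain e where e: "e \<in> X" "fst (its ! e) = \<kappa>" by blast
    then have "(\<kappa>, \<sigma> \<kappa>) = its ! e" "e < length its" using \<sigma>[OF e(1)] X(2) by auto
    then show "(\<kappa>, \<sigma> \<kappa>) \<in> set its" by simp
  next
    fix h assume "h \<in> set hs"
    from F(4)[OF this] obtain e where e: "e \<in> X" "h (its ! e)" by (auto simp: X_def)
    then have "h (fst (its ! e), \<sigma> (fst (its ! e)))" using \<sigma>[OF e(1)] by simp
    moreover have "fst (its ! e) \<in> set ks" using e X(2) by (intro keys nth_mem) auto
    ultimately show "\<exists>\<kappa>\<in>set ks. h (\<kappa>, \<sigma> \<kappa>)" by blast
  qed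
next
  assume "\<exists>\<sigma>. (\<forall>\<kappa>\<in>set ks. (\<kappa>, \<sigma> \<kappa>) \<in> set its) \<and> (\<forall>h\<in>set hs. \<exists>\<kappa>\<in>set ks. h (\<kappa>, \<sigma> \<kappa>))"
  then obtain \<sigma> where \<sigma>: "\<And>\<kappa>. \<kappa> \<in> set ks \<Longrightarrow> (\<kappa>, \<sigma> \<kappa>) \<in> set its"
    "\<And>h. h \<in> set hs \<Longrightarrow> \<exists>\<kappa>\<in>set ks. h (\<kappa>, \<sigma> \<kappa>)" by blast
  have "\<forall>\<kappa>\<in>set ks. \<exists>e<length its. its ! e = (\<kappa>, \<sigma> \<kappa>)" using \<sigma>(1) by (auto simp: in_set_conv_nth)
  then obtain ix where ix: "\<And>\<kappa>. \<kappa> \<in> set ks \<Longrightarrow> ix \<kappa> < length its \<and> its ! ix \<kappa> = (\<kappa>, \<sigma> \<kappa>)" by metis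
  let ?F = "(\<lambda>\<kappa>. edge (ix \<kappa>)) ` set ks"
  have inj: "inj_on (\<lambda>\<kappa>. edge (ix \<kappa>)) (set ks)"
    using ix edge_inj by (intro inj_onI) (metis fst_conv)
  show "\<exists>F\<subseteq>edge ` {..<length its}. card F = length ks \<and> pairwise disjnt F \<and>
   (\<forall>h\<in>set hs. \<exists>e<length its. edge e \<in> F \<and> h (its ! e))"
  proof (intro exI[of _ ?F] conjI ballI)
    show "?F \<subseteq> edge ` {..<length its}" using ix by auto
    show "card ?F = length ks" using card_image[OF inj] distinct_card[OF dist] by simp
    show "pairwise disjnt ?F"
    proof (rule pairwiseI)
      fix f f' assume "f \<in> ?F" "f' \<in> ?F" "f \<noteq> f'"
      then obtain \<kappa> \<kappa>' where k: "\<kappa> \<in> set ks" "\<kappa>' \<in> set ks" "f = edge (ix \<kappa>)" "f' = edge (ix \<kappa>')" "\<kappa> \<noteq> \<kappa>'"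
        by auto
      have "ctr (ix \<kappa>) \<noteq> ctr (ix \<kappa>')" "ix \<kappa> \<noteq> ix \<kappa>'"
        using ctr_key[of "ix \<kappa>"] ctr_key[of "ix \<kappa>'"] ix[OF k(1)] ix[OF k(2)] k(5) by auto
      then show "disjnt f f'" using disjnt_edge ix k by simp
    qed
    fix h assume "h \<in> set hs"
    from \<sigma>(2)[OF this] obtain \<kappa> where k: "\<kappa> \<in> set ks" "h (\<kappa>, \<sigma> \<kappa>)" by blast
    then show "\<exists>e<length its. edge e \<in> ?F \<and> h (its ! e)"
      using ix[OF k(1)] by (intro exI[of _ "ix \<kappa>"]) auto
  qed
qed

end

section \<open>Tuples\<close>

definition slots :: "nat \<Rightarrow> nat list" where
  "slots n = [0..<n]"

lemma slots_simps [simp]: "set (slots n) = {..<n}" "distinct (slots n)" "length (slots n) = n"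
  by (auto simp: slots_def)

primrec tuples :: "nat \<Rightarrow> 'a list \<Rightarrow> 'a list list" where
  "tuples 0 xs = [[]]"
| "tuples (Suc n) xs = concat (map (\<lambda>x. map (\<lambda>t. x # t) (tuples n xs)) xs)"

lemma set_tuples: "set (tuples n xs) = {t. length t = n \<and> set t \<subseteq> set xs}"
proof (induction n)
  case (Suc n)
  have "set (tuples (Suc n) xs) = (\<Union>x\<in>set xs. (#) x ` {t. length t = n \<and> set t \<subseteq> set xs})"
    by (simp add: Suc)
  also have "\<dots> = {t. length t = Suc n \<and> set t \<subseteq> set xs}"
    by (auto simp: length_Suc_conv)
  finally show ?case .
qed auto

lemma length_tuples: "length (tuples n xs) = length xs ^ n"
  by (induction n) (auto simp: length_concat comp_def sum_list_triv)

lemma distinct_tuples: "distinct xs \<Longrightarrow> distinct (tuples n xs)"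
proof (induction n)
  case (Suc n)
  then have d: "distinct (tuples n xs)" by simp
  have "distinct (concat (map (\<lambda>x. map (\<lambda>t. x # t) (tuples n xs)) ys))" if "distinct ys" for ys
    using that by (induction ys) (auto simp: distinct_map d)
  then show ?case using Suc.prems by simp
qed simp

section \<open>Hitting sets for formulas with a weighted assignment\<close>

text \<open>
  An assignment \<open>{v\<^sub>1 < \<dots> < v\<^sub>k}\<close> is given by \<open>p 0 = 0\<close>, \<open>p i = v\<^sub>i + 1\<close> and, for
  \<open>i > k\<close>, \<open>p i = N + i - k\<close>.  A variable \<open>v\<close> lies in exactly one interval \<open>p i \<le> v + 1 < p (i + 1)\<close>,
  and it is true iff \<open>v + 1 = p i\<close>: both polarities of a literal are decided by two consecutive values.
  There are \<open>m + 2\<close> values in order to make the number of stars depend on \<open>m\<close> only.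
\<close>

definition pair_ok :: "circuit \<Rightarrow> nat \<Rightarrow> nat \<times> nat \<Rightarrow> bool" where
  "pair_ok C k x \<longleftrightarrow> (if fst x = 0 then snd x = 0
     else if fst x \<le> k then 0 < snd x \<and> snd x \<le> length C \<and> gate_tag (gate_at C (snd x - 1)) = 0
     else snd x + k = length C + fst x)"

text \<open>Only conditions visible inside one tuple. Monotonicity of the whole sequence follows
  because every two consecutive positions occur together in some tuple.\<close>

definition valid_payload :: "circuit \<Rightarrow> nat \<Rightarrow> (nat \<times> nat) list \<Rightarrow> bool" where
  "valid_payload C k p \<longleftrightarrow> (\<forall>x\<in>set p. pair_ok C k x \<and>
     (\<forall>y\<in>set p. (fst x = fst y \<longrightarrow> snd x = snd y) \<and> (fst y = Suc (fst x) \<longrightarrow> snd x < snd y)))"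

text \<open>The largest value that has to be available is
  \<open>p (m + 1) = N + m + 1 - k\<close>.\<close>

definition sel_pairs :: "nat \<Rightarrow> nat \<Rightarrow> (nat \<times> nat) list" where
  "sel_pairs N m = concat (map (\<lambda>j. map (\<lambda>w. (j, w)) (slots (Suc (Suc (N + m))))) (slots (Suc (Suc m))))"

definition sel_keys :: "nat \<Rightarrow> nat \<Rightarrow> nat list list" where
  "sel_keys Q m = [] # tuples Q (slots (Suc (Suc m)))"

text \<open>The star with centre \<open>[]\<close> selects a disjunct of the outermost disjunction.\<close>

definition sel_items ::
  "nat \<Rightarrow> circuit \<Rightarrow> nat \<Rightarrow> nat \<Rightarrow> lit list list list list \<Rightarrow> (nat list \<times> (nat \<times> nat) list) list" where
  "sel_items Q C k m \<Phi> = map (\<lambda>g. ([], [(g, 0)])) [0..<length \<Phi>] @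
     map (\<lambda>p. (map fst p, p)) (filter (valid_payload C k) (tuples Q (sel_pairs (length C) m)))"

text \<open>For \<open>c = (\<tau>, (j, w))\<close>: if the edge at \<open>\<tau>\<close> gives
  position \<open>j\<close> the value \<open>w\<close>, then so must the edge at the constant tuple
  of \<open>j\<close>. In this way all stars agree with the diagonal ones.\<close>

definition hit_consistent :: "nat \<Rightarrow> nat list \<times> nat \<times> nat \<Rightarrow> nat list \<times> (nat \<times> nat) list \<Rightarrow> bool" where
  "hit_consistent Q c it \<longleftrightarrow> (fst it = fst c \<and> snd c \<notin> set (snd it)) \<or>
     (fst it = replicate Q (fst (snd c)) \<and> snd c \<in> set (snd it))"

text \<open>A certificate inside a single edge: two consecutive positions enclose the variable, so
  its truth is decided by whether it is the lower value.\<close>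

definition forces :: "(nat \<times> nat) list \<Rightarrow> lit \<Rightarrow> bool" where
  "forces p l \<longleftrightarrow> (\<exists>x\<in>set p. \<exists>y\<in>set p. fst y = Suc (fst x) \<and> snd x \<le> Suc (fst l) \<and>
     Suc (fst l) < snd y \<and> (Suc (fst l) = snd x) = snd l)"

definition hit_clause :: "nat \<times> lit list list \<Rightarrow> nat list \<times> (nat \<times> nat) list \<Rightarrow> bool" where
  "hit_clause c it \<longleftrightarrow> (fst it = [] \<and> snd it \<noteq> [(fst c, 0)]) \<or>
     (fst it \<noteq> [] \<and> (\<exists>t\<in>set (snd c). \<forall>l\<in>set t. forces (snd it) l))"

definition consistency_list :: "nat \<Rightarrow> nat \<Rightarrow> nat \<Rightarrow> (nat list \<times> nat \<times> nat) list" where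
  "consistency_list Q N m =
     concat (map (\<lambda>\<tau>. map (\<lambda>x. (\<tau>, x)) (sel_pairs N m)) (tuples Q (slots (Suc (Suc m)))))"

definition clause_list :: "lit list list list list \<Rightarrow> (nat \<times> lit list list) list" where
  "clause_list \<Phi> = concat (map (\<lambda>g. map (\<lambda>D. (g, D)) (hd (drop g \<Phi>))) [0..<length \<Phi>])"

definition sel_hits ::
  "nat \<Rightarrow> nat \<Rightarrow> nat \<Rightarrow> lit list list list list \<Rightarrow> (nat list \<times> (nat \<times> nat) list \<Rightarrow> bool) list" where
  "sel_hits Q N m \<Phi> = map (hit_consistent Q) (consistency_list Q N m) @ map hit_clause (clause_list \<Phi>)"

lemma set_sel_pairs: "set (sel_pairs N m) = {(j, w). j < m + 2 \<and> w < N + m + 2}"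
  by (auto simp: sel_pairs_def)

lemma set_clause_list: "set (clause_list \<Phi>) = {(g, D). g < length \<Phi> \<and> D \<in> set (\<Phi> ! g)}"
  by (auto simp: clause_list_def hd_drop_conv_nth)

lemma stars_sel:
  assumes "0 < Q"
  shows "stars (sel_keys Q m) (sel_items Q C k m \<Phi>)"
proof
  show "distinct (sel_keys Q m)"
    using assms by (auto simp: sel_keys_def set_tuples distinct_tuples)
  fix it assume "it \<in> set (sel_items Q C k m \<Phi>)"
  then show "fst it \<in> set (sel_keys Q m)"
    by (auto simp: sel_items_def sel_keys_def set_tuples set_sel_pairs) blast
qed

text \<open>By monotonicity \<open>Suc v\<close> can only be the value at \<open>i\<close>. The
  value \<open>p 0 = 0\<close> is never \<open>Suc v\<close>, and the values after position
  \<open>k\<close> exceed \<open>N\<close>, so a hit at \<open>i\<close> is a true variable.\<close>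

lemma slot_lit:
  fixes p :: "nat \<Rightarrow> nat"
  assumes p0: "p 0 = 0" and mono: "\<And>i j. i < j \<Longrightarrow> j \<le> m + 1 \<Longrightarrow> p i < p j"
    and tail: "\<And>j. k < j \<Longrightarrow> j \<le> m + 1 \<Longrightarrow> p j + k = N + j"
    and S: "S = {v. \<exists>j. 1 \<le> j \<and> j \<le> k \<and> Suc v = p j}" and km: "k \<le> m"
    and i: "i \<le> m" "p i \<le> Suc v" "Suc v < p (Suc i)" and v: "v < N"
  shows "v \<in> S \<longleftrightarrow> Suc v = p i"
proof
  assume "v \<in> S"
  then obtain j where j: "1 \<le> j" "j \<le> k" "Suc v = p j" by (auto simp: S)
  have "\<not> j < i" using mono[of j i] i j by auto
  moreover have "\<not> Suc i < j" using mono[of "Suc i" j] i j km by auto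
  moreover have "j \<noteq> Suc i" using i j by auto
  ultimately have "j = i" by linarith
  then show "Suc v = p i" using j by simp
next
  assume *: "Suc v = p i"
  then have "i \<noteq> 0" using p0 by (cases i) auto
  moreover have "i \<le> k" using tail[of i] i v * by (cases "i \<le> k") auto
  ultimately show "v \<in> S" using * by (auto simp: S intro!: exI[of _ i])
qed

lemma slot_exists:
  fixes p :: "nat \<Rightarrow> nat"
  assumes "p 0 = 0"
  shows "u < p n \<Longrightarrow> \<exists>i<n. p i \<le> u \<and> u < p (Suc i)"
proof (induction n)
  case (Suc n)
  then show ?case by (cases "u < p n") (auto intro: less_SucI)
qed (simp add: assms)

text \<open>A selected edge hits a clause on its own, hence must certify a whole conjunction. A term
  has at most \<open>q\<close> literals with two positions each, so some tuple of length
  \<open>Q\<close> contains all that is needed.\<close>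

theorem selection_iff:
  assumes Q: "2 * q \<le> Q" "0 < q" and km: "k \<le> m"
    and short: "\<And>Ds D t. Ds \<in> set \<Phi> \<Longrightarrow> D \<in> set Ds \<Longrightarrow> t \<in> set D \<Longrightarrow> short_term q (length C) t"
  shows "(\<exists>\<sigma>. (\<forall>\<kappa>\<in>set (sel_keys Q m). (\<kappa>, \<sigma> \<kappa>) \<in> set (sel_items Q C k m \<Phi>)) \<and>
      (\<forall>h\<in>set (sel_hits Q (length C) m \<Phi>). \<exists>\<kappa>\<in>set (sel_keys Q m). h (\<kappa>, \<sigma> \<kappa>))) \<longleftrightarrow>
    (\<exists>S\<subseteq>circuit_inputs C. card S = k \<and> sem2 S \<Phi>)"
    (is "?L \<longleftrightarrow> ?R")
proof
  assume ?L
  then obtain \<sigma> where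
    items: "\<And>\<kappa>. \<kappa> \<in> set (sel_keys Q m) \<Longrightarrow> (\<kappa>, \<sigma> \<kappa>) \<in> set (sel_items Q C k m \<Phi>)" and
    hits: "\<And>h. h \<in> set (sel_hits Q (length C) m \<Phi>) \<Longrightarrow> \<exists>\<kappa>\<in>set (sel_keys Q m). h (\<kappa>, \<sigma> \<kappa>)" by blast
  let ?T = "set (tuples Q (slots (Suc (Suc m))))"
  have T: "\<tau> \<in> ?T \<longleftrightarrow> length \<tau> = Q \<and> (\<forall>j\<in>set \<tau>. j < m + 2)" for \<tau>
    by (auto simp: set_tuples)
  have ne: "\<tau> \<noteq> []" if "\<tau> \<in> ?T" for \<tau> using that Q by (auto simp: T)
  have sel: "map fst (\<sigma> \<tau>) = \<tau>" "valid_payload C k (\<sigma> \<tau>)" "set (\<sigma> \<tau>) \<subseteq> set (sel_pairs (length C) m)"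
    if "\<tau> \<in> ?T" for \<tau>
    using items[of \<tau>] that ne[OF that] by (auto simp: sel_keys_def sel_items_def set_tuples)
  have diag: "replicate Q j \<in> ?T" if "j < m + 2" for j using that by (simp add: T)
  \<comment> \<open>The sequence is read off the constant tuples; the consistency hits show that all
    other stars use the same values.\<close>
  define p where "p j = snd (hd (\<sigma> (replicate Q j)))" for j
  have pd: "w = p j" if "j < m + 2" "(j, w) \<in> set (\<sigma> (replicate Q j))" for j w
  proof -
    have "\<sigma> (replicate Q j) \<noteq> []" using that by auto
    then have "hd (\<sigma> (replicate Q j)) \<in> set (\<sigma> (replicate Q j))" by simp
    moreover from this have "fst (hd (\<sigma> (replicate Q j))) = j"
      using sel(1)[OF diag[OF that(1)]] by (metis imageI list.set_map in_set_replicate)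
    ultimately show ?thesis
      using sel(2)[OF diag[OF that(1)]] that(2) unfolding valid_payload_def p_def by fastforce
  qed
  have cons: "w = p j" if \<tau>: "\<tau> \<in> ?T" and x: "(j, w) \<in> set (\<sigma> \<tau>)" for \<tau> j w
  proof -
    have xs: "(j, w) \<in> set (sel_pairs (length C) m)" using sel(3)[OF \<tau>] x by blast
    then have "(\<tau>, j, w) \<in> set (consistency_list Q (length C) m)" using \<tau> by (auto simp: consistency_list_def)
    then have "hit_consistent Q (\<tau>, j, w) \<in> set (sel_hits Q (length C) m \<Phi>)" by (simp add: sel_hits_def)
    from hits[OF this] obtain \<kappa> where "hit_consistent Q (\<tau>, j, w) (\<kappa>, \<sigma> \<kappa>)" by blast
    then have "(j, w) \<in> set (\<sigma> (replicate Q j))" using x by (auto simp: hit_consistent_def)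
    then show ?thesis using xs by (intro pd) (auto simp: set_sel_pairs)
  qed
  have mem: "(j, p j) \<in> set (\<sigma> \<tau>)" if "\<tau> \<in> ?T" "j \<in> set \<tau>" for \<tau> j
  proof -
    have "j \<in> fst ` set (\<sigma> \<tau>)" using sel(1)[OF that(1)] that(2) by (metis list.set_map)
    then obtain w where "(j, w) \<in> set (\<sigma> \<tau>)" by auto
    then show ?thesis using cons[OF that(1)] by metis
  qed
  have Q0: "0 < Q" using Q by simp
  have ok: "pair_ok C k (j, p j)" if "j < m + 2" for j
    using sel(2)[OF diag[OF that]] mem[OF diag[OF that], of j] Q0 by (auto simp: valid_payload_def)
  have step: "p j < p (Suc j)" if "j \<le> m" for j
  proof -
    \<comment> \<open>This star compares the positions \<open>j\<close> and \<open>j + 1\<close>; it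
      exists because \<open>Q\<close> is at least 2.\<close>
    let ?\<tau> = "j # Suc j # replicate (Q - 2) 0"
    have t: "?\<tau> \<in> ?T" using that Q by (auto simp: T)
    have "(j, p j) \<in> set (\<sigma> ?\<tau>)" "(Suc j, p (Suc j)) \<in> set (\<sigma> ?\<tau>)" by (rule mem[OF t]; simp)+
    then show ?thesis using sel(2)[OF t] unfolding valid_payload_def by fastforce
  qed
  have mono: "p i < p j" if "i < j" "j \<le> m + 1" for i j
    using that
  proof (induction j)
    case (Suc j)
    then show ?case using step[of j] by (cases "i = j") auto
  qed simp
  have p0: "p 0 = 0" using ok[of 0] by (simp add: pair_ok_def)
  have tail: "p j + k = length C + j" if "k < j" "j \<le> m + 1" for j
    using ok[of j] that by (auto simp: pair_ok_def)
  have inp: "0 < p j" "p j - 1 \<in> circuit_inputs C" if "1 \<le> j" "j \<le> k" for j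
  proof -
    have *: "0 < p j" "p j \<le> length C" "gate_tag (gate_at C (p j - 1)) = 0"
      using ok[of j] that km by (auto simp: pair_ok_def)
    then show "0 < p j" by simp
    have "gate_at C (p j - 1) = C ! (p j - 1)" using * by (intro gate_at_nth) auto
    then show "p j - 1 \<in> circuit_inputs C"
      using * by (cases "C ! (p j - 1)") (auto simp: circuit_inputs_def)
  qed
  define S where "S = {v. \<exists>j. 1 \<le> j \<and> j \<le> k \<and> Suc v = p j}"
  have S_im: "S = (\<lambda>j. p j - 1) ` {1..k}"
  proof (intro set_eqI iffI)
    fix v assume "v \<in> S"
    then show "v \<in> (\<lambda>j. p j - 1) ` {1..k}" by (auto simp: S_def image_iff) (metis One_nat_def atLeastAtMost_iff diff_Suc_1)
  next
    fix v assume "v \<in> (\<lambda>j. p j - 1) ` {1..k}"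
    then obtain j where j: "1 \<le> j" "j \<le> k" "v = p j - 1" by auto
    then show "v \<in> S" using inp(1)[OF j(1,2)] by (auto simp: S_def intro!: exI[of _ j])
  qed
  have "inj_on (\<lambda>j. p j - 1) {1..k}"
  proof (rule linorder_inj_onI')
    fix i j assume "i \<in> {1..k}" "j \<in> {1..k}" "i < j"
    then show "p i - 1 \<noteq> p j - 1" using mono[of i j] inp(1)[of i] km by auto
  qed
  then have card: "card S = k" by (simp add: S_im card_image)
  have sub: "S \<subseteq> circuit_inputs C" using inp(2) by (auto simp: S_im)
  have "([], \<sigma> []) \<in> set (sel_items Q C k m \<Phi>)" by (rule items) (simp add: sel_keys_def)
  then obtain g where g: "g < length \<Phi>" "\<sigma> [] = [(g, 0)]"
    using Q0 by (auto simp: sel_items_def set_tuples)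
  have "sem1 S (\<Phi> ! g)"
    unfolding sem1_def
  proof
    fix D assume D: "D \<in> set (\<Phi> ! g)"
    then have "hit_clause (g, D) \<in> set (sel_hits Q (length C) m \<Phi>)"
      using g by (simp add: sel_hits_def set_clause_list)
    from hits[OF this] obtain \<kappa> where \<kappa>: "\<kappa> \<in> set (sel_keys Q m)" "hit_clause (g, D) (\<kappa>, \<sigma> \<kappa>)" by blast
    then have "\<kappa> \<noteq> []" using g by (auto simp: hit_clause_def)
    then have \<tau>: "\<kappa> \<in> ?T" using \<kappa> by (auto simp: sel_keys_def)
    from \<kappa>(2) \<open>\<kappa> \<noteq> []\<close> obtain t where t: "t \<in> set D" "\<And>l. l \<in> set t \<Longrightarrow> forces (\<sigma> \<kappa>) l"
      by (auto simp: hit_clause_def)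
    have "lit_true S l" if l: "l \<in> set t" for l
    proof -
      from t(2)[OF l] obtain i w w' where
        x: "(i, w) \<in> set (\<sigma> \<kappa>)" "(Suc i, w') \<in> set (\<sigma> \<kappa>)" "w \<le> Suc (fst l)" "Suc (fst l) < w'"
          "(Suc (fst l) = w) = snd l" by (auto simp: forces_def)
      have w: "w = p i" "w' = p (Suc i)" using cons[OF \<tau>] x by auto
      have "Suc i < m + 2" using sel(3)[OF \<tau>] x(2) by (auto simp: set_sel_pairs)
      moreover have "fst l < length C"
        using short[OF nth_mem[OF g(1)] D t(1)] l by (auto simp: short_term_def)
      ultimately have "fst l \<in> S \<longleftrightarrow> Suc (fst l) = p i"
        using x w by (intro slot_lit[OF p0 mono tail S_def km]) auto
      then show ?thesis using x(5) w by (simp add: lit_true_def)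
    qed
    then show "sem0 S D" using t(1) unfolding sem0_def by blast
  qed
  then have "sem2 S \<Phi>" using g(1) by (auto simp: sem2_def)
  then show ?R using sub card by blast
next
  assume ?R
  then obtain S where S: "S \<subseteq> circuit_inputs C" "card S = k" "sem2 S \<Phi>" by blast
  let ?N = "length C"
  have SN: "S \<subseteq> {..<?N}" using S(1) by (auto simp: circuit_inputs_def)
  then have fin: "finite S" by (rule finite_subset) simp
  define xs where "xs = sorted_list_of_set S"
  have xs: "set xs = S" "length xs = k" "sorted_wrt (<) xs"
    using fin S(2) by (auto simp: xs_def)
  have xsN: "xs ! a < ?N" if "a < k" for a
    using SN xs nth_mem[of a xs] that by auto
  have xsN1: "xs ! (j - 1) < ?N" if "0 < j" "j \<le> k" for j
    using that by (intro xsN) simp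
  \<comment> \<open>Beyond \<open>k\<close> the values are \<open>N + 1\<close>,
    \<open>N + 2\<close> and so on, above \<open>v + 1\<close> for every variable
    \<open>v < N\<close>.\<close>
  define p where "p j = (if j = 0 then 0 else if j \<le> k then Suc (xs ! (j - 1)) else ?N + j - k)" for j
  have p0: "p 0 = 0" by (simp add: p_def)
  have tail: "p j + k = ?N + j" if "k < j" for j using that by (auto simp: p_def)
  have mono: "p i < p j" if "i < j" for i j
  proof (cases "j \<le> k")
    case True
    have "xs ! (i - 1) < xs ! (j - 1)" if "i \<noteq> 0"
      using sorted_wrt_nth_less[OF xs(3), of "i - 1" "j - 1"] True xs(2) \<open>i < j\<close> that by simp
    then show ?thesis using True that by (auto simp: p_def)
  next
    case False
    have "p i \<le> ?N" if "i \<le> k" using xsN[of "i - 1"] that by (auto simp: p_def Suc_le_eq)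
    then show ?thesis using False that by (cases "i \<le> k") (auto simp: p_def)
  qed
  have S_def: "S = {v. \<exists>j. 1 \<le> j \<and> j \<le> k \<and> Suc v = p j}"
  proof (intro set_eqI iffI)
    fix v assume "v \<in> S"
    then obtain a where "a < k" "v = xs ! a" using xs by (metis in_set_conv_nth)
    then show "v \<in> {v. \<exists>j. 1 \<le> j \<and> j \<le> k \<and> Suc v = p j}"
      by (auto simp: p_def intro!: exI[of _ "Suc a"])
  next
    fix v assume "v \<in> {v. \<exists>j. 1 \<le> j \<and> j \<le> k \<and> Suc v = p j}"
    then obtain j where "1 \<le> j" "j \<le> k" "v = xs ! (j - 1)" by (auto simp: p_def split: if_splits)
    then show "v \<in> S" using xs nth_mem[of "j - 1" xs] by auto
  qed
  from S(3) obtain g where g: "g < length \<Phi>" "sem1 S (\<Phi> ! g)" by (auto simp: sem2_def in_set_conv_nth)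
  define \<sigma> where "\<sigma> \<kappa> = (if \<kappa> = [] then [(g, 0)] else map (\<lambda>j. (j, p j)) \<kappa>)" for \<kappa>
  have bound: "p j < ?N + m + 2" if "j < m + 2" for j
    using that xsN1[of j] by (auto simp: p_def)
  have okp: "pair_ok C k (j, p j)" for j
  proof -
    have "gate_tag (gate_at C (xs ! (j - 1))) = 0" if "0 < j" "j \<le> k"
    proof -
      have "xs ! (j - 1) \<in> circuit_inputs C" using S(1) xs nth_mem[of "j - 1" xs] that by auto
      then show ?thesis by (auto simp: circuit_inputs_def gate_at_nth)
    qed
    then show ?thesis using xsN1[of j] tail[of j] by (auto simp: pair_ok_def p_def Suc_le_eq)
  qed
  have T: "\<tau> \<in> set (tuples Q (slots (Suc (Suc m)))) \<longleftrightarrow> length \<tau> = Q \<and> (\<forall>j\<in>set \<tau>. j < m + 2)" for \<tau>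
    by (auto simp: set_tuples)
  show ?L
  proof (intro exI[of _ \<sigma>] conjI ballI)
    fix \<kappa> assume \<kappa>: "\<kappa> \<in> set (sel_keys Q m)"
    show "(\<kappa>, \<sigma> \<kappa>) \<in> set (sel_items Q C k m \<Phi>)"
    proof (cases "\<kappa> = []")
      case True
      then show ?thesis using g(1) by (auto simp: \<sigma>_def sel_items_def)
    next
      case False
      then have t: "\<kappa> \<in> set (tuples Q (slots (Suc (Suc m))))" using \<kappa> by (auto simp: sel_keys_def)
      have "valid_payload C k (\<sigma> \<kappa>)" using False okp mono by (auto simp: valid_payload_def \<sigma>_def)
      moreover have "\<sigma> \<kappa> \<in> set (tuples Q (sel_pairs ?N m))"
        using t False bound by (auto simp: T set_tuples \<sigma>_def set_sel_pairs)
      moreover have "map fst (\<sigma> \<kappa>) = \<kappa>" using False by (simp add: \<sigma>_def comp_def)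
      ultimately show ?thesis by (force simp: sel_items_def)
    qed
  next
    fix h assume "h \<in> set (sel_hits Q ?N m \<Phi>)"
    then consider (cons) \<tau> j w where "\<tau> \<in> set (tuples Q (slots (Suc (Suc m))))" "(j, w) \<in> set (sel_pairs ?N m)"
        "h = hit_consistent Q (\<tau>, j, w)"
      | (clause) g' D where "g' < length \<Phi>" "D \<in> set (\<Phi> ! g')" "h = hit_clause (g', D)"
      by (auto simp: sel_hits_def consistency_list_def set_clause_list)
    then show "\<exists>\<kappa>\<in>set (sel_keys Q m). h (\<kappa>, \<sigma> \<kappa>)"
    proof cases
      case cons
      show ?thesis
      proof (cases "(j, w) \<in> set (\<sigma> \<tau>)")
        case False
        then show ?thesis using cons by (intro bexI[of _ \<tau>]) (auto simp: hit_consistent_def sel_keys_def)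
      next
        case True
        have "\<tau> \<noteq> []" using cons(1) Q by (auto simp: T)
        then have "w = p j" using True by (auto simp: \<sigma>_def)
        moreover have "replicate Q j \<noteq> []" "replicate Q j \<in> set (sel_keys Q m)"
          using Q cons(2) by (auto simp: sel_keys_def T set_sel_pairs)
        ultimately show ?thesis using cons(3) Q
          by (intro bexI[of _ "replicate Q j"]) (auto simp: hit_consistent_def \<sigma>_def)
      qed
    next
      case clause
      show ?thesis
      proof (cases "g' = g")
        case False
        then show ?thesis using clause by (intro bexI[of _ "[]"]) (auto simp: hit_clause_def \<sigma>_def sel_keys_def)
      next
        case True
        with g(2) clause(2) obtain t where t: "t \<in> set D" "\<And>l. l \<in> set t \<Longrightarrow> lit_true S l"
          by (auto simp: sem1_def sem0_def)
        have st: "length t \<le> q" "\<And>l. l \<in> set t \<Longrightarrow> fst l < ?N"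
          using short[OF nth_mem[OF clause(1)] clause(2) t(1)] by (auto simp: short_term_def)
        have "\<forall>l\<in>set t. \<exists>i\<le>m. p i \<le> Suc (fst l) \<and> Suc (fst l) < p (Suc i)"
        proof
          fix l assume "l \<in> set t"
          \<comment> \<open>The value \<open>p (k + 1) = N + 1\<close> closes the last interval that
            can contain a variable, and \<open>k \<le> m\<close> keeps its index in range.\<close>
          then have "Suc (fst l) < p (Suc k)" using st(2)[of l] tail[of "Suc k"] by simp
          then show "\<exists>i\<le>m. p i \<le> Suc (fst l) \<and> Suc (fst l) < p (Suc i)"
            using slot_exists[of p, OF p0] km by (meson le_trans less_Suc_eq_le)
        qed
        then obtain ix where ix: "\<And>l. l \<in> set t \<Longrightarrow> ix l \<le> m \<and> p (ix l) \<le> Suc (fst l) \<and> Suc (fst l) < p (Suc (ix l))"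
          by metis
        \<comment> \<open>Both positions that decide each literal, padded with position 0 up to
          length \<open>Q\<close>.\<close>
        let ?\<tau> = "concat (map (\<lambda>l. [ix l, Suc (ix l)]) t) @ replicate (Q - 2 * length t) 0"
        have len: "length (concat (map (\<lambda>l. [ix l, Suc (ix l)]) t)) = 2 * length t"
          by (induction t) auto
        have T\<tau>: "?\<tau> \<in> set (tuples Q (slots (Suc (Suc m))))"
          unfolding T using st(1) Q ix len by (auto simp: less_Suc_eq_le le_SucI)
        have ne: "?\<tau> \<noteq> []"
        proof
          assume "?\<tau> = []"
          moreover have "length ?\<tau> = Q" using len st(1) Q by simp
          ultimately show False using Q by (simp only: list.size)
        qed
        have F: "forces (\<sigma> ?\<tau>) l" if l: "l \<in> set t" for l
        proof -
          have "fst l \<in> S \<longleftrightarrow> Suc (fst l) = p (ix l)"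
            using ix[OF l] st(2)[OF l] by (intro slot_lit[where m = m, OF p0 mono tail S_def km]) auto
          then have "(Suc (fst l) = p (ix l)) = snd l" using t(2)[OF l] by (simp add: lit_true_def)
          moreover have "(ix l, p (ix l)) \<in> set (\<sigma> ?\<tau>)" "(Suc (ix l), p (Suc (ix l))) \<in> set (\<sigma> ?\<tau>)"
            using l unfolding \<sigma>_def if_not_P[OF ne] by auto
          ultimately show ?thesis using ix[OF l] unfolding forces_def by force
        qed
        have "hit_clause (g', D) (?\<tau>, \<sigma> ?\<tau>)"
          unfolding hit_clause_def using ne F t(1) by (simp only: fst_conv snd_conv) blast
        moreover have "?\<tau> \<in> set (sel_keys Q m)" unfolding sel_keys_def by (rule list.set_intros(2)[OF T\<tau>])
        ultimately show ?thesis using clause(3) by blast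
      qed
    qed
  qed
qed

section \<open>Parsing\<close>

definition parse_nat :: "bool list \<Rightarrow> nat \<times> bool list" where
  "parse_nat w = (length (takeWhile (\<lambda>b. b) w), tl (dropWhile (\<lambda>b. b) w))"

definition parse_list :: "(bool list \<Rightarrow> 'b \<times> bool list) \<Rightarrow> nat \<Rightarrow> bool list \<Rightarrow> 'b list \<times> bool list" where
  "parse_list P n w = ((\<lambda>s. (fst s @ [fst (P (snd s))], snd (P (snd s)))) ^^ n) ([], w)"

definition parse_nats :: "bool list \<Rightarrow> nat list \<times> bool list" where
  "parse_nats w = parse_list parse_nat (fst (parse_nat w)) (snd (parse_nat w))"

definition parse_gate :: "bool list \<Rightarrow> gate \<times> bool list" where
  "parse_gate w = (if fst (parse_nat w) = 0 then (mk_gate 0 [], snd (parse_nat w))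
     else if fst (parse_nat w) = 1
       then (mk_gate 1 [fst (parse_nat (snd (parse_nat w)))], snd (parse_nat (snd (parse_nat w))))
     else (mk_gate (fst (parse_nat w)) (fst (parse_nats (snd (parse_nat w)))),
           snd (parse_nats (snd (parse_nat w)))))"

definition parse_circuit :: "bool list \<Rightarrow> circuit" where
  "parse_circuit w = fst (parse_list parse_gate (fst (parse_nat w)) (snd (parse_nat w)))"

lemma takeWhile_unary: "takeWhile (\<lambda>b. b) (replicate n True @ False # r) = replicate n True"
  by (induction n) auto

lemma dropWhile_unary: "dropWhile (\<lambda>b. b) (replicate n True @ False # r) = False # r"
  by (induction n) auto

lemma parse_nat_enc: "parse_nat (enc_nat n @ r) = (n, r)"
  by (simp add: parse_nat_def enc_nat_def takeWhile_unary dropWhile_unary)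

lemma parse_nat_enc_instance: "parse_nat (enc_instance x k) = (k, x)"
  by (simp add: parse_nat_def enc_instance_def takeWhile_unary dropWhile_unary)

lemma parse_list_enc:
  assumes "\<And>x r. x \<in> set xs \<Longrightarrow> P (e x @ r) = (x, r)"
  shows "parse_list P (length xs) (concat (map e xs) @ r) = (xs, r)"
proof -
  let ?f = "\<lambda>s. (fst s @ [fst (P (snd s))], snd (P (snd s)))"
  have "(?f ^^ length ys) (a, concat (map e ys) @ r) = (a @ ys, r)" if "set ys \<subseteq> set xs" for a ys
    using that
    by (induction ys arbitrary: a) (auto simp: funpow_Suc_right assms simp del: funpow.simps(2))
  from this[of xs "[]"] show ?thesis by (simp add: parse_list_def)
qed

lemma parse_nats_enc: "parse_nats (enc_list enc_nat is @ r) = (is, r)"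
  by (simp add: parse_nats_def enc_list_def parse_nat_enc parse_list_enc)

lemma parse_gate_enc: "parse_gate (enc_gate g @ r) = (g, r)"
  by (cases g) (simp_all add: parse_gate_def parse_nat_enc parse_nats_enc mk_gate_def)

lemma parse_circuit_enc: "parse_circuit (enc_list enc_gate C) = C"
proof -
  have "parse_list parse_gate (length C) (concat (map enc_gate C) @ []) = (C, [])"
    by (rule parse_list_enc) (rule parse_gate_enc)
  then show ?thesis by (simp add: parse_circuit_def enc_list_def parse_nat_enc)
qed

section \<open>Parsing takes polynomial time\<close>

lemma sz_tl_le: "sz (tl a) \<le> sz a"
  by (cases a) auto

lemma sz_dropWhile_le: "sz (dropWhile P a) \<le> sz a"
  by (induction a) auto

lemma sz_parse_nat: "sz (snd (parse_nat w)) \<le> sz w"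
  using le_trans[OF sz_tl_le sz_dropWhile_le] by (simp add: parse_nat_def)

lemma sz_parse_list:
  assumes "\<And>w. sz (snd (P w)) \<le> sz w"
  shows "sz (snd (parse_list P n w)) \<le> sz w"
  unfolding parse_list_def by (induction n) (auto intro: le_trans[OF assms])

lemma sz_parse_gate: "sz (snd (parse_gate w)) \<le> sz w"
  unfolding parse_gate_def parse_nats_def
  by (auto intro: sz_parse_nat le_trans[OF sz_parse_nat] le_trans[OF sz_parse_list[OF sz_parse_nat]])

lemma poly_parse_nat [poly_intros]: "poly w \<Longrightarrow> poly (\<lambda>x. parse_nat (w x))"
  unfolding parse_nat_def by (intro poly_intros)

text \<open>The unread rest never grows, so each of the \<open>n x\<close> items is bounded by one
  polynomial in the size of the whole word; this bounds the accumulator.\<close>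

lemma poly_parse_list:
  fixes P :: "bool list \<Rightarrow> 'b::tree_codable \<times> bool list"
  assumes P: "poly P" and n: "poly n" and w: "poly w" and dec: "\<And>w. sz (snd (P w)) \<le> sz w"
  shows "poly (\<lambda>x. parse_list P (n x) (w x))"
proof -
  from poly_size[OF poly_fst[OF P]] obtain c where c: "\<And>w. sz (fst (P w)) \<le> (sz w + 2) ^ c" by blast
  from poly_size[OF n] obtain cn where cn: "\<And>x. sz (n x) \<le> (sz x + 2) ^ cn" by blast
  from poly_size[OF w] obtain cw where cw: "\<And>x. sz (w x) \<le> (sz x + 2) ^ cw" by blast
  let ?f = "\<lambda>s. (fst s @ [fst (P (snd s))], snd (P (snd s)))"
  have eq: "fold (\<lambda>_. ?f) (replicate k False) ([], v) = parse_list P k v" for k v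
    by (simp add: parse_list_def fold_replicate_funpow)
  have fst_sz: "sz (fst (parse_list P k v)) \<le> 1 + k * (1 + (sz v + 2) ^ c)" for k v
  proof (induction k)
    case 0
    then show ?case by (simp add: parse_list_def)
  next
    case (Suc k)
    let ?s = "parse_list P k v"
    have "sz (fst (P (snd ?s))) \<le> (sz (snd ?s) + 2) ^ c" by (rule c)
    also have "\<dots> \<le> (sz v + 2) ^ c" using sz_parse_list[of P k v, OF dec] by (intro power_mono) auto
    finally have "sz (fst (P (snd ?s))) \<le> (sz v + 2) ^ c" .
    moreover have "fst (parse_list P (Suc k) v) = fst ?s @ [fst (P (snd ?s))]"
      by (simp add: parse_list_def)
    ultimately show ?case using Suc sz_append[of "fst ?s" "[fst (P (snd ?s))]"] by simp
  qed
  have "poly (\<lambda>x. fold (\<lambda>_. ?f) (replicate (n x) False) ([], w x))"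
  proof (rule poly_fold)
    show "poly (\<lambda>x. replicate (n x) False)" by (rule poly_replicate_False[OF n])
    show "poly (\<lambda>x. ([], w x))" by (intro poly_intros w)
    show "poly (\<lambda>p. ?f (snd (snd p)))" by (intro poly_intros poly_comp[OF _ P])
    show "sz (fold (\<lambda>_. ?f) (take i (replicate (n x) False)) ([], w x)) \<le>
       (\<lambda>N. Suc ((1 + (N + 2) ^ cn * (1 + ((N + 2) ^ cw + 2) ^ c)) + (N + 2) ^ cw)) (sz x)" for x i
    proof -
      let ?k = "min i (n x)" and ?N = "sz x"
      have "?k * (1 + (sz (w x) + 2) ^ c) \<le> (?N + 2) ^ cn * (1 + ((?N + 2) ^ cw + 2) ^ c)"
        using cn[of x] cw[of x] by (intro mult_le_mono add_mono power_mono) auto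
      moreover have "sz (parse_list P ?k (w x)) =
          Suc (sz (fst (parse_list P ?k (w x))) + sz (snd (parse_list P ?k (w x))))"
        by (metis prod.collapse sz_Pair)
      moreover have e: "fold (\<lambda>_. ?f) (take i (replicate (n x) False)) ([], w x) = parse_list P ?k (w x)"
        unfolding take_replicate by (rule eq)
      ultimately show ?thesis unfolding e
        using fst_sz[of ?k "w x"] sz_parse_list[of P ?k "w x", OF dec] cw[of x] by simp
    qed
  qed (intro polyb_intros)
  then show ?thesis by (simp only: eq)
qed

lemma poly_parse_nats [poly_intros]:
  assumes "poly w" shows "poly (\<lambda>x. parse_nats (w x))"
  unfolding parse_nats_def
proof (rule poly_parse_list)
  show "poly parse_nat" using poly_parse_nat[OF poly_id] by simp
qed (intro poly_intros assms sz_parse_nat)+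

lemma poly_parse_gate: "poly parse_gate"
  unfolding parse_gate_def[abs_def] by (intro poly_intros)

lemma poly_parse_circuit [poly_intros]:
  assumes "poly w" shows "poly (\<lambda>x. parse_circuit (w x))"
  unfolding parse_circuit_def
  by (intro poly_fst poly_parse_list[OF poly_parse_gate] sz_parse_gate poly_snd poly_parse_nat assms)

section \<open>The reduction\<close>

lemma poly_mem [poly_intros]:
  assumes "poly f" "poly l" shows "poly (\<lambda>x. f x \<in> set (l x))"
proof -
  have "poly (\<lambda>x. \<exists>y\<in>set (l x). y = f x)" by (intro poly_intros assms poly_comp[OF _ assms(1)])
  then show ?thesis by simp
qed

lemma poly_slots [poly_intros]: "poly n \<Longrightarrow> poly (\<lambda>x. slots (n x))"
  unfolding slots_def by (intro poly_intros)

lemma poly_gate_at [poly_intros]: "poly C \<Longrightarrow> poly j \<Longrightarrow> poly (\<lambda>x. gate_at (C x) (j x))"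
  unfolding gate_at_def by (intro poly_intros)

lemma poly_depth_le:
  assumes "poly C" "poly j" shows "poly (\<lambda>x. depth_le d (C x) (j x))"
proof -
  have "poly (\<lambda>p. depth_le d (fst p) (snd p))"
  proof (induction d)
    case (Suc d)
    show ?case unfolding depth_le.simps by (intro poly_intros poly_comp2[OF Suc])
  qed (simp, intro poly_intros)
  from poly_comp2[OF this assms] show ?thesis .
qed

lemma poly_weft_le:
  assumes "poly C" "poly j" shows "poly (\<lambda>x. weft_le d t (C x) (j x))"
proof -
  have "poly (\<lambda>p. weft_le d t (fst p) (snd p))"
  proof (induction d arbitrary: t)
    case (Suc d)
    show ?case unfolding weft_le.simps by (intro poly_intros poly_comp2[OF Suc])
  qed (simp, intro poly_intros)
  from poly_comp2[OF this assms] show ?thesis .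
qed

lemma poly_pairprod [poly_intros]:
  assumes "poly D" shows "poly (\<lambda>x. pairprod (D x))"
  unfolding pairprod_def by (intro poly_intros assms poly_comp[OF _ assms])

lemma poly_dnf0:
  assumes "poly C" "poly j" "poly b" shows "poly (\<lambda>x. dnf0 d (C x) (j x) (b x))"
proof -
  have "poly (\<lambda>p. dnf0 d (fst p) (fst (snd p)) (snd (snd p)))"
  proof (induction d)
    case (Suc d)
    show ?case unfolding dnf0.simps by (intro poly_intros poly_comp3[OF Suc])
  qed (simp, intro poly_intros)
  from poly_comp3[OF this assms] show ?thesis .
qed

lemma poly_cnf1:
  assumes "poly C" "poly j" "poly b" shows "poly (\<lambda>x. cnf1 d (C x) (j x) (b x))"
proof -
  have "poly (\<lambda>p. cnf1 d (fst p) (fst (snd p)) (snd (snd p)))"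
  proof (induction d)
    case (Suc d)
    show ?case unfolding cnf1.simps by (intro poly_intros poly_comp3[OF Suc] poly_dnf0)
  qed (simp, intro poly_intros)
  from poly_comp3[OF this assms] show ?thesis .
qed

lemma poly_dnf2:
  assumes "poly C" "poly j" "poly b" shows "poly (\<lambda>x. dnf2 d (C x) (j x) (b x))"
proof -
  have "poly (\<lambda>p. dnf2 d (fst p) (fst (snd p)) (snd (snd p)))"
  proof (induction d)
    case (Suc d)
    show ?case unfolding dnf2.simps by (intro poly_intros poly_comp3[OF Suc] poly_cnf1)
  qed (simp, intro poly_intros)
  from poly_comp3[OF this assms] show ?thesis .
qed

lemma poly_tuples [poly_intros]:
  assumes "poly l" shows "poly (\<lambda>x. tuples n (l x))"
proof -
  have "poly (\<lambda>xs :: 'b list. tuples n xs)"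
  proof (induction n)
    case (Suc n)
    show ?case unfolding tuples.simps by (intro poly_intros poly_comp[OF _ Suc])
  qed (simp, intro poly_intros)
  from poly_comp[OF assms this] show ?thesis .
qed

lemma poly_key_index [poly_intros]:
  assumes "poly ks" "poly \<kappa>" shows "poly (\<lambda>x. key_index (ks x) (\<kappa> x))"
  unfolding key_index_def by (intro poly_intros assms poly_comp[OF _ assms(2)])

lemma poly_numbered [poly_intros]:
  assumes "poly l" shows "poly (\<lambda>x. numbered (l x))"
  unfolding numbered_def by (intro poly_intros assms poly_comp[OF _ assms])

lemma poly_star_sample:
  assumes ks: "poly ks" and its: "poly its" and h: "poly (\<lambda>p. h (fst p) (snd p))"
  shows "poly (\<lambda>x. star_sample (ks x) (its x) (h x))"
  unfolding star_sample_def star_edge_def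
  by (intro poly_intros its poly_comp[OF _ ks] poly_comp2[OF h])

lemma poly_sel_pairs [poly_intros]:
  assumes "poly N" "poly m" shows "poly (\<lambda>x. sel_pairs (N x) (m x))"
  unfolding sel_pairs_def by (intro poly_intros assms poly_comp[OF _ assms(1)] poly_comp[OF _ assms(2)])

lemma poly_sel_keys [poly_intros]:
  assumes "poly m" shows "poly (\<lambda>x. sel_keys Q (m x))"
  unfolding sel_keys_def by (intro poly_intros assms)

lemma poly_sel_items [poly_intros]:
  assumes "poly C" "poly k" "poly m" "poly \<Phi>" shows "poly (\<lambda>x. sel_items Q (C x) (k x) (m x) (\<Phi> x))"
  unfolding sel_items_def valid_payload_def pair_ok_def
  by (intro poly_intros assms poly_comp[OF _ assms(1)] poly_comp[OF _ assms(2)])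

lemma poly_consistency_list [poly_intros]:
  assumes "poly N" "poly m" shows "poly (\<lambda>x. consistency_list Q (N x) (m x))"
  unfolding consistency_list_def by (intro poly_intros assms poly_comp[OF _ assms(1)] poly_comp[OF _ assms(2)])

lemma poly_clause_list [poly_intros]:
  assumes "poly \<Phi>" shows "poly (\<lambda>x. clause_list (\<Phi> x))"
  unfolding clause_list_def by (intro poly_intros assms poly_comp[OF _ assms])

lemma poly_hit_consistent [poly_intros]:
  "poly c \<Longrightarrow> poly it \<Longrightarrow> poly (\<lambda>x. hit_consistent Q (c x) (it x))"
  unfolding hit_consistent_def by (intro poly_intros)

lemma poly_forces [poly_intros]:
  assumes "poly p" "poly l" shows "poly (\<lambda>x. forces (p x) (l x))"
  unfolding forces_def by (intro poly_intros assms poly_comp[OF _ assms(1)] poly_comp[OF _ assms(2)])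

lemma poly_hit_clause [poly_intros]:
  assumes "poly c" "poly it" shows "poly (\<lambda>x. hit_clause (c x) (it x))"
  unfolding hit_clause_def by (intro poly_intros assms poly_comp[OF _ assms(1)] poly_comp[OF _ assms(2)])

text \<open>A list of predicates is not codable data. Unfolding \<open>star_samples\<close> and
  \<open>sel_hits\<close> fuses the maps, so that they run over \<open>consistency_list\<close> and
  \<open>clause_list\<close>, with the predicates as polynomial-time functions of the
  entries.\<close>

lemma poly_star_samples_sel:
  assumes C: "poly C" and k: "poly k" and m: "poly m" and \<Phi>: "poly \<Phi>"
  shows "poly (\<lambda>x. star_samples (sel_keys Q (m x)) (sel_items Q (C x) (k x) (m x) (\<Phi> x))
     (sel_hits Q (length (C x)) (m x) (\<Phi> x)))"
  unfolding star_samples_def sel_hits_def map_append map_map comp_def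
  by (intro poly_intros poly_star_sample assms poly_comp[OF _ C] poly_comp[OF _ k] poly_comp[OF _ m] poly_comp[OF _ \<Phi>])

lemma poly_enc_nat [poly_intros]: "poly n \<Longrightarrow> poly (\<lambda>x. enc_nat (n x))"
  unfolding enc_nat_def by (intro poly_intros)

lemma poly_enc_list [poly_intros]:
  assumes "poly (\<lambda>p. e (fst p) (snd p))" "poly l"
  shows "poly (\<lambda>x. enc_list (e x) (l x))"
  unfolding enc_list_def by (intro poly_intros assms)

lemma enc_gate_eq: "enc_gate g = (if gate_tag g = 0 then enc_nat 0
    else if gate_tag g = 1 then enc_nat 1 @ enc_nat (hd (gate_args g))
    else enc_nat (gate_tag g) @ enc_list enc_nat (gate_args g))"
  by (cases g) auto

lemma poly_enc_gate [poly_intros]: "poly g \<Longrightarrow> poly (\<lambda>x. enc_gate (g x))"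
  unfolding enc_gate_eq by (intro poly_intros)

lemma poly_enc_samples [poly_intros]:
  assumes "poly n" "poly smp" shows "poly (\<lambda>x. enc_samples (n x) (smp x))"
  unfolding enc_samples_def enc_edges_def case_prod_beta' by (intro poly_intros assms)

lemma poly_enc_instance [poly_intros]: "poly y \<Longrightarrow> poly k \<Longrightarrow> poly (\<lambda>x. enc_instance (y x) (k x))"
  unfolding enc_instance_def by (intro poly_intros)

text \<open>Encoding \<open>C\<close> again and comparing with \<open>y\<close> rejects every word
  that is not the code of a circuit, whatever the total parser makes of it.\<close>

definition good_circuit :: "nat \<Rightarrow> bool list \<Rightarrow> circuit \<Rightarrow> bool" where
  "good_circuit d y C \<longleftrightarrow> enc_list enc_gate C = y \<and> C \<noteq> [] \<and>
     (\<forall>j\<in>set (slots (length C)). \<forall>i\<in>set (gate_args (gate_at C j)). i < j) \<and>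
     depth_le d C (length C - 1) \<and> weft_le d 2 C (length C - 1)"

text \<open>The empty disjunction is false: its star \<open>[]\<close> has no edge, so a bad word
  becomes an instance without solution. The fuel \<open>Suc d\<close> exceeds the depth.\<close>

definition red_formula :: "nat \<Rightarrow> bool list \<Rightarrow> circuit \<Rightarrow> lit list list list list" where
  "red_formula d y C = (if good_circuit d y C then dnf2 (Suc d) C (length C - 1) True else [])"

definition red_instance :: "nat \<Rightarrow> circuit \<Rightarrow> nat \<Rightarrow> nat \<Rightarrow> lit list list list list \<Rightarrow> bool list" where
  "red_instance Q C k m \<Phi> = enc_instance
     (enc_samples (length (sel_keys Q m) + length (sel_items Q C k m \<Phi>))
       (star_samples (sel_keys Q m) (sel_items Q C k m \<Phi>) (sel_hits Q (length C) m \<Phi>)))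
     (length (sel_keys Q m))"

text \<open>Terms of \<open>dnf2 (Suc d)\<close> have at most \<open>2 ^ Suc d\<close> literals,
  each decided by two positions.\<close>

definition term_width :: "nat \<Rightarrow> nat" where
  "term_width d = 2 * 2 ^ Suc d"

text \<open>The input is \<open>enc_instance (enc_instance y k) m\<close>, where \<open>m\<close> is an upper bound on \<open>k\<close>.\<close>

definition reduction :: "nat \<Rightarrow> bool list \<Rightarrow> bool list" where
  "reduction d w = red_instance (term_width d)
     (parse_circuit (snd (parse_nat (snd (parse_nat w)))))
     (fst (parse_nat (snd (parse_nat w)))) (fst (parse_nat w))
     (red_formula d (snd (parse_nat (snd (parse_nat w))))
       (parse_circuit (snd (parse_nat (snd (parse_nat w))))))"

lemma poly_good_circuit [poly_intros]:
  assumes "poly y" "poly C" shows "poly (\<lambda>x. good_circuit d (y x) (C x))"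
  unfolding good_circuit_def
  by (intro poly_intros assms poly_depth_le poly_weft_le poly_comp[OF _ assms(2)])

lemma poly_red_formula [poly_intros]:
  assumes "poly y" "poly C" shows "poly (\<lambda>x. red_formula d (y x) (C x))"
  unfolding red_formula_def by (intro poly_intros assms poly_dnf2)

lemma poly_red_instance [poly_intros]:
  assumes "poly C" "poly k" "poly m" "poly \<Phi>"
  shows "poly (\<lambda>x. red_instance Q (C x) (k x) (m x) (\<Phi> x))"
  unfolding red_instance_def by (intro poly_intros poly_star_samples_sel assms)

lemma poly_reduction: "poly (reduction d)"
  unfolding reduction_def[abs_def] by (intro poly_intros)

section \<open>Correctness of the reduction\<close>

lemma last_node_values: "C \<noteq> [] \<Longrightarrow> last (node_values h C) = node_values h C ! (length C - 1)"
  by (metis last_conv_nth length_0_conv length_node_values)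

lemma good_circuit_iff:
  "good_circuit d y C \<longleftrightarrow> enc_list enc_gate C = y \<and> circuit_wf C \<and>
     circuit_weft C \<le> 2 \<and> circuit_depth C \<le> d"
proof -
  have last: "circuit_weft C = cweft C (length C - 1)" "circuit_depth C = cdep C (length C - 1)" if "C \<noteq> []"
    using that by (simp_all add: circuit_weft_def circuit_depth_def last_node_values)
  have wf: "C \<noteq> [] \<and> (\<forall>j\<in>set (slots (length C)). \<forall>i\<in>set (gate_args (gate_at C j)). i < j) \<longleftrightarrow> circuit_wf C"
    by (auto simp: circuit_wf_def gate_at_nth)
  have ne: "circuit_wf C \<Longrightarrow> C \<noteq> []" by (simp add: circuit_wf_def)
  show ?thesis
  proof (cases "circuit_wf C")
    case True
    then have "length C - 1 < length C" using ne by (cases C) auto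
    then show ?thesis using True wf ne last depth_le_iff[OF True, of "length C - 1" d]
        weft_le_iff[OF True, of "length C - 1" d 2] unfolding good_circuit_def by metis
  next
    case False
    then show ?thesis using wf unfolding good_circuit_def by blast
  qed
qed

text \<open>The new parameter depends on \<open>m\<close> and \<open>d\<close> only, not on
  \<open>k\<close>. Its \<open>Suc\<close> counts the star that selects a disjunct.\<close>

theorem reduction_correct:
  assumes km: "k \<le> m"
  shows "\<exists>n smp. reduction d (enc_instance (enc_instance y k) m) =
      enc_instance (enc_samples n smp) (Suc ((m + 2) ^ term_width d)) \<and> valid_samples n smp \<and>
      ((\<exists>F. conscheck_matching_solution {..<n} (map (\<lambda>(es, l). (edge_set es, l)) smp)
          (Suc ((m + 2) ^ term_width d)) F) \<longleftrightarrow> (y, k) \<in> weighted_circuit_sat 2 d)"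
proof -
  let ?Q = "term_width d"
  define C where "C = parse_circuit y"
  define \<Phi> where "\<Phi> = red_formula d y C"
  let ?ks = "sel_keys ?Q m" and ?its = "sel_items ?Q C k m \<Phi>" and ?hs = "sel_hits ?Q (length C) m \<Phi>"
  have Q: "2 * 2 ^ Suc d \<le> ?Q" "0 < (2::nat) ^ Suc d" "0 < ?Q" by (auto simp: term_width_def)
  interpret stars ?ks ?its by (rule stars_sel[OF Q(3)])
  have K: "length ?ks = Suc ((m + 2) ^ ?Q)" by (simp add: sel_keys_def length_tuples)
  have red: "reduction d (enc_instance (enc_instance y k) m) =
      enc_instance (enc_samples (length ?ks + length ?its) (star_samples ?ks ?its ?hs)) (length ?ks)"
    by (simp add: reduction_def parse_nat_enc_instance red_instance_def C_def \<Phi>_def)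
  have short: "short_term (2 ^ Suc d) (length C) t" if "Ds \<in> set \<Phi>" "D \<in> set Ds" "t \<in> set D" for Ds D t
  proof -
    have g: "good_circuit d y C" using that by (auto simp: \<Phi>_def red_formula_def split: if_splits)
    then have "circuit_wf C" by (simp add: good_circuit_iff)
    moreover from this have "length C - 1 < length C" by (auto simp: circuit_wf_def)
    ultimately show ?thesis
      using that g unfolding \<Phi>_def red_formula_def by (intro short_term_dnf2) (simp_all only: if_True)
  qed
  have "(\<exists>F. conscheck_matching_solution {..<length ?ks + length ?its}
      (map (\<lambda>(es, l). (edge_set es, l)) (star_samples ?ks ?its ?hs)) (length ?ks) F) \<longleftrightarrow>
      (\<exists>S\<subseteq>circuit_inputs C. card S = k \<and> sem2 S \<Phi>)"
    unfolding star_solution by (rule selection_iff[OF Q(1,2) km short])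
  also have "\<dots> \<longleftrightarrow> (y, k) \<in> weighted_circuit_sat 2 d"
  proof (cases "good_circuit d y C")
    case True
    then have C: "enc_list enc_gate C = y" "circuit_wf C" "circuit_weft C \<le> 2" "circuit_depth C \<le> d"
      by (auto simp: good_circuit_iff)
    then have ne: "C \<noteq> []" by (simp add: circuit_wf_def)
    then have lt: "length C - 1 < length C" by (cases C) auto
    have "sem2 S \<Phi> \<longleftrightarrow> circuit_sat C S" for S
    proof -
      have "cdep C (length C - 1) < Suc d" "cweft C (length C - 1) \<le> 2"
        using C(3,4) ne by (auto simp: circuit_depth_def circuit_weft_def less_Suc_eq_le last_node_values)
      from dnf2_correct[OF C(2) lt this, of S True] True
      show ?thesis using ne
        by (simp add: \<Phi>_def red_formula_def circuit_sat_def last_node_values del: dnf2.simps)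
    qed
    moreover have "(y, k) \<in> weighted_circuit_sat 2 d \<longleftrightarrow>
        (\<exists>S\<subseteq>circuit_inputs C. card S = k \<and> circuit_sat C S)"
    proof
      assume "(y, k) \<in> weighted_circuit_sat 2 d"
      then obtain C' where C': "y = enc_list enc_gate C'"
        "\<exists>S\<subseteq>circuit_inputs C'. card S = k \<and> circuit_sat C' S" by (auto simp: weighted_circuit_sat_def)
      then have "C' = C" by (simp add: C_def parse_circuit_enc)
      with C'(2) show "\<exists>S\<subseteq>circuit_inputs C. card S = k \<and> circuit_sat C S" by simp
    next
      assume "\<exists>S\<subseteq>circuit_inputs C. card S = k \<and> circuit_sat C S"
      with C show "(y, k) \<in> weighted_circuit_sat 2 d"
        unfolding weighted_circuit_sat_def by blast
    qed
    ultimately show ?thesis by simp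
  next
    case False
    then have "\<Phi> = []" by (simp add: \<Phi>_def red_formula_def)
    moreover have "(y, k) \<notin> weighted_circuit_sat 2 d"
    proof
      assume "(y, k) \<in> weighted_circuit_sat 2 d"
      then obtain C' where C': "y = enc_list enc_gate C'" "circuit_wf C'" "circuit_weft C' \<le> 2" "circuit_depth C' \<le> d"
        by (auto simp: weighted_circuit_sat_def)
      moreover from this have "C' = C" by (simp add: C_def parse_circuit_enc)
      ultimately show False using False by (simp add: good_circuit_iff)
    qed
    ultimately show ?thesis by (simp add: sem2_def)
  qed
  finally show ?thesis using red valid_star_samples[of ?hs] unfolding K by blast
qed

section \<open>Composing machines\<close>

text \<open>
  Arbitrary machines leave garbage on their tapes.  They are composed by giving each its own block of
  tapes and copying only the outputs.
\<close>

definition computes :: "prog \<Rightarrow> bool list \<Rightarrow> nat \<Rightarrow> bool list \<Rightarrow> bool" where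
  "computes P w T v \<longleftrightarrow> (\<exists>s'. runs P (start w) T s' \<and> tape_holds (s' 0) v)"

lemma computes_mono: "computes P w T v \<Longrightarrow> T \<le> T' \<Longrightarrow> computes P w T' v"
  unfolding computes_def using runs_mono by blast

lemma computes_of_tm: "tm_wf M \<Longrightarrow> tm_computes M w T v \<Longrightarrow> computes (of_tm M) w T v"
  unfolding computes_def by (rule runs_of_tm)

lemma computes_to_tm: "uses n P \<Longrightarrow> 0 < n \<Longrightarrow> computes P w T v \<Longrightarrow> tm_computes (to_tm n P) w T v"
  unfolding computes_def using tm_computes_to_tm by blast

lemma tm_tapes_pos: "tm_wf M \<Longrightarrow> 0 < tm_tapes M"
  by (simp add: tm_wf_def)

lemma word_program:
  assumes "poly h"
  obtains P n c where "uses n P" "0 < n" "\<And>w. computes P w ((length w + 2) ^ c) (h w)"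
    "\<And>w. length (h w) \<le> (length w + 2) ^ c"
proof -
  from poly_word_program[OF assms] obtain P n c where P: "uses n P" "0 < n"
    "\<And>w. rruns P (reg w) ((length w + 2) ^ c) (reg (h w))"
    "\<And>w. length (h w) \<le> (length w + 2) ^ c" by (rule ptE) (rule that)
  have "computes P w ((length w + 2) ^ c) (h w)" for w
    unfolding computes_def using P(3)[of w] tape_holds_input[of "h w"]
    by (intro exI[of _ "st (reg (h w))"]) (simp add: st_reg, simp add: start_def)
  then show thesis using that P by blast
qed

lemma start_simps: "start w 0 = input_tape w" "0 < i \<Longrightarrow> start w i = input_tape []"
  by (auto simp: start_def)

lemma runs_mv_to:
  assumes "tape_holds (s i) xs" "i \<noteq> j" "T = 5 * length xs + 1"
    "s' = s(i := (popt ^^ length xs) (s i), j := fold pusht xs (s j))"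
  shows "runs (mvp i j) s T s'"
  using runs_mv[of s i xs j, OF assms(1,2)] assms(3,4) by simp

text \<open>\<open>P\<close> owns the tapes below \<open>n\<close>, \<open>Q\<close> the next
  \<open>m\<close>, and tape \<open>n + m\<close> carries the outputs, which are reversed twice.
  Tape 0 need not be erased: one blank under the head suffices, since the final word is pushed to
  its left and is read up to the first blank.\<close>

definition thenp :: "nat \<Rightarrow> nat \<Rightarrow> prog \<Rightarrow> prog \<Rightarrow> prog" where
  "thenp n m P Q = P ;; mvp 0 (n + m) ;; mvp (n + m) n ;; shiftp n Q ;; mvp n (n + m) ;;
     actp 0 (\<lambda>_. None) MoveS ;; mvp (n + m) 0"

lemma uses_thenp:
  assumes "uses n P" "uses m Q" "0 < n"
  shows "uses (n + m + 1) (thenp n m P Q)"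
  unfolding thenp_def using assms(3)
  by (intro uses_seq uses_basic uses_act uses_mono[OF assms(1)] uses_shift[OF assms(2)]) auto

lemma tape_holds_blank: "tape_holds (tape_act t (None, MoveS)) []"
  by (simp add: tape_holds_def tape_act_def)

lemma computes_thenp:
  assumes "uses n P" "uses m Q" "0 < n" "0 < m" "computes P w T v" "computes Q v T' u"
  shows "computes (thenp n m P Q) w (T + T' + 10 * (length v + length u) + 5) u"
proof -
  let ?z = "n + m"
  from assms(5) obtain s1 where s1: "runs P (start w) T s1" "tape_holds (s1 0) v"
    unfolding computes_def by blast
  from assms(6) obtain s' where s': "runs Q (start v) T' s'" "tape_holds (s' 0) u"
    unfolding computes_def by blast
  have out1: "s1 i = input_tape []" if "n \<le> i" for i
    using runs_outside[OF assms(1) s1(1) that] that assms(3) by (simp add: start_simps)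
  have out': "s' i = input_tape []" if "m \<le> i" for i
    using runs_outside[OF assms(2) s'(1) that] that assms(4) by (simp add: start_simps)
  define s2 where "s2 = s1(0 := (popt ^^ length v) (s1 0), ?z := input_tape (rev v))"
  have r2: "runs (mvp 0 ?z) s1 (5 * length v + 1) s2"
    by (rule runs_mv_to[where xs = v]) (use assms(3) s1(2) in \<open>auto simp: s2_def out1\<close>)
  define s3 where "s3 = s2(?z := input_tape [], n := input_tape v)"
  have "tape_holds (s2 ?z) (rev v)" by (simp add: s2_def tape_holds_input)
  then have r3: "runs (mvp ?z n) s2 (5 * length v + 1) s3"
    by (rule runs_mv_to) (use assms(3,4) in \<open>auto simp: s3_def s2_def out1 fun_eq_iff\<close>)
  have "(\<lambda>i. s3 (i + n)) = start v"
  proof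
    fix i show "s3 (i + n) = start v i"
      using assms(3,4) by (cases "i = 0") (auto simp: s3_def s2_def out1 start_simps)
  qed
  with s'(1) have "runs Q (\<lambda>i. s3 (i + n)) T' s'" by simp
  note r4 = runs_shift[OF this]
  define s4 where "s4 = (\<lambda>i. if i < n then s3 i else s' (i - n))"
  have h4: "tape_holds (s4 n) u" "s4 ?z = input_tape []" using s'(2) out'[of m] by (auto simp: s4_def)
  define s5 where "s5 = s4(n := (popt ^^ length u) (s4 n), ?z := input_tape (rev u))"
  have r5: "runs (mvp n ?z) s4 (5 * length u + 1) s5"
    by (rule runs_mv_to[where xs = u]) (use assms(4) h4 in \<open>auto simp: s5_def\<close>)
  define s6 where "s6 = s5(0 := tape_act (s5 0) (None, MoveS))"
  have r6: "runs (actp 0 (\<lambda>_. None) MoveS) s5 1 s6"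
    unfolding s6_def by (rule runs_act)
  have h6: "tape_holds (s6 ?z) (rev u)" using assms(3) by (simp add: s6_def s5_def tape_holds_input)
  define s7 where "s7 = s6(?z := (popt ^^ length (rev u)) (s6 ?z), 0 := fold pusht (rev u) (s6 0))"
  have r7: "runs (mvp ?z 0) s6 (5 * length (rev u) + 1) s7"
    unfolding s7_def using assms(3) by (intro runs_mv_to[where xs = "rev u"] h6) auto
  have "tape_holds (s7 0) (rev (rev u) @ [])"
    unfolding s7_def s6_def by (simp del: rev_rev_ident append_Nil2) (rule tape_holds_fold_pusht[OF tape_holds_blank])
  moreover have "runs (thenp n m P Q) (start w)
      (T + ((5 * length v + 1) + ((5 * length v + 1) + (T' + ((5 * length u + 1) + (1 + (5 * length (rev u) + 1))))))) s7"
    unfolding thenp_def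
    by (rule runs_seq[OF s1(1) runs_seq[OF r2 runs_seq[OF r3 runs_seq[OF r4[folded s4_def] runs_seq[OF r5 runs_seq[OF r6 r7]]]]]])
  ultimately show ?thesis unfolding computes_def
    by (intro exI[of _ s7] conjI) (erule runs_mono, simp, simp)
qed

text \<open>If the first output consists of \<open>k\<close> times \<open>True\<close> and the
  second is \<open>u\<close>, the result is \<open>enc_instance u k\<close>; this is how a parameter
  bound is put in front of a word.\<close>

definition joinp :: "nat \<Rightarrow> nat \<Rightarrow> prog \<Rightarrow> prog \<Rightarrow> prog" where
  "joinp n m P Q = mvp 0 (n + m) ;; mv2p (n + m) 0 n ;; P ;; shiftp n Q ;; mvp 0 (n + m) ;;
     mvp n (n + m + 1) ;; actp 0 (\<lambda>_. None) MoveS ;; mvp (n + m + 1) 0 ;; pushp 0 False ;; mvp (n + m) 0"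

lemma uses_joinp:
  assumes "uses n P" "uses m Q" "0 < n"
  shows "uses (n + m + 2) (joinp n m P Q)"
  unfolding joinp_def using assms(3)
  by (intro uses_seq uses_basic uses_act uses_mono[OF assms(1)] uses_shift[OF assms(2)]) auto

lemma computes_joinp:
  assumes "uses n P" "uses m Q" "0 < n" "0 < m" "computes P w T v" "computes Q w T' u"
  shows "computes (joinp n m P Q) w (T + T' + 12 * length w + 10 * (length v + length u) + 9) (v @ False # u)"
proof -
  let ?z = "n + m" and ?E = "(\<lambda>_. []) :: regs"
  from assms(5) obtain s1 where s1: "runs P (start w) T s1" "tape_holds (s1 0) v"
    unfolding computes_def by blast
  from assms(6) obtain s' where s': "runs Q (start w) T' s'" "tape_holds (s' 0) u"
    unfolding computes_def by blast
  have out': "s' i = input_tape []" if "m \<le> i" for i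
    using runs_outside[OF assms(2) s'(1) that] that assms(4) by (simp add: start_simps)
  have a1: "runs (mvp 0 ?z) (start w) (5 * length w + 1) (st (?E(?z := rev w)))"
    unfolding st_reg[symmetric] by (rule rruns_mv) (use assms(3) in \<open>auto simp: reg_def\<close>)
  let ?s = "st (?E(0 := w, n := w))"
  have a2: "runs (mv2p ?z 0 n) (st (?E(?z := rev w))) (7 * length w + 1) ?s"
    by (rule rruns_mv2) (use assms(3,4) in \<open>auto simp: fun_eq_iff\<close>)
  define s2 where "s2 = (\<lambda>i. if i < n then s1 i else ?s i)"
  have a3: "runs P ?s T s2"
    unfolding s2_def by (rule runs_frame[OF assms(1) s1(1)]) (simp add: st_def start_def)
  have "(\<lambda>i. s2 (i + n)) = start w"
    using assms(3) by (auto simp: fun_eq_iff s2_def st_def start_def)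
  with s'(1) have "runs Q (\<lambda>i. s2 (i + n)) T' s'" by simp
  note a4 = runs_shift[OF this]
  define s4 where "s4 = (\<lambda>i. if i < n then s2 i else s' (i - n))"
  have h4: "tape_holds (s4 0) v" "tape_holds (s4 n) u" "s4 ?z = input_tape []" "s4 (?z + 1) = input_tape []"
    using s1(2) s'(2) out'[of m] out'[of "m + 1"] assms(3) by (auto simp: s4_def s2_def)
  define s5 where "s5 = s4(0 := (popt ^^ length v) (s4 0), ?z := input_tape (rev v))"
  have a5: "runs (mvp 0 ?z) s4 (5 * length v + 1) s5"
    by (rule runs_mv_to[where xs = v]) (use assms(3) h4 in \<open>auto simp: s5_def\<close>)
  have h5: "tape_holds (s5 n) u" "s5 (?z + 1) = input_tape []"
    using h4 assms(3,4) by (auto simp: s5_def)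
  define s6 where "s6 = s5(n := (popt ^^ length u) (s5 n), ?z + 1 := input_tape (rev u))"
  have a6: "runs (mvp n (?z + 1)) s5 (5 * length u + 1) s6"
    by (rule runs_mv_to[where xs = u]) (use h5 in \<open>auto simp: s6_def\<close>)
  define s7 where "s7 = s6(0 := tape_act (s6 0) (None, MoveS))"
  have a7: "runs (actp 0 (\<lambda>_. None) MoveS) s6 1 s7"
    unfolding s7_def by (rule runs_act)
  have h7: "tape_holds (s7 (?z + 1)) (rev u)" "tape_holds (s7 0) []" "s7 ?z = input_tape (rev v)"
    using assms(3,4) by (auto simp: s7_def s6_def s5_def tape_holds_input tape_holds_blank)
  define s8 where "s8 = s7(?z + 1 := (popt ^^ length (rev u)) (s7 (?z + 1)), 0 := fold pusht (rev u) (s7 0))"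
  have a8: "runs (mvp (?z + 1) 0) s7 (5 * length (rev u) + 1) s8"
    unfolding s8_def by (intro runs_mv_to[where xs = "rev u"] h7(1)) auto
  have h8: "tape_holds (s8 0) u" "s8 ?z = input_tape (rev v)"
    using tape_holds_fold_pusht[OF h7(2), of "rev u"] h7(3) assms(3) by (auto simp: s8_def)
  define s9 where "s9 = s8(0 := pusht False (s8 0))"
  have a9: "runs (pushp 0 False) s8 2 s9" unfolding s9_def by (rule runs_push)
  have h9: "tape_holds (s9 0) (False # u)" "tape_holds (s9 ?z) (rev v)"
    using tape_holds_push[OF h8(1)] h8(2) assms(3) by (auto simp: s9_def tape_holds_input)
  define s10 where "s10 = s9(?z := (popt ^^ length (rev v)) (s9 ?z), 0 := fold pusht (rev v) (s9 0))"
  have a10: "runs (mvp ?z 0) s9 (5 * length (rev v) + 1) s10"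
    unfolding s10_def using assms(3) by (intro runs_mv_to[where xs = "rev v"] h9(2)) auto
  have "tape_holds (s10 0) (v @ False # u)"
    using tape_holds_fold_pusht[OF h9(1), of "rev v"] by (simp add: s10_def)
  moreover have "runs (joinp n m P Q) (start w)
     ((5 * length w + 1) + ((7 * length w + 1) + (T + (T' + ((5 * length v + 1) + ((5 * length u + 1) +
      (1 + ((5 * length (rev u) + 1) + (2 + (5 * length (rev v) + 1)))))))))) s10"
    unfolding joinp_def
    by (rule runs_seq[OF a1 runs_seq[OF a2 runs_seq[OF a3 runs_seq[OF a4[folded s4_def]
        runs_seq[OF a5 runs_seq[OF a6 runs_seq[OF a7 runs_seq[OF a8 runs_seq[OF a9 a10]]]]]]]]])
  ultimately show ?thesis unfolding computes_def
    by (intro exI[of _ s10] conjI) (erule runs_mono, simp, simp)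
qed

text \<open>A time bound also bounds the output of an arbitrary machine: relative to the head, a
  step extends the nonblank part of tape 0 by at most one cell to the right.\<close>

lemma computes_length:
  assumes "computes P w T v"
  shows "length v \<le> length w + T + 1"
proof -
  have inv: "snd ((pstep P ^^ t) (0, start w)) 0 i \<noteq> None \<Longrightarrow> i \<le> int (length w + t)" for t i
  proof (induction t arbitrary: i)
    case 0
    then show ?case by (auto simp: start_def input_tape_def split: if_splits)
  next
    case (Suc t)
    let ?c = "(pstep P ^^ t) (0, start w)"
    show ?case
    proof (cases "fst P \<le> fst ?c")
      case True
      then have "(pstep P ^^ Suc t) (0, start w) = ?c" by (simp add: pstep_def)
      with Suc show ?thesis by force
    next
      case False
      let ?a = "snd (snd P (fst ?c) (\<lambda>i. snd ?c i 0)) 0"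
      have "snd ((pstep P ^^ Suc t) (0, start w)) 0 i = ((snd ?c 0)(0 := fst ?a)) (i + move_offset (snd ?a))"
        using False by (simp add: pstep_def Let_def tape_act_def)
      with Suc.prems have "i + move_offset (snd ?a) = 0 \<or> snd ?c 0 (i + move_offset (snd ?a)) \<noteq> None"
        by (auto split: if_splits)
      moreover have "\<bar>move_offset (snd ?a)\<bar> \<le> 1" by (cases "snd ?a") auto
      ultimately show ?thesis using Suc.IH[of "i + move_offset (snd ?a)"] by auto
    qed
  qed
  from assms obtain t s' where t: "t \<le> T" "(pstep P ^^ t) (0, start w) = (fst P, s')" "tape_holds (s' 0) v"
    by (auto simp: computes_def runs_def)
  show ?thesis
  proof (cases "v = []")
    case False
    then have "s' 0 (int (length v - 1)) \<noteq> None" using t(3) by (auto simp: tape_holds_def)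
    then have "int (length v - 1) \<le> int (length w + t)" using inv[of t "int (length v - 1)"] t(2) by simp
    then show ?thesis using t(1) by linarith
  qed simp
qed

section \<open>Computable functions\<close>

lemma computable_funI:
  assumes "uses n P" "0 < n" "\<And>k. computes P (replicate k True) (T k) (replicate (f k) True)"
  shows "computable_fun f"
  unfolding computable_fun_def
  using tm_wf_to_tm[OF assms(2)] computes_to_tm[OF assms(1,2,3)] by blast

lemma computable_funE:
  assumes "computable_fun f"
  obtains P n T where "uses n P" "0 < n" "\<And>k. computes P (replicate k True) (T k) (replicate (f k) True)"
proof -
  from assms obtain M where M: "tm_wf M" "\<forall>k. \<exists>T. tm_computes M (replicate k True) T (replicate (f k) True)"
    unfolding computable_fun_def by blast
  from M(2) obtain T where T: "\<And>k. tm_computes M (replicate k True) (T k) (replicate (f k) True)" by metis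
  show thesis
    by (rule that[OF uses_of_tm tm_tapes_pos[OF M(1)] computes_of_tm[OF M(1) T]])
qed

lemma computable_comp:
  assumes "computable_fun f" "computable_fun g"
  shows "computable_fun (\<lambda>k. g (f k))"
proof -
  from assms(1) obtain P n T where P: "uses n P" "0 < n"
    "\<And>k. computes P (replicate k True) (T k) (replicate (f k) True)" by (rule computable_funE) (rule that)
  from assms(2) obtain Q m T' where Q: "uses m Q" "0 < m"
    "\<And>k. computes Q (replicate k True) (T' k) (replicate (g k) True)" by (rule computable_funE) (rule that)
  show ?thesis
    by (rule computable_funI[OF uses_thenp[OF P(1) Q(1) P(2)] _ computes_thenp[OF P(1) Q(1) P(2) Q(2) P(3) Q(3)]]) simp
qed

lemma poly_unary_program:
  assumes "poly F"
  obtains P n c where "uses n P" "0 < n"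
    "\<And>w. computes P w ((length w + 2) ^ c) (replicate (F w) True)"
proof -
  have "poly (\<lambda>w. replicate (F w) True)" by (intro poly_intros assms)
  then obtain P n c where "uses n P" "0 < n"
    "\<And>w. computes P w ((length w + 2) ^ c) (replicate (F w) True)" by (rule word_program) (rule that)
  then show thesis by (rule that)
qed

lemma computable_poly:
  assumes "poly (F :: nat \<Rightarrow> nat)" shows "computable_fun F"
proof -
  have "poly (\<lambda>w :: bool list. F (length w))" by (intro poly_comp[OF _ assms] poly_intros)
  then obtain P n c where P: "uses n P" "0 < n"
    "\<And>w. computes P w ((length w + 2) ^ c) (replicate (F (length w)) True)"
    by (rule poly_unary_program) (rule that)
  show ?thesis
  proof (rule computable_funI[OF P(1,2)])
    show "computes P (replicate k True) ((length (replicate k True) + 2) ^ c) (replicate (F k) True)" for k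
      using P(3)[of "replicate k True"] by simp
  qed
qed

text \<open>The two unary outputs are joined with a separating \<open>False\<close>, from which a
  polynomial-time program reads both numbers.\<close>

lemma computable_poly2:
  assumes f: "computable_fun f" and g: "computable_fun g" and F: "poly (\<lambda>p. F (fst p) (snd p))"
  shows "computable_fun (\<lambda>k. F (f k) (g k))"
proof -
  from f obtain P n T where P: "uses n P" "0 < n"
    "\<And>k. computes P (replicate k True) (T k) (replicate (f k) True)" by (rule computable_funE) (rule that)
  from g obtain Q m T' where Q: "uses m Q" "0 < m"
    "\<And>k. computes Q (replicate k True) (T' k) (replicate (g k) True)" by (rule computable_funE) (rule that)
  have "poly (\<lambda>w. F (fst (parse_nat w)) (length (snd (parse_nat w))))"
    by (intro poly_comp2[OF F] poly_intros)
  then obtain R l c where R: "uses l R" "0 < l"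
    "\<And>w. computes R w ((length w + 2) ^ c) (replicate (F (fst (parse_nat w)) (length (snd (parse_nat w)))) True)"
    by (rule poly_unary_program) (rule that)
  have eq: "F (fst (parse_nat (replicate a True @ False # replicate b True)))
      (length (snd (parse_nat (replicate a True @ False # replicate b True)))) = F a b" for a b
    using parse_nat_enc_instance[of "replicate b True" a] by (simp add: enc_instance_def)
  note J = computes_joinp[OF P(1) Q(1) P(2) Q(2) P(3) Q(3)]
  note uJ = uses_joinp[OF P(1) Q(1) P(2)]
  have J0: "0 < n + m + 2" by simp
  show ?thesis
    by (rule computable_funI[OF uses_thenp[OF uJ R(1) J0] _ computes_thenp[OF uJ R(1) J0 R(2) J R(3), unfolded eq]]) simp
qed

text \<open>Tape \<open>n\<close>, just beyond the tapes of \<open>P\<close>, receives a mark in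
  every step and thus holds the number of steps in unary.\<close>

definition clockp :: "nat \<Rightarrow> prog \<Rightarrow> prog" where
  "clockp n P = (fst P, \<lambda>q rd. let r = snd P q rd in (fst r, (snd r)(n := (Some True, MoveL))))"

text \<open>The head stands on the blank left of the \<open>t\<close> marks; one move to the right
  makes the marks an ordinary word.\<close>

definition clock_tape :: "nat \<Rightarrow> tape" where
  "clock_tape t = (\<lambda>i. if 1 \<le> i \<and> i \<le> int t then Some True else None)"

lemma clock_tape_act: "tape_act (clock_tape t) (Some True, MoveL) = clock_tape (Suc t)"
  by (auto simp: fun_eq_iff tape_act_def clock_tape_def)

lemma clock_tape_right: "tape_act (clock_tape t) (clock_tape t 0, MoveR) = input_tape (replicate t True)"
  by (auto simp: fun_eq_iff tape_act_def clock_tape_def input_tape_def)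

lemma uses_clockp:
  assumes "uses n P" shows "uses (Suc n) (clockp n P)"
  unfolding uses_def
proof (intro allI conjI impI)
  fix q and rd :: "nat \<Rightarrow> symb" and i assume "Suc n \<le> i"
  then show "snd (snd (clockp n P) q rd) i = (rd i, MoveS)"
    using uses_cong_outside[OF assms] by (simp add: clockp_def Let_def)
next
  fix q and rd rd' :: "nat \<Rightarrow> symb" assume "\<forall>i<Suc n. rd i = rd' i"
  then have *: "\<And>i. i < n \<Longrightarrow> rd i = rd' i" by simp
  show "fst (snd (clockp n P) q rd) = fst (snd (clockp n P) q rd')"
    using uses_cong(1)[OF assms, of rd rd', OF *] by (simp add: clockp_def Let_def)
  show "snd (snd (clockp n P) q rd) i = snd (snd (clockp n P) q rd') i" if "i < Suc n" for i
    using uses_cong(2)[OF assms, of rd rd', OF *] that by (simp add: clockp_def Let_def)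
qed

lemma pstep_clockp:
  assumes "uses n P" "q < fst P"
  shows "pstep (clockp n P) (q, s(n := clock_tape t)) =
     (fst (pstep P (q, s)), (snd (pstep P (q, s)))(n := clock_tape (Suc t)))"
proof -
  let ?rd = "\<lambda>i. (s(n := clock_tape t)) i 0" and ?rd' = "\<lambda>i. s i 0"
  have *: "?rd i = ?rd' i" if "i < n" for i using that by simp
  have 1: "fst (snd P q ?rd) = fst (snd P q ?rd')" by (rule uses_cong(1)[OF assms(1)]) (rule *)
  have 2: "snd (snd P q ?rd) i = snd (snd P q ?rd') i" if "i < n" for i
    by (rule uses_cong(2)[OF assms(1) _ that]) (rule *)
  have 3: "snd (snd P q ?rd) i = (s i 0, MoveS)" "snd (snd P q ?rd') i = (s i 0, MoveS)" if "n < i" for i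
    using uses_cong_outside[OF assms(1), of i q] that by auto
  have "tape_act ((s(n := clock_tape t)) i) (((snd (snd P q ?rd))(n := (Some True, MoveL))) i) =
      ((\<lambda>i. tape_act (s i) (snd (snd P q ?rd') i))(n := clock_tape (Suc t))) i" for i
    using 2[of i] 3[of i] by (cases i n rule: linorder_cases) (auto simp: clock_tape_act)
  then show ?thesis using assms(2) 1 by (simp add: pstep_def clockp_def Let_def fun_eq_iff)
qed

text \<open>The running time of a machine is computable, because the machine can count its own steps.\<close>

lemma computable_running_time:
  assumes "computable_fun g"
  obtains P n T where "uses n P" "0 < n" "computable_fun T"
    "\<And>k. computes P (replicate k True) (T k) (replicate (g k) True)"
proof -
  from assms obtain P n T0 where P: "uses n P" "0 < n"
    "\<And>k. computes P (replicate k True) (T0 k) (replicate (g k) True)" by (rule computable_funE) (rule that)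
  define c where "c k t = (pstep P ^^ t) (0, start (replicate k True))" for k t
  \<comment> \<open>\<open>T0\<close> is some upper bound that need not be computable, whereas the
    clock marks exactly the steps before the first halting time.\<close>
  define T where "T k = (LEAST t. fst P \<le> fst (c k t))" for k
  have ex: "\<exists>t s'. c k t = (fst P, s') \<and> tape_holds (s' 0) (replicate (g k) True)" for k
    using P(3)[of k] by (auto simp: computes_def runs_def c_def)
  have T: "fst P \<le> fst (c k (T k))" for k
  proof -
    from ex[of k] obtain t s' where "c k t = (fst P, s')" by blast
    then have "fst P \<le> fst (c k t)" by simp
    then show ?thesis unfolding T_def by (rule LeastI)
  qed
  have less: "fst (c k t) < fst P" if "t < T k" for k t
    using not_less_Least[of t "\<lambda>t. fst P \<le> fst (c k t)"] that by (simp add: T_def)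
  have halt: "\<exists>s'. c k (T k) = (fst P, s') \<and> tape_holds (s' 0) (replicate (g k) True)" for k
  proof -
    from ex[of k] obtain t s' where t: "c k t = (fst P, s')" "tape_holds (s' 0) (replicate (g k) True)" by blast
    have "T k \<le> t" using less[of t k] t(1) by (cases "T k \<le> t") auto
    have "pstep P (c k (T k)) = c k (T k)" using T[of k] by (simp add: pstep_def)
    then have "(pstep P ^^ (t - T k)) (c k (T k)) = c k (T k)" by (rule funpow_fixpoint)
    moreover have "(pstep P ^^ (t - T k)) (c k (T k)) = c k t"
      using \<open>T k \<le> t\<close> by (simp add: c_def flip: funpow_add[unfolded comp_def, THEN fun_cong])
    ultimately have "c k (T k) = (fst P, s')" using t(1) by simp
    then show ?thesis using t(2) by blast
  qed
  have run: "computes P (replicate k True) (T k) (replicate (g k) True)" for k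
    using halt[of k] by (auto simp: computes_def runs_def c_def)
  let ?R = "clockp n P ;; actp n (\<lambda>x. x) MoveR ;; actp 0 (\<lambda>_. None) MoveS ;; mvp n (n + 1) ;; mvp (n + 1) 0"
  have clock: "computes ?R (replicate k True) (T k + (1 + (1 + ((5 * T k + 1) + (5 * T k + 1))))) (replicate (T k) True)" for k
  proof -
    define w where "w = replicate (T k) True"
    have w: "length w = T k" "rev w = w" by (simp_all add: w_def)
    have blank: "start (replicate k True) = (start (replicate k True))(n := clock_tape 0)"
      using P(2) by (auto simp: fun_eq_iff start_def clock_tape_def input_tape_def)
    have steps: "(pstep (clockp n P) ^^ t) (0, start (replicate k True)) = (fst (c k t), (snd (c k t))(n := clock_tape t))"
      if "t \<le> T k" for t
      using that
    proof (induction t)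
      case 0
      show ?case using blank by (simp add: c_def)
    next
      case (Suc t)
      then have "fst (c k t) < fst P" by (intro less) simp
      from pstep_clockp[OF P(1) this, of "snd (c k t)" t] Suc show ?case
        by (simp add: c_def fun_upd_def)
    qed
    obtain s where s: "c k (T k) = (fst P, s)" using halt[of k] by blast
    have "fst (clockp n P) = fst P" by (simp add: clockp_def)
    with steps[of "T k"] s have 1: "runs (clockp n P) (start (replicate k True)) (T k) (s(n := clock_tape (T k)))"
      unfolding runs_def by (intro exI[of _ "T k"]) simp
    let ?s1 = "s(n := input_tape w)"
    have 2: "runs (actp n (\<lambda>x. x) MoveR) (s(n := clock_tape (T k))) 1 ?s1"
      by (rule runs_cong[OF runs_act]) (auto simp: clock_tape_right w_def)
    let ?s2 = "?s1(0 := tape_act (?s1 0) (None, MoveS))"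
    have 3: "runs (actp 0 (\<lambda>_. None) MoveS) ?s1 1 ?s2" by (rule runs_act)
    have out: "s (n + 1) = input_tape []"
    proof -
      have "runs P (start (replicate k True)) (T k) s" using s by (auto simp: runs_def c_def)
      from runs_outside[OF P(1) this, of "n + 1"] show ?thesis by (simp add: start_simps)
    qed
    let ?s3 = "?s2(n := input_tape [], n + 1 := input_tape w)"
    have h2: "tape_holds (?s2 n) w" using P(2) by (simp add: tape_holds_input)
    have 4: "runs (mvp n (n + 1)) ?s2 (5 * T k + 1) ?s3"
      by (rule runs_mv_to[where xs = w], rule h2) (use P(2) out w in auto)
    have h3: "tape_holds (?s3 (n + 1)) w" by (simp add: tape_holds_input)
    have 5: "runs (mvp (n + 1) 0) ?s3 (5 * length w + 1)
       (?s3(n + 1 := (popt ^^ length w) (?s3 (n + 1)), 0 := fold pusht w (?s3 0)))"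
      by (rule runs_mv_to[where xs = w], rule h3) auto
    have "tape_holds (?s3 0) []" using P(2) tape_holds_blank by simp
    from tape_holds_fold_pusht[OF this, of w]
    have "tape_holds ((?s3(n + 1 := (popt ^^ length w) (?s3 (n + 1)), 0 := fold pusht w (?s3 0))) 0) w"
      by (simp add: w)
    moreover note runs_seq[OF 1 runs_seq[OF 2 runs_seq[OF 3 runs_seq[OF 4 5]]]]
    ultimately show ?thesis unfolding computes_def w_def[symmetric]
      by (intro exI conjI) (erule runs_mono, simp add: w, assumption)
  qed
  have "uses (n + 2) ?R"
    by (intro uses_seq uses_basic uses_act uses_mono[OF uses_clockp[OF P(1)]]) auto
  from computable_funI[OF this _ clock] have "computable_fun T" by simp
  from that[OF P(1,2) this run] show thesis .
qed

section \<open>The two inclusions\<close>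

lemma computable_add:
  assumes "computable_fun f" "computable_fun g" shows "computable_fun (\<lambda>k. f k + g k)"
  by (rule computable_poly2[OF assms, where F = "(+)"]) (intro poly_intros)

lemma enc_instance_pos: "0 < length (enc_instance x k)" "k \<le> length (enc_instance x k)"
  by (auto simp: enc_instance_def)

text \<open>The targets for yes and no in \<open>FPT_subset_W2\<close>: circuits without inputs,
  with weight 0.\<close>

lemma constant_circuits:
  "(enc_list enc_gate [AndG []], 0) \<in> weighted_circuit_sat 2 1"
  "(enc_list enc_gate [OrG []], 0) \<notin> weighted_circuit_sat 2 1"
proof -
  have "circuit_wf [AndG []]" "circuit_weft [AndG []] \<le> 2" "circuit_depth [AndG []] \<le> 1" "circuit_sat [AndG []] {}"
    by (auto simp: circuit_wf_def circuit_weft_def circuit_depth_def circuit_sat_def node_values_def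
        gate_weft_def gate_depth_def large_gate_def)
  then show "(enc_list enc_gate [AndG []], 0) \<in> weighted_circuit_sat 2 1"
    unfolding weighted_circuit_sat_def by (auto intro!: exI[of _ "[AndG []]"] exI[of _ "{}"])
  show "(enc_list enc_gate [OrG []], 0) \<notin> weighted_circuit_sat 2 1"
  proof
    assume "(enc_list enc_gate [OrG []], 0) \<in> weighted_circuit_sat 2 1"
    then obtain C S where C: "enc_list enc_gate [OrG []] = enc_list enc_gate C" "circuit_sat C S"
      unfolding weighted_circuit_sat_def by blast
    then have "[OrG []] = C" using parse_circuit_enc by metis
    with C(2) show False by (auto simp: circuit_sat_def node_values_def)
  qed
qed

text \<open>The machine that decides \<open>L\<close> is followed by a program that turns its bit
  into one of the two constant circuits; the new parameter is 0.\<close>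

lemma FPT_subset_W2: "FPT \<subseteq> W_class 2"
proof
  fix L assume "L \<in> FPT"
  then obtain M f c where M: "tm_wf M" "computable_fun f"
    "\<And>x k. tm_computes M (enc_instance x k) (f k * length (enc_instance x k) ^ c) [(x, k) \<in> L]"
    unfolding FPT_def by blast
  define out where "out b = enc_instance (enc_list enc_gate [if b then AndG [] else OrG []]) 0" for b
  have "poly (\<lambda>w. if w = [True] then out True else out False)" by (intro poly_intros)
  then obtain H m ch where H: "uses m H" "0 < m"
    "\<And>w. computes H w ((length w + 2) ^ ch) (if w = [True] then out True else out False)"
    by (rule word_program) (rule that)
  have Hb: "computes H [b] (3 ^ ch) (out b)" for b
    using H(3)[of "[b]"] by (simp add: numeral_3_eq_3 split: if_splits)
  let ?n = "tm_tapes M"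
  \<comment> \<open>Time for \<open>H\<close> on a single bit and for copying; being constant, it is
    absorbed in the factor that depends on \<open>k\<close>.\<close>
  define K where "K = 3 ^ ch + 10 * (1 + (length (out True) + length (out False))) + 5"
  note tp = tm_tapes_pos[OF M(1)]
  let ?R = "thenp ?n m (of_tm M) H"
  have uR: "uses (?n + m + 1) ?R" by (rule uses_thenp[OF uses_of_tm H(1) tp])
  have run: "tm_computes (to_tm (?n + m + 1) ?R) (enc_instance x k)
      ((f k + K) * length (enc_instance x k) ^ c) (out ((x, k) \<in> L))" for x k
  proof (rule computes_to_tm[OF uR])
    let ?N = "length (enc_instance x k)" and ?b = "(x, k) \<in> L"
    have "computes ?R (enc_instance x k) (f k * ?N ^ c + 3 ^ ch + 10 * (length [?b] + length (out ?b)) + 5) (out ?b)"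
      by (rule computes_thenp[OF uses_of_tm H(1) tp H(2) computes_of_tm[OF M(1,3)] Hb])
    moreover have "length (out ?b) \<le> length (out True) + length (out False)" by (cases ?b) auto
    moreover have "K \<le> K * ?N ^ c" using enc_instance_pos(1)[of x k]
      by (simp add: Suc_le_eq)
    ultimately show "computes ?R (enc_instance x k) ((f k + K) * ?N ^ c) (out ?b)"
      by (elim computes_mono) (simp add: K_def add_mult_distrib)
  qed simp
  have "computable_fun (\<lambda>k. f k + K)"
    by (rule computable_add[OF M(2) computable_poly[OF poly_const]])
  moreover have "computable_fun (\<lambda>_. 0)" by (rule computable_poly[OF poly_const])
  moreover have "(enc_list enc_gate [if b then AndG [] else OrG []], 0) \<in> weighted_circuit_sat 2 1 \<longleftrightarrow> b" for b
    using constant_circuits by (cases b) auto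
  moreover have "tm_wf (to_tm (?n + m + 1) ?R)" by (rule tm_wf_to_tm) simp
  ultimately have "fpt_reducible L (weighted_circuit_sat 2 1)"
    unfolding fpt_reducible_def using run unfolding out_def by (metis order_refl)
  then show "L \<in> W_class 2" unfolding W_class_def by blast
qed

text \<open>The word \<open>replicate (g k) True\<close> is put in front of the instance produced by
  \<open>MR\<close>; the reduction to stars follows, then the assumed algorithm, whose first output
  bit says whether a solution exists.\<close>

lemma W2_subset_FPT:
  assumes "conscheck_matching_admits_fpt_algorithm"
  shows "W_class 2 \<subseteq> FPT"
proof
  fix L assume "L \<in> W_class 2"
  then obtain d where "fpt_reducible L (weighted_circuit_sat 2 d)" unfolding W_class_def by blast
  then obtain MR f g c where R: "tm_wf MR" "computable_fun f" "computable_fun g"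
    "\<And>x k. \<exists>x' k'. tm_computes MR (enc_instance x k) (f k * length (enc_instance x k) ^ c) (enc_instance x' k') \<and>
       k' \<le> g k \<and> ((x, k) \<in> L \<longleftrightarrow> (x', k') \<in> weighted_circuit_sat 2 d)"
    unfolding fpt_reducible_def by blast
  from assms obtain MA fA cA where A: "tm_wf MA" "computable_fun fA"
    "\<And>n smp k. valid_samples n smp \<Longrightarrow> \<exists>ans. tm_computes MA (enc_instance (enc_samples n smp) k)
       (fA k * length (enc_instance (enc_samples n smp) k) ^ cA) (enc_answer ans) \<and> correct_answer n smp k ans"
    unfolding conscheck_matching_admits_fpt_algorithm_def by blast
  \<comment> \<open>The time for computing \<open>g\<close> enters the factor of the final running
    time that has to be computable.\<close>
  from R(3) obtain Pg ng Tg where G: "uses ng Pg" "0 < ng" "computable_fun Tg"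
    "\<And>k. computes Pg (replicate k True) (Tg k) (replicate (g k) True)"
    by (rule computable_running_time) (rule that)
  have "poly (\<lambda>w. takeWhile (\<lambda>b. b) w)" by (intro poly_intros)
  then obtain P1 n1 c1 where P1: "uses n1 P1" "0 < n1"
    "\<And>w. computes P1 w ((length w + 2) ^ c1) (takeWhile (\<lambda>b. b) w)"
    by (rule word_program) (rule that)
  from poly_reduction[of d] obtain P2 n2 c2 where P2: "uses n2 P2" "0 < n2"
    "\<And>w. computes P2 w ((length w + 2) ^ c2) (reduction d w)"
    "\<And>w. length (reduction d w) \<le> (length w + 2) ^ c2"
    by (rule word_program) (rule that)
  \<comment> \<open>The first bit of \<open>enc_answer\<close> tells a solution from the report that
    there is none.\<close>
  have "poly (\<lambda>w. [hd w] :: bool list)" by (intro poly_intros)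
  then obtain P3 n3 c3 where P3: "uses n3 P3" "0 < n3"
    "\<And>w. computes P3 w ((length w + 2) ^ c3) [hd w]"
    by (rule word_program) (rule that)
  note tR = tm_tapes_pos[OF R(1)] and tA = tm_tapes_pos[OF A(1)]
  let ?nG = "n1 + ng + 1" and ?PG = "thenp n1 ng P1 Pg"
  have uG: "uses ?nG ?PG" "0 < ?nG" by (rule uses_thenp[OF P1(1) G(1) P1(2)], simp)
  let ?nJ = "?nG + tm_tapes MR + 2" and ?PJ = "joinp ?nG (tm_tapes MR) ?PG (of_tm MR)"
  have uJ: "uses ?nJ ?PJ" "0 < ?nJ" by (rule uses_joinp[OF uG(1) uses_of_tm uG(2)], simp)
  let ?nQ = "?nJ + n2 + 1" and ?PQ = "thenp ?nJ n2 ?PJ P2"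
  have uQ: "uses ?nQ ?PQ" "0 < ?nQ" by (rule uses_thenp[OF uJ(1) P2(1) uJ(2)], simp)
  let ?nA = "?nQ + tm_tapes MA + 1" and ?PA = "thenp ?nQ (tm_tapes MA) ?PQ (of_tm MA)"
  have uA: "uses ?nA ?PA" "0 < ?nA" by (rule uses_thenp[OF uQ(1) uses_of_tm uQ(2)], simp)
  let ?nH = "?nA + n3 + 1" and ?PH = "thenp ?nA n3 ?PA P3"
  have uH: "uses ?nH ?PH" "0 < ?nH" by (rule uses_thenp[OF uA(1) P3(1) uA(2)], simp)
  define K where "K m = Suc ((m + 2) ^ term_width d)" for m
  \<comment> \<open>Collects the factors that depend on \<open>k\<close> alone; the summand 2
    guarantees \<open>U k \<ge> 2\<close>, which is used when the final bound is put into the form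
    of a product.\<close>
  define U where "U k = Tg k + f k + g k + fA (K (g k)) + 2" for k
  have "poly K" unfolding K_def[abs_def] by (intro poly_intros)
  from computable_comp[OF computable_comp[OF R(3) computable_poly[OF this]] A(2)]
  have "computable_fun (\<lambda>k. fA (K (g k)))" .
  then have compU: "computable_fun U"
    unfolding U_def[abs_def] by (intro computable_add G(3) R(2,3) computable_poly[OF poly_const])
  \<comment> \<open>Length bounds in terms of \<open>b\<close>: the output of \<open>MR\<close>, the
    input and the output of the reduction, the answer of the algorithm.\<close>
  define bV bW bO bA where "bV b = 2 * b + 1" and "bW b = b + (1 + bV b)" and
    "bO b = (bW b + 2) ^ c2" and "bA b = bO b + b * bO b ^ cA + 1" for b :: nat
  define tG tJ tQ tM tH where "tG b = (b + 2) ^ c1 + b + 10 * (b + b) + 5" and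
    "tJ b = tG b + b + 12 * b + 10 * (b + bV b) + 9" and
    "tQ b = tJ b + (bW b + 2) ^ c2 + 10 * (bW b + bO b) + 5" and
    "tM b = tQ b + b * bO b ^ cA + 10 * (bO b + bA b) + 5" and
    "tH b = tM b + (bA b + 2) ^ c3 + 10 * (bA b + 1) + 5" for b :: nat
  have "polyb tH"
    unfolding tH_def tM_def tQ_def tJ_def tG_def bA_def bO_def bW_def bV_def by (intro polyb_intros)
  then obtain E where E: "\<And>b. tH b \<le> (b + 2) ^ E" unfolding polyb_def by blast
  have run: "computes ?PH (enc_instance x k) (tH (U k * length (enc_instance x k) ^ Suc c)) [(x, k) \<in> L]" for x k
  proof -
    \<comment> \<open>The single quantity \<open>b\<close> dominates the input length and the terms
      \<open>Tg k\<close>, \<open>g k\<close>, \<open>f k * N ^ c\<close> and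
      \<open>fA (K (g k))\<close>; all further bounds are polynomials in \<open>b\<close>.\<close>
    define w N b where "w = enc_instance x k" and "N = length (enc_instance x k)" and "b = U k * N ^ Suc c"
    have N: "1 \<le> N" "k \<le> N" using enc_instance_pos(1)[of x k] enc_instance_pos(2)[of k x]
      by (auto simp: N_def Suc_le_eq)
    have le: "q * N ^ c \<le> b" "q \<le> b" if "q \<le> U k" for q
    proof -
      have "N ^ c \<le> N ^ Suc c" using N by simp
      then show "q * N ^ c \<le> b" unfolding b_def using that by (rule mult_le_mono[rotated])
      have "q * 1 \<le> U k * N ^ Suc c" using that N by (intro mult_le_mono) auto
      then show "q \<le> b" by (simp add: b_def)
    qed
    have "1 * N \<le> U k * N ^ Suc c" using N by (intro mult_le_mono) (auto simp: U_def)
    then have Nb: "N \<le> b" by (simp add: b_def)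
    have lb: "Tg k \<le> b" "f k * N ^ c \<le> b" "g k \<le> b" "fA (K (g k)) \<le> b"
      using le by (auto simp: U_def)
    obtain x' k' where x': "tm_computes MR w (f k * N ^ c) (enc_instance x' k')" "k' \<le> g k"
      "(x, k) \<in> L \<longleftrightarrow> (x', k') \<in> weighted_circuit_sat 2 d"
      using R(4)[of x k] unfolding w_def N_def by blast
    have "computes P1 w ((N + 2) ^ c1) (replicate k True)"
      using P1(3)[of w] by (simp add: w_def N_def enc_instance_def takeWhile_unary)
    from computes_thenp[OF P1(1) G(1) P1(2) G(2) this G(4)[of k]]
    have runG: "computes ?PG w (tG b) (replicate (g k) True)"
    proof (rule computes_mono)
      have "(N + 2) ^ c1 \<le> (b + 2) ^ c1" using Nb by (intro power_mono) auto
      then show "(N + 2) ^ c1 + Tg k + 10 * (length (replicate k True) + length (replicate (g k) True)) + 5 \<le> tG b"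
        unfolding tG_def using lb N Nb by simp
    qed
    define v where "v = enc_instance x' k'"
    have runR: "computes (of_tm MR) w b v"
      unfolding v_def by (rule computes_mono[OF computes_of_tm[OF R(1) x'(1)] lb(2)])
    have lv: "length v \<le> bV b"
      using computes_length[OF computes_of_tm[OF R(1) x'(1)]] lb(2) Nb by (simp add: v_def w_def N_def bV_def)
    define y where "y = enc_instance v (g k)"
    have ly: "length y \<le> bW b" using lv lb(3) by (simp add: y_def enc_instance_def bW_def)
    have runJ: "computes ?PJ w (tJ b) y"
      unfolding y_def enc_instance_def
    proof (rule computes_mono[OF computes_joinp[OF uG(1) uses_of_tm uG(2) tR runG runR]])
      show "tG b + b + 12 * length w + 10 * (length (replicate (g k) True) + length v) + 9 \<le> tJ b"
        unfolding tJ_def using lv lb(3) Nb by (simp add: w_def N_def)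
    qed
    from reduction_correct[OF x'(2), of d x'] obtain n smp where
      red: "reduction d y = enc_instance (enc_samples n smp) (K (g k))" "valid_samples n smp"
        "(\<exists>F. conscheck_matching_solution {..<n} (map (\<lambda>(es, l). (edge_set es, l)) smp) (K (g k)) F) \<longleftrightarrow>
          (x', k') \<in> weighted_circuit_sat 2 d"
      unfolding y_def v_def K_def by blast
    define z where "z = reduction d y"
    have "(length y + 2) ^ c2 \<le> bO b" unfolding bO_def using ly by (intro power_mono) auto
    then have lz: "length z \<le> bO b" unfolding z_def using P2(4)[of y] by linarith
    have runQ: "computes ?PQ w (tQ b) z"
      unfolding z_def
    proof (rule computes_mono[OF computes_thenp[OF uJ(1) P2(1) uJ(2) P2(2) runJ P2(3)]])
      show "tJ b + (length y + 2) ^ c2 + 10 * (length y + length (reduction d y)) + 5 \<le> tQ b"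
        unfolding tQ_def using \<open>(length y + 2) ^ c2 \<le> bO b\<close> ly lz by (simp add: z_def bO_def)
    qed
    from A(3)[OF red(2), of "K (g k)"] obtain ans where
      ans: "tm_computes MA z (fA (K (g k)) * length z ^ cA) (enc_answer ans)"
        "correct_answer n smp (K (g k)) ans" unfolding z_def red(1) by blast
    have tb: "fA (K (g k)) * length z ^ cA \<le> b * bO b ^ cA"
      using lb(4) lz by (intro mult_le_mono power_mono) auto
    define u where "u = enc_answer ans"
    have runA: "computes (of_tm MA) z (b * bO b ^ cA) u"
      unfolding u_def by (rule computes_mono[OF computes_of_tm[OF A(1) ans(1)] tb])
    have lu: "length u \<le> bA b"
      using computes_length[OF runA] lz by (simp add: bA_def)
    have runM: "computes ?PA w (tM b) u"
    proof (rule computes_mono[OF computes_thenp[OF uQ(1) uses_of_tm uQ(2) tA runQ runA]])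
      show "tQ b + b * bO b ^ cA + 10 * (length z + length u) + 5 \<le> tM b"
        unfolding tM_def using lz lu by simp
    qed
    have runH: "computes ?PH w (tH b) [hd u]"
    proof (rule computes_mono[OF computes_thenp[OF uA(1) P3(1) uA(2) P3(2) runM P3(3)]])
      have "(length u + 2) ^ c3 \<le> (bA b + 2) ^ c3" using lu by (intro power_mono) auto
      then show "tM b + (length u + 2) ^ c3 + 10 * (length u + length [hd u]) + 5 \<le> tH b"
        unfolding tH_def using lu by simp
    qed
    have "hd u \<longleftrightarrow> (x, k) \<in> L"
      using ans(2) red(3) x'(3) by (cases ans) (auto simp: u_def)
    then show ?thesis using runH by (simp add: w_def b_def N_def)
  qed
  have "tm_computes (to_tm ?nH ?PH) (enc_instance x k)
      ((2 * U k) ^ E * length (enc_instance x k) ^ (Suc c * E)) [(x, k) \<in> L]" for x k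
  proof (rule computes_to_tm[OF uH computes_mono[OF run]])
    define N b where "N = length (enc_instance x k)" and "b = U k * N ^ Suc c"
    have "1 \<le> N ^ Suc c" using enc_instance_pos(1)[of x k]
      by (simp add: N_def Suc_le_eq del: power_Suc)
    then have "2 * 1 \<le> b" unfolding b_def by (intro mult_le_mono) (auto simp: U_def)
    \<comment> \<open>For \<open>b \<ge> 2\<close> the sum \<open>b + 2\<close> is at most
      \<open>2 * b\<close>, a function of \<open>k\<close> times a power of the length; its powers
      have the form that \<open>FPT\<close> requires.\<close>
    then have "(b + 2) ^ E \<le> (2 * b) ^ E" by (intro power_mono) auto
    also have "\<dots> = (2 * U k) ^ E * N ^ (Suc c * E)"
      by (simp only: b_def power_mult_distrib power_mult mult.assoc)
    finally have "tH b \<le> (2 * U k) ^ E * N ^ (Suc c * E)" by (rule order_trans[OF E])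
    then show "tH (U k * length (enc_instance x k) ^ Suc c) \<le>
        (2 * U k) ^ E * length (enc_instance x k) ^ (Suc c * E)" by (simp only: b_def N_def)
  qed
  moreover have "computable_fun (\<lambda>k. (2 * U k) ^ E)"
    by (rule computable_comp[OF compU computable_poly]) (intro poly_intros)
  moreover have "tm_wf (to_tm ?nH ?PH)" by (rule tm_wf_to_tm[OF uH(2)])
  ultimately show "L \<in> FPT"
    unfolding FPT_def mem_Collect_eq
    by (intro exI[of _ "to_tm ?nH ?PH"] exI[of _ "\<lambda>k. (2 * U k) ^ E"] exI[of _ "Suc c * E"] conjI allI)
qed

theorem theorem6:
  assumes "FPT \<noteq> W_class 2"
  shows "\<not> conscheck_matching_admits_fpt_algorithm"
  using assms FPT_subset_W2 W2_subset_FPT by blast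

end
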